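(* Let $\mathcal{H}$ be a Hilbert space. Let $\mathfrak{T}\subset B(\mathcal{H})$ be a unital $\mathrm{C}^*$-subalgebra and let $\mathcal{A}\subset\mathfrak{T}$ be a norm-closed unital subalgebra. Assume that $\mathfrak{T}$ contains the ideal of compact operators on $\mathcal{H}$. Assume also that there is a subspace $\Gamma\subset\mathcal{H}$ consisting of non-cyclic vectors for $\mathcal{A}$ with the property that for every $h\in\mathcal{H}\ominus\Gamma$, there is $h'\in\Gamma$ such that \[\langle ah,h\rangle-\langle ah',h'\rangle=0,\quad a\in\mathcal{A}.\] Then, for every pair of vectors $h,k\in\mathcal{H}$, the functional $t\mapsto\langle th,k\rangle$, $t\in\mathfrak{T}$, lies in $\operatorname{AC}(\Delta_* )$. In particular, the triple $\mathcal{A}\subset\mathfrak{T}\subset B(\mathcal{H})$ is coanalytic.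
   Context: The bidual $\mathfrak{T}^{**}$ is regarded as a von Neumann algebra containing $\mathfrak{T}$ as a weak-$*$ dense $\mathrm{C}^*$-subalgebra. For $\phi\in\mathfrak{T}^*$, $\widehat\phi$ denotes its unique weak-$*$ continuous extension to $\mathfrak{T}^{**}$. There are a unique partial isometry $v_\phi\in\mathfrak{T}^{**}$ and a unique weak-$*$ continuous positive linear functional $|\phi|$ on $\mathfrak{T}^{**}$ with $\widehat\phi(\xi)=|\phi|(\xi v_\phi)$ for $\xi\in\mathfrak{T}^{**}$ and $\mathfrak{T}^{**}(I-v_\phi^*v_\phi)=\{\xi:|\phi|(\xi^*\xi)=0\}$; $|\phi|$ is also identified with its restriction to $\mathfrak{T}$. The adjoint functional is $\phi^\dagger(t)=\overline{\phi(t^* )}$, $t\in\mathfrak{T}$. For $\phi,\psi\in\mathfrak{T}^*$, $\phi\ll\psi$ means: for $\xi\in\mathfrak{T}^{**}$, $|\psi|(\xi^*\xi)=0$ implies $|\phi|(\xi^*\xi)=0$. With $\mathcal{A}^\perp=\{\phi\in\mathfrak{T}^*:\phi|_{\mathcal{A}}=0\}$, $\Delta_*\subset\mathfrak{T}^*$ is the norm closure of the convex hull of $\{|\phi^\dagger|:\phi\in\mathcal{A}^\perp,\|\phi\|=1\}$, and $\operatorname{AC}(\Delta_* )=\{\phi\in\mathfrak{T}^*:\phi\ll\delta\text{ for some }\delta\in\Delta_*\}$. The triple $\mathcal{A}\subset\mathfrak{T}\subset B(\mathcal{H})$ is coanalytic if a bounded net $(b_i)$ in $\mathcal{A}$ converges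 to $0$ in the weak-$*$ topology of $B(\mathcal{H})$ whenever $\lim_i\alpha(b_i^* )=0$ for all $\alpha\in\operatorname{AC}(\Delta_* )$. A vector $x\in\mathcal{H}$ is cyclic for $\mathcal{A}$ if $\{ax:a\in\mathcal{A}\}$ is dense in $\mathcal{H}$. $\mathcal{H}\ominus\Gamma$ is the orthogonal complement of $\Gamma$. *)

theory Defs
  imports "HOL-Analysis.Analysis" "HOL-Library.Function_Algebras"
begin

section \<open>Complex Hilbert spaces\<close>

class scaleC =
  fixes scaleC :: "complex \<Rightarrow> 'a \<Rightarrow> 'a"  (infixr \<open>*\<^sub>C\<close> 75)

text \<open>The complex inner product is linear in the first argument. Its real part is the
  real inner product, so that norm, topology and completeness are those of the library;
  positive definiteness is inherited from \<^class>\<open>real_inner\<close>.\<close>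

class complex_inner = real_inner + scaleC +
  fixes cinner :: "'a \<Rightarrow> 'a \<Rightarrow> complex"
  assumes scaleC_add_right: "c *\<^sub>C (x + y) = c *\<^sub>C x + c *\<^sub>C y"
    and scaleC_add_left: "(c + d) *\<^sub>C x = c *\<^sub>C x + d *\<^sub>C x"
    and scaleC_scaleC: "c *\<^sub>C d *\<^sub>C x = (c * d) *\<^sub>C x"
    and scaleC_of_real: "of_real r *\<^sub>C x = r *\<^sub>R x"
    and cinner_commute: "cinner x y = cnj (cinner y x)"
    and cinner_add_left: "cinner (x + y) z = cinner x z + cinner y z"
    and cinner_scaleC_left: "cinner (c *\<^sub>C x) y = c * cinner x y"
    and inner_eq_Re_cinner: "inner x y = Re (cinner x y)"

class chilbert_space = complex_inner + complete_space

instantiation complex :: chilbert_space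
begin

definition "c *\<^sub>C (z::complex) = c * z"
definition "cinner (x::complex) y = x * cnj y"

instance
  by standard (auto simp: scaleC_complex_def cinner_complex_def algebra_simps scaleR_conv_of_real
      inner_complex_def)

end

lemma norm_scaleC: "norm (c *\<^sub>C x) = cmod c * norm (x::'a::complex_inner)"
proof -
  have "cinner (c *\<^sub>C x) (c *\<^sub>C x) = c * cnj (c * cinner x x)"
    by (subst cinner_scaleC_left, subst cinner_commute) (simp add: cinner_scaleC_left)
  also have "\<dots> = (c * cnj c) * cinner x x"
    using cinner_commute[of x x] by simp
  also have "c * cnj c = complex_of_real ((cmod c)\<^sup>2)"
    by (rule complex_norm_square[symmetric])
  finally have "inner (c *\<^sub>C x) (c *\<^sub>C x) = (cmod c)\<^sup>2 * inner x x"
    by (simp only: inner_eq_Re_cinner Re_complex_of_real times_complex.sel Im_complex_of_real)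
  then show ?thesis
    by (simp add: norm_eq_sqrt_inner real_sqrt_mult)
qed

text \<open>Linear subspaces; they are not required to be closed.\<close>

definition csubspace :: "'h::chilbert_space set \<Rightarrow> bool" where
  "csubspace \<Gamma> \<longleftrightarrow> 0 \<in> \<Gamma> \<and> (\<forall>x\<in>\<Gamma>. \<forall>y\<in>\<Gamma>. x + y \<in> \<Gamma>) \<and> (\<forall>c. \<forall>x\<in>\<Gamma>. c *\<^sub>C x \<in> \<Gamma>)"

definition orth_complement :: "'h::chilbert_space set \<Rightarrow> 'h set" where
  "orth_complement \<Gamma> = {h. \<forall>g\<in>\<Gamma>. cinner h g = 0}"


section \<open>Pointwise vector space structure on functions\<close>

text \<open>Functionals are added and scaled pointwise; the real vector space structure makes the
  library's convex hull available for sets of functionals.\<close>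

instantiation "fun" :: (type, real_vector) real_vector
begin

definition "r *\<^sub>R f = (\<lambda>x. r *\<^sub>R f x)"

instance
  by standard (auto simp: scaleR_fun_def fun_eq_iff algebra_simps)

end

instantiation "fun" :: (type, scaleC) scaleC
begin

definition "c *\<^sub>C f = (\<lambda>x. c *\<^sub>C f x)"

instance ..

end


section \<open>Operators on a Hilbert space\<close>

text \<open>The library's type of bounded linear maps is only real-linear; the algebra of all
  bounded operators is its complex-linear part.\<close>

definition bounded_ops :: "('h::chilbert_space \<Rightarrow>\<^sub>L 'h) set" where
  "bounded_ops = {S. \<forall>c x. blinfun_apply S (c *\<^sub>C x) = c *\<^sub>C blinfun_apply S x}"

instantiation blinfun :: (real_normed_vector, chilbert_space) scaleC
begin

lift_definition scaleC_blinfun :: "complex \<Rightarrow> 'a \<Rightarrow>\<^sub>L 'b \<Rightarrow> 'a \<Rightarrow>\<^sub>L 'b"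
  is "\<lambda>c f x. c *\<^sub>C f x"
proof -
  fix c :: complex and f :: "'a \<Rightarrow> 'b"
  assume f: "bounded_linear f"
  have com: "c *\<^sub>C r *\<^sub>R y = r *\<^sub>R c *\<^sub>C y" for r and y :: 'b
    by (simp add: scaleC_of_real[symmetric] scaleC_scaleC mult.commute)
  obtain K where K: "norm (f x) \<le> norm x * K" for x
    using f bounded_linear.bounded by blast
  show "bounded_linear (\<lambda>x. c *\<^sub>C f x)"
  proof (rule bounded_linear_intro)
    show "norm (c *\<^sub>C f x) \<le> norm x * (cmod c * K)" for x
      using mult_left_mono[OF K[of x], of "cmod c"] by (simp add: norm_scaleC mult.left_commute)
  qed (use f in \<open>simp_all add: bounded_linear.linear linear_add linear_scale scaleC_add_right com\<close>)
qed

instance ..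

end

definition op_adj :: "('h::chilbert_space \<Rightarrow>\<^sub>L 'h) \<Rightarrow> ('h \<Rightarrow>\<^sub>L 'h)" where
  "op_adj S = (THE R. \<forall>x y. cinner (blinfun_apply S x) y = cinner x (blinfun_apply R y))"

definition unital_closed_subalgebra :: "('h::chilbert_space \<Rightarrow>\<^sub>L 'h) set \<Rightarrow> bool" where
  "unital_closed_subalgebra A \<longleftrightarrow>
     A \<subseteq> bounded_ops \<and> closed A \<and> id_blinfun \<in> A \<and>
     (\<forall>a\<in>A. \<forall>b\<in>A. a + b \<in> A \<and> a o\<^sub>L b \<in> A) \<and> (\<forall>c. \<forall>a\<in>A. c *\<^sub>C a \<in> A)"

definition unital_cstar_subalgebra :: "('h::chilbert_space \<Rightarrow>\<^sub>L 'h) set \<Rightarrow> bool" where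
  "unital_cstar_subalgebra T \<longleftrightarrow> unital_closed_subalgebra T \<and> (\<forall>t\<in>T. op_adj t \<in> T)"

definition compact_ops :: "('h::chilbert_space \<Rightarrow>\<^sub>L 'h) set" where
  "compact_ops = {S \<in> bounded_ops. compact (closure (blinfun_apply S ` cball 0 1))}"

definition cyclic_vector :: "('h::chilbert_space \<Rightarrow>\<^sub>L 'h) set \<Rightarrow> 'h \<Rightarrow> bool" where
  "cyclic_vector A x \<longleftrightarrow> closure {blinfun_apply a x |a. a \<in> A} = UNIV"


section \<open>Duals and weak-* topologies\<close>

text \<open>A functional on a carrier set is represented by the function that is extended by \<open>0\<close>
  outside the carrier, so that equality of functionals is equality of functions.\<close>

definition ext0 :: "'v set \<Rightarrow> ('v \<Rightarrow> complex) \<Rightarrow> 'v \<Rightarrow> complex" where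
  "ext0 V f = (\<lambda>x. if x \<in> V then f x else 0)"

definition linear_functional :: "'v::{plus,scaleC} set \<Rightarrow> ('v \<Rightarrow> complex) \<Rightarrow> bool" where
  "linear_functional V \<phi> \<longleftrightarrow>
     (\<forall>x. x \<notin> V \<longrightarrow> \<phi> x = 0) \<and>
     (\<forall>x\<in>V. \<forall>y\<in>V. \<phi> (x + y) = \<phi> x + \<phi> y) \<and> (\<forall>c. \<forall>x\<in>V. \<phi> (c *\<^sub>C x) = c * \<phi> x)"

definition dual_space ::
    "'v::{plus,scaleC} set \<Rightarrow> ('v \<Rightarrow> real) \<Rightarrow> ('v \<Rightarrow> complex) set" where
  "dual_space V nrm =
     {\<phi>. linear_functional V \<phi> \<and> (\<exists>M. \<forall>x\<in>V. cmod (\<phi> x) \<le> M * nrm x)}"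

definition dual_norm :: "'v set \<Rightarrow> ('v \<Rightarrow> real) \<Rightarrow> ('v \<Rightarrow> complex) \<Rightarrow> real" where
  "dual_norm V nrm \<phi> = (SUP x\<in>{x \<in> V. nrm x \<le> 1}. cmod (\<phi> x))"

text \<open>The coarsest topology on \<open>X\<close> for which all members of \<open>F\<close> are continuous.\<close>

definition initial_topology :: "'x set \<Rightarrow> ('x \<Rightarrow> complex) set \<Rightarrow> 'x topology" where
  "initial_topology X F = topology_generated_by {{x \<in> X. f x \<in> U} |f U. f \<in> F \<and> open U}"

text \<open>The predual of the algebra of all bounded operators (the trace class, under the trace
  pairing) consists of the functionals \<open>S \<mapsto> \<Sum>n. \<langle>S (h n), k n\<rangle>\<close> with \<open>h\<close> and \<open>k\<close>
  square summable.\<close>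

definition predual_functionals :: "(('h::chilbert_space \<Rightarrow>\<^sub>L 'h) \<Rightarrow> complex) set" where
  "predual_functionals =
     {\<lambda>S. \<Sum>n. cinner (blinfun_apply S (h n)) (k n) |h k.
        summable (\<lambda>n::nat. (norm (h n))\<^sup>2) \<and> summable (\<lambda>n. (norm (k n))\<^sup>2)}"

definition weak_star_ops :: "('h::chilbert_space \<Rightarrow>\<^sub>L 'h) topology" where
  "weak_star_ops = initial_topology bounded_ops predual_functionals"


section \<open>Dual and bidual of an operator algebra\<close>

type_synonym 'h functional = "('h \<Rightarrow>\<^sub>L 'h) \<Rightarrow> complex"
type_synonym 'h bifunctional = "'h functional \<Rightarrow> complex"

definition dual :: "('h::chilbert_space \<Rightarrow>\<^sub>L 'h) set \<Rightarrow> 'h functional set" where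
  "dual T = dual_space T norm"

definition fnorm :: "('h::chilbert_space \<Rightarrow>\<^sub>L 'h) set \<Rightarrow> 'h functional \<Rightarrow> real" where
  "fnorm T = dual_norm T norm"

definition bidual :: "('h::chilbert_space \<Rightarrow>\<^sub>L 'h) set \<Rightarrow> 'h bifunctional set" where
  "bidual T = dual_space (dual T) (fnorm T)"

definition embed :: "('h::chilbert_space \<Rightarrow>\<^sub>L 'h) set \<Rightarrow> ('h \<Rightarrow>\<^sub>L 'h) \<Rightarrow> 'h bifunctional" where
  "embed T t = ext0 (dual T) (\<lambda>\<phi>. \<phi> t)"

definition dagger :: "('h::chilbert_space \<Rightarrow>\<^sub>L 'h) set \<Rightarrow> 'h functional \<Rightarrow> 'h functional" where
  "dagger T \<phi> = ext0 T (\<lambda>t. cnj (\<phi> (op_adj t)))"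

text \<open>The von Neumann algebra structure of the bidual: the product is the (first) Arens
  product, i.e. the separately weak-* continuous extension of the product of \<open>T\<close>, and the
  involution is the weak-* continuous extension of the involution of \<open>T\<close>. The vector space
  operations are pointwise.\<close>

definition bmult ::
    "('h::chilbert_space \<Rightarrow>\<^sub>L 'h) set \<Rightarrow> 'h bifunctional \<Rightarrow> 'h bifunctional \<Rightarrow> 'h bifunctional" where
  "bmult T \<xi> \<eta> =
     ext0 (dual T) (\<lambda>\<phi>. \<xi> (ext0 T (\<lambda>a. \<eta> (ext0 T (\<lambda>b. \<phi> (a o\<^sub>L b))))))"

definition bstar ::
    "('h::chilbert_space \<Rightarrow>\<^sub>L 'h) set \<Rightarrow> 'h bifunctional \<Rightarrow> 'h bifunctional" where
  "bstar T \<xi> = ext0 (dual T) (\<lambda>\<phi>. cnj (\<xi> (dagger T \<phi>)))"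

definition bone :: "('h::chilbert_space \<Rightarrow>\<^sub>L 'h) set \<Rightarrow> 'h bifunctional" where
  "bone T = embed T id_blinfun"

definition weak_star_bidual ::
    "('h::chilbert_space \<Rightarrow>\<^sub>L 'h) set \<Rightarrow> 'h bifunctional topology" where
  "weak_star_bidual T = initial_topology (bidual T) {\<lambda>\<xi>. \<xi> \<phi> |\<phi>. \<phi> \<in> dual T}"

definition weak_star_functional ::
    "('h::chilbert_space \<Rightarrow>\<^sub>L 'h) set \<Rightarrow> ('h bifunctional \<Rightarrow> complex) \<Rightarrow> bool" where
  "weak_star_functional T \<Phi> \<longleftrightarrow>
     linear_functional (bidual T) \<Phi> \<and> continuous_map (weak_star_bidual T) euclidean \<Phi>"

definition hat ::
    "('h::chilbert_space \<Rightarrow>\<^sub>L 'h) set \<Rightarrow> 'h functional \<Rightarrow> 'h bifunctional \<Rightarrow> complex" where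
  "hat T \<phi> = (THE \<Phi>. weak_star_functional T \<Phi> \<and> (\<forall>t\<in>T. \<Phi> (embed T t) = \<phi> t))"

definition positive_functional ::
    "('h::chilbert_space \<Rightarrow>\<^sub>L 'h) set \<Rightarrow> ('h bifunctional \<Rightarrow> complex) \<Rightarrow> bool" where
  "positive_functional T \<Phi> \<longleftrightarrow> (\<forall>\<xi>\<in>bidual T. \<Phi> (bmult T (bstar T \<xi>) \<xi>) \<in> \<real>\<^sub>\<ge>\<^sub>0)"

definition partial_isometry ::
    "('h::chilbert_space \<Rightarrow>\<^sub>L 'h) set \<Rightarrow> 'h bifunctional \<Rightarrow> bool" where
  "partial_isometry T v \<longleftrightarrow> v \<in> bidual T \<and> bmult T v (bmult T (bstar T v) v) = v"

definition polar_decomposition ::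
    "('h::chilbert_space \<Rightarrow>\<^sub>L 'h) set \<Rightarrow> 'h functional \<Rightarrow> 'h bifunctional \<Rightarrow>
      ('h bifunctional \<Rightarrow> complex) \<Rightarrow> bool" where
  "polar_decomposition T \<phi> v \<Phi> \<longleftrightarrow>
     partial_isometry T v \<and> weak_star_functional T \<Phi> \<and> positive_functional T \<Phi> \<and>
     (\<forall>\<xi>\<in>bidual T. hat T \<phi> \<xi> = \<Phi> (bmult T \<xi> v)) \<and>
     {bmult T \<xi> (bone T - bmult T (bstar T v) v) |\<xi>. \<xi> \<in> bidual T} =
       {\<xi> \<in> bidual T. \<Phi> (bmult T (bstar T \<xi>) \<xi>) = 0}"

definition modulus ::
    "('h::chilbert_space \<Rightarrow>\<^sub>L 'h) set \<Rightarrow> 'h functional \<Rightarrow> 'h bifunctional \<Rightarrow> complex" where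
  "modulus T \<phi> = (THE \<Phi>. \<exists>v. polar_decomposition T \<phi> v \<Phi>)"

definition modulus_restr ::
    "('h::chilbert_space \<Rightarrow>\<^sub>L 'h) set \<Rightarrow> 'h functional \<Rightarrow> 'h functional" where
  "modulus_restr T \<phi> = ext0 T (\<lambda>t. modulus T \<phi> (embed T t))"

definition abs_cont ::
    "('h::chilbert_space \<Rightarrow>\<^sub>L 'h) set \<Rightarrow> 'h functional \<Rightarrow> 'h functional \<Rightarrow> bool" where
  "abs_cont T \<phi> \<psi> \<longleftrightarrow>
     (\<forall>\<xi>\<in>bidual T. modulus T \<psi> (bmult T (bstar T \<xi>) \<xi>) = 0 \<longrightarrow>
                    modulus T \<phi> (bmult T (bstar T \<xi>) \<xi>) = 0)"


section \<open>Coanalytic triples\<close>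

definition annihilator ::
    "('h::chilbert_space \<Rightarrow>\<^sub>L 'h) set \<Rightarrow> ('h \<Rightarrow>\<^sub>L 'h) set \<Rightarrow> 'h functional set" where
  "annihilator A T = {\<phi> \<in> dual T. \<forall>a\<in>A. \<phi> a = 0}"

definition norm_closure ::
    "('h::chilbert_space \<Rightarrow>\<^sub>L 'h) set \<Rightarrow> 'h functional set \<Rightarrow> 'h functional set" where
  "norm_closure T S = {\<phi> \<in> dual T. \<forall>\<epsilon>>0. \<exists>\<psi>\<in>S. fnorm T (\<phi> - \<psi>) < \<epsilon>}"

definition Delta_star ::
    "('h::chilbert_space \<Rightarrow>\<^sub>L 'h) set \<Rightarrow> ('h \<Rightarrow>\<^sub>L 'h) set \<Rightarrow> 'h functional set" where
  "Delta_star A T =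
     norm_closure T
       (convex hull {modulus_restr T (dagger T \<phi>) |\<phi>. \<phi> \<in> annihilator A T \<and> fnorm T \<phi> = 1})"

definition AC ::
    "('h::chilbert_space \<Rightarrow>\<^sub>L 'h) set \<Rightarrow> 'h functional set \<Rightarrow> 'h functional set" where
  "AC T \<Delta> = {\<phi> \<in> dual T. \<exists>\<delta>\<in>\<Delta>. abs_cont T \<phi> \<delta>}"

definition directed :: "'i set \<Rightarrow> ('i \<Rightarrow> 'i \<Rightarrow> bool) \<Rightarrow> bool" where
  "directed I le \<longleftrightarrow>
     I \<noteq> {} \<and> (\<forall>i\<in>I. le i i) \<and>
     (\<forall>i\<in>I. \<forall>j\<in>I. \<forall>k\<in>I. le i j \<longrightarrow> le j k \<longrightarrow> le i k) \<and>
     (\<forall>i\<in>I. \<forall>j\<in>I. \<exists>k\<in>I. le i k \<and> le j k)"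

definition tail_filter :: "'i set \<Rightarrow> ('i \<Rightarrow> 'i \<Rightarrow> bool) \<Rightarrow> 'i filter" where
  "tail_filter I le = (INF i\<in>I. principal {j \<in> I. le i j})"

lemma eventually_tail_filter:
  assumes "directed I le"
  shows "eventually P (tail_filter I le) \<longleftrightarrow> (\<exists>i\<in>I. \<forall>j\<in>I. le i j \<longrightarrow> P j)"
  unfolding tail_filter_def
proof (subst eventually_INF_base)
  show "I \<noteq> {}"
    using assms by (simp add: directed_def)
  show "\<exists>x\<in>I. principal {j \<in> I. le x j} \<le>
      inf (principal {j \<in> I. le a j}) (principal {j \<in> I. le b j})"
    if ab: "a \<in> I" "b \<in> I" for a b
  proof -
    have tr: "le i k" if "i \<in> I" "j \<in> I" "k \<in> I" "le i j" "le j k" for i j k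
      using assms that unfolding directed_def by blast
    obtain k where k: "k \<in> I" "le a k" "le b k"
      using assms ab unfolding directed_def by blast
    have "{j \<in> I. le k j} \<subseteq> {j \<in> I. le a j} \<inter> {j \<in> I. le b j}"
      using k ab tr by blast
    then show ?thesis
      using k(1) by auto
  qed
qed (auto simp: eventually_principal)

text \<open>The type argument is the type of indices of the nets under consideration; a triple is
  coanalytic if this holds for every type \<open>'i\<close>.\<close>

definition coanalytic ::
    "'i itself \<Rightarrow> ('h::chilbert_space \<Rightarrow>\<^sub>L 'h) set \<Rightarrow> ('h \<Rightarrow>\<^sub>L 'h) set \<Rightarrow> bool" where
  "coanalytic TYPE('i) A T \<longleftrightarrow>
     (\<forall>(I :: 'i set) le b.
        directed I le \<and> (\<forall>i\<in>I. b i \<in> A) \<and> (\<exists>M. \<forall>i\<in>I. norm (b i) \<le> M) \<and>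
        (\<forall>\<alpha>\<in>AC T (Delta_star A T). ((\<lambda>i. \<alpha> (op_adj (b i))) \<longlongrightarrow> 0) (tail_filter I le)) \<longrightarrow>
        limitin weak_star_ops b 0 (tail_filter I le))"

end

theory Submission
  imports Defs
begin

text \<open>Every vector \<open>k\<close> has the form \<open>g + h\<close> with \<open>g\<close> in the closure of \<open>\<Gamma>\<close> and \<open>h\<close>
  orthogonal to \<open>\<Gamma>\<close>. A unit vector \<open>u \<in> \<Gamma>\<close> is not cyclic, so \<open>t \<mapsto> \<langle>t u, w\<rangle>\<close> annihilates
  \<open>A\<close> for some unit vector \<open>w\<close>, and the modulus of its adjoint is \<open>t \<mapsto> \<langle>t u, u\<rangle>\<close>; norm limits
  of such functionals cover the closure of \<open>\<Gamma>\<close>. For \<open>h\<close> with partner \<open>h'\<close>, which is orthogonal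
  to \<open>h\<close> and of the same norm, the self-adjoint functional \<open>\<langle>t h, h\<rangle> - \<langle>t h', h'\<rangle>\<close> annihilates
  \<open>A\<close> and has modulus \<open>\<langle>t h, h\<rangle> + \<langle>t h', h'\<rangle>\<close>. Averages of these moduli dominate
  \<open>\<langle>t k, k\<rangle>\<close>, which up to scaling is the modulus of every \<open>\<langle>t x, k\<rangle>\<close>.

  All functionals involved have finite rank and their polar decompositions can be written down
  with partial isometries in \<open>T\<close> itself, because \<open>T\<close> contains the compact operators. Arens
  regularity is avoided: uniqueness of the modulus uses only associativity of the first Arens
  product and Cauchy-Schwarz arguments for \<open>(\<xi>, \<eta>) \<mapsto> \<Psi> (\<eta>\<^sup>* \<xi>)\<close>, and never the identity
  \<open>(\<xi> \<eta>)\<^sup>* = \<eta>\<^sup>* \<xi>\<^sup>*\<close>.\<close>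

section \<open>Hilbert space preliminaries\<close>

text \<open>\<open>modulus\<close> is a definite description, so each use of |\<phi>| costs a polar
  decomposition together with its uniqueness. In finite rank both come down to operators on the
  Hilbert space. Every \<xi> in the bidual acts there through \<open>rep \<xi>\<close>, and the
  value of \<open>rho L\<close>, the sum of the functionals \<langle>t k, k\<rangle> over k in L, at
  \<xi>* \<xi> is the sum of the numbers |rep \<xi> k|^2. So \<xi> is null for \<open>rho L\<close>
  exactly when \<open>rep \<xi>\<close> kills the vectors of L. Products of \<xi> with rank-one
  operators see no more of \<xi> than such vectors (\<open>bmult_rank_one_eq_0\<close>), and this
  identifies the left ideal demanded by the polar decomposition inside the whole bidual. Absolute
  continuity thus becomes an inclusion of kernels, a condition that is linear in the vector. Hence
  the dominated vectors are closed under sums, and it is enough to treat the two components of an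
  orthogonal decomposition.\<close>

lemma cinner_add_right: "cinner x (y + z) = cinner x y + cinner x (z::'a::complex_inner)"
  by (subst (1 2 3) cinner_commute) (simp add: cinner_add_left)

lemma cinner_scaleC_right: "cinner x (c *\<^sub>C y) = cnj c * cinner x (y::'a::complex_inner)"
  by (subst (1 2) cinner_commute) (simp add: cinner_scaleC_left)

lemma scaleC_zero_left [simp]: "0 *\<^sub>C x = (0::'a::complex_inner)"
  using scaleC_of_real[of 0 x] by simp

lemma scaleC_one [simp]: "1 *\<^sub>C x = (x::'a::complex_inner)"
  using scaleC_of_real[of 1 x] by simp

lemma scaleC_minus_one [simp]: "(-1) *\<^sub>C x = - (x::'a::complex_inner)"
  using scaleC_of_real[of "-1" x] by simp

lemma scaleC_zero_right [simp]: "c *\<^sub>C 0 = (0::'a::complex_inner)"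
  using norm_scaleC[of c "0::'a"] by simp

lemma scaleC_diff_right: "c *\<^sub>C (x - y) = c *\<^sub>C x - c *\<^sub>C (y::'a::complex_inner)"
  using scaleC_add_right[of c "x - y" y] by simp

lemma cinner_minus_left: "cinner (- x) y = - cinner x (y::'a::complex_inner)"
  using cinner_scaleC_left[of "-1" x y] by simp

lemma cinner_minus_right: "cinner x (- y) = - cinner x (y::'a::complex_inner)"
  using cinner_scaleC_right[of x "-1" y] by simp

lemma cinner_diff_left: "cinner (x - y) z = cinner x z - cinner y (z::'a::complex_inner)"
  using cinner_add_left[of x "- y" z] by (simp add: cinner_minus_left)

lemma cinner_diff_right: "cinner x (y - z) = cinner x y - cinner x (z::'a::complex_inner)"
  using cinner_add_right[of x y "- z"] by (simp add: cinner_minus_right)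

lemma cinner_zero_left [simp]: "cinner 0 (y::'a::complex_inner) = 0"
  using cinner_scaleC_left[of 0 0 y] by simp

lemma cinner_zero_right [simp]: "cinner (y::'a::complex_inner) 0 = 0"
  using cinner_scaleC_right[of y 0 0] by simp

lemma cinner_scaleR_left: "cinner (r *\<^sub>R x) y = of_real r * cinner x (y::'a::complex_inner)"
  using cinner_scaleC_left[of "of_real r" x y] by (simp add: scaleC_of_real)

lemma cinner_scaleR_right: "cinner x (r *\<^sub>R y) = of_real r * cinner x (y::'a::complex_inner)"
  using cinner_scaleC_right[of x "of_real r" y] by (simp add: scaleC_of_real)

lemma cinner_self: "cinner x x = of_real ((norm (x::'a::complex_inner))\<^sup>2)"
proof -
  have "cnj (cinner x x) = cinner x x"
    by (rule cinner_commute[symmetric])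
  then have "Im (cinner x x) = 0"
    by (simp add: complex_eq_iff)
  moreover have "Re (cinner x x) = (norm x)\<^sup>2"
    by (metis inner_eq_Re_cinner power2_norm_eq_inner)
  ultimately show ?thesis by (simp add: complex_eq_iff)
qed

lemma cinner_ext: "(\<And>z. cinner x z = cinner y z) \<Longrightarrow> x = (y::'a::complex_inner)"
  using cinner_self[of "x - y"] by (simp add: cinner_diff_left)

text \<open>The real Cauchy-Schwarz inequality after a rotation: the unit scalar \<open>c\<close>
  makes the complex inner product real and nonnegative.\<close>

lemma cmod_cinner_le: "cmod (cinner x y) \<le> norm x * norm (y::'a::complex_inner)"
proof (cases "cinner x y = 0")
  case False
  define c where "c = cnj (cinner x y) / cmod (cinner x y)"
  have c: "cmod c = 1"
    using False by (simp add: c_def norm_divide)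
  have "c * cinner x y = cmod (cinner x y)"
    using False by (simp add: c_def complex_norm_square[symmetric] power2_eq_square mult.commute)
  then have "cmod (cinner x y) = inner (c *\<^sub>C x) y"
    by (simp add: inner_eq_Re_cinner cinner_scaleC_left)
  also have "\<dots> \<le> norm (c *\<^sub>C x) * norm y"
    by (rule norm_cauchy_schwarz)
  finally show ?thesis
    by (simp add: norm_scaleC c)
qed simp

lemma scaleC_scaleR: "c *\<^sub>C r *\<^sub>R x = r *\<^sub>R c *\<^sub>C (x::'a::complex_inner)"
  by (simp add: scaleC_of_real[symmetric] scaleC_scaleC mult.commute)

lemma bounded_linear_scaleC: "bounded_linear (\<lambda>x::'a::complex_inner. c *\<^sub>C x)"
  by (rule bounded_linear_intro[of _ "cmod c"])
    (simp_all add: scaleC_add_right scaleC_scaleR norm_scaleC mult.commute)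

lemma csubspace_scaleR: "csubspace M \<Longrightarrow> x \<in> M \<Longrightarrow> r *\<^sub>R x \<in> M"
  unfolding csubspace_def scaleC_of_real[symmetric] by blast

lemma csubspace_closure:
  assumes "csubspace M"
  shows "csubspace (closure M)"
  unfolding csubspace_def
proof (intro conjI ballI allI)
  show "0 \<in> closure M"
    using assms closure_subset by (auto simp: csubspace_def)
next
  fix x y assume "x \<in> closure M" "y \<in> closure M"
  then obtain f g where "\<forall>n. f n \<in> M" "f \<longlonglongrightarrow> x" "\<forall>n. g n \<in> M" "g \<longlonglongrightarrow> y"
    by (auto simp: closure_sequential)
  then show "x + y \<in> closure M"
    using assms unfolding closure_sequential csubspace_def
    by (intro exI[of _ "\<lambda>n. f n + g n"]) (auto intro: tendsto_add)
next
  fix c x assume "x \<in> closure M"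
  then obtain f where "\<forall>n. f n \<in> M" "f \<longlonglongrightarrow> x"
    by (auto simp: closure_sequential)
  then show "c *\<^sub>C x \<in> closure M"
    using assms unfolding closure_sequential csubspace_def
    by (intro exI[of _ "\<lambda>n. c *\<^sub>C f n"])
      (auto intro: bounded_linear.tendsto[OF bounded_linear_scaleC])
qed

text \<open>A minimizing sequence is Cauchy by the parallelogram identity: midpoints stay in M, so
  their squared distance to x is also at least the infimum \<open>D\<close>.\<close>

lemma closest_point_csubspace:
  fixes x :: "'h::chilbert_space"
  assumes M: "csubspace M" "closed M"
  shows "\<exists>m\<in>M. \<forall>y\<in>M. norm (x - m) \<le> norm (x - y)"
proof -
  define D where "D = (INF y\<in>M. (norm (x - y))\<^sup>2)"
  have ne: "M \<noteq> {}" using M by (auto simp: csubspace_def)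
  have bdd: "bdd_below ((\<lambda>y. (norm (x - y))\<^sup>2) ` M)"
    by (rule bdd_belowI[of _ 0]) auto
  have D_le: "D \<le> (norm (x - y))\<^sup>2" if "y \<in> M" for y
    unfolding D_def by (rule cINF_lower[OF bdd that])
  have "\<exists>y\<in>M. (norm (x - y))\<^sup>2 < D + inverse (real (Suc n))" for n
    using cINF_less_iff[OF ne bdd, of "D + inverse (real (Suc n))"] by (simp add: D_def)
  then obtain a where aM: "\<And>n. a n \<in> M"
    and a: "\<And>n. (norm (x - a n))\<^sup>2 < D + inverse (real (Suc n))"
    by metis
  have par: "(norm (a m - a n))\<^sup>2 \<le> 2 * inverse (real (Suc m)) + 2 * inverse (real (Suc n))" for m n
  proof -
    have "(1/2) *\<^sub>R (a m + a n) \<in> M"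
      using M aM by (meson csubspace_def csubspace_scaleR)
    then have "D \<le> (norm (x - (1/2) *\<^sub>R (a m + a n)))\<^sup>2"
      by (rule D_le)
    moreover have "(norm (a m - a n))\<^sup>2 + 4 * (norm (x - (1/2) *\<^sub>R (a m + a n)))\<^sup>2
        = 2 * (norm (x - a m))\<^sup>2 + 2 * (norm (x - a n))\<^sup>2"
      unfolding power2_norm_eq_inner by (simp add: algebra_simps inner_commute)
    ultimately show ?thesis
      using a[of m] a[of n] by linarith
  qed
  have "Cauchy a"
  proof (rule CauchyI)
    fix e :: real assume "e > 0"
    then obtain N where N: "inverse (real (Suc N)) < e\<^sup>2 / 4"
      using reals_Archimedean[of "e\<^sup>2 / 4"] by auto
    have "norm (a m - a n) < e" if "m \<ge> N" "n \<ge> N" for m n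
    proof -
      have "inverse (real (Suc m)) \<le> inverse (real (Suc N))" "inverse (real (Suc n)) \<le> inverse (real (Suc N))"
        using that by (auto simp: field_simps)
      then have "(norm (a m - a n))\<^sup>2 < e\<^sup>2"
        using par[of m n] N by linarith
      then show ?thesis
        using \<open>e > 0\<close> by (simp add: power_less_imp_less_base)
    qed
    then show "\<exists>N. \<forall>m\<ge>N. \<forall>n\<ge>N. norm (a m - a n) < e" by blast
  qed
  then obtain m where m: "a \<longlonglongrightarrow> m"
    using Cauchy_convergent convergent_def by blast
  have "m \<in> M"
    using M(2) aM m closed_sequentially by blast
  have "(\<lambda>n. (norm (x - a n))\<^sup>2) \<longlonglongrightarrow> (norm (x - m))\<^sup>2"
    by (intro tendsto_intros m)
  moreover have "(\<lambda>n. D + inverse (real (Suc n))) \<longlonglongrightarrow> D"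
    using tendsto_add[OF tendsto_const[of D] LIMSEQ_inverse_real_of_nat] by simp
  ultimately have "(norm (x - m))\<^sup>2 \<le> D"
    using a by (intro LIMSEQ_le) (auto intro: less_imp_le)
  then have "\<forall>y\<in>M. norm (x - m) \<le> norm (x - y)"
    using D_le by (meson norm_ge_zero order_trans power2_le_imp_le)
  with \<open>m \<in> M\<close> show ?thesis by blast
qed

lemma orthogonal_projection:
  fixes x :: "'h::chilbert_space"
  assumes M: "csubspace M" "closed M"
  shows "\<exists>m\<in>M. \<forall>y\<in>M. cinner (x - m) y = 0"
proof -
  obtain m where m: "m \<in> M" and min: "\<And>y. y \<in> M \<Longrightarrow> norm (x - m) \<le> norm (x - y)"
    using closest_point_csubspace[OF M] by blast
  have re: "inner (x - m) y = 0" if y: "y \<in> M" for y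
  proof (cases "y = 0")
    case False
    \<comment> \<open>Minimizer of the quadratic r -> |x - m - r y|^2; minimality of m forces the
      gain to be zero.\<close>
    define r where "r = inner (x - m) y / inner y y"
    have yy: "inner y y > 0" using False by simp
    have "m + r *\<^sub>R y \<in> M"
      using M(1) m y by (meson csubspace_def csubspace_scaleR)
    then have "(norm (x - m))\<^sup>2 \<le> (norm ((x - m) - r *\<^sub>R y))\<^sup>2"
      using min by (simp add: diff_diff_eq)
    also have "\<dots> = (norm (x - m))\<^sup>2 - 2 * r * inner (x - m) y + r\<^sup>2 * inner y y"
      unfolding power2_norm_eq_inner
      by (simp add: inner_diff_left inner_diff_right inner_commute power2_eq_square algebra_simps)
    also have "\<dots> = (norm (x - m))\<^sup>2 - (inner (x - m) y)\<^sup>2 / inner y y"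
      using yy by (simp add: r_def power2_eq_square)
    finally have "(inner (x - m) y)\<^sup>2 / inner y y \<le> 0" by simp
    then show ?thesis
      using yy by (simp add: divide_le_0_iff)
  qed simp
  have "cinner (x - m) y = 0" if y: "y \<in> M" for y
  proof -
    \<comment> \<open>Real orthogonality tested on i y yields the imaginary part of the complex
      inner product.\<close>
    have "\<i> *\<^sub>C y \<in> M" using M(1) y by (simp add: csubspace_def)
    then have "Re (cnj \<i> * cinner (x - m) y) = 0"
      using re[of "\<i> *\<^sub>C y"] by (simp add: inner_eq_Re_cinner cinner_scaleC_right)
    moreover have "Re (cinner (x - m) y) = 0"
      using re[OF y] by (simp add: inner_eq_Re_cinner)
    ultimately show ?thesis by (simp add: complex_eq_iff)
  qed
  with m show ?thesis by blast
qed

text \<open>A nonzero f is determined by its kernel up to a scalar: for e orthogonal to the kernel,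
  x - (f x / f e) e lies in the kernel and is therefore orthogonal to e.\<close>

lemma riesz_representation:
  fixes f :: "'h::chilbert_space \<Rightarrow> complex"
  assumes add: "\<And>x y. f (x + y) = f x + f y" and scale: "\<And>c x. f (c *\<^sub>C x) = c * f x"
    and bound: "\<And>x. cmod (f x) \<le> K * norm x"
  shows "\<exists>y. \<forall>x. f x = cinner x y"
proof (cases "\<forall>x. f x = 0")
  case True
  then show ?thesis by (intro exI[of _ 0]) simp
next
  case False
  then obtain x0 where x0: "f x0 \<noteq> 0" by blast
  define M where "M = {x. f x = 0}"
  have diff: "f (x - y) = f x - f y" for x y
    by (metis add add_diff_cancel diff_add_cancel)
  have "bounded_linear f"
  proof (rule bounded_linear_intro[of _ K])
    show "f (r *\<^sub>R x) = r *\<^sub>R f x" for r x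
      using scale[of "of_real r" x] by (simp add: scaleC_of_real scaleR_conv_of_real)
  qed (use add bound in \<open>auto simp: mult.commute\<close>)
  then have "continuous_on UNIV f"
    by (simp add: linear_continuous_on)
  then have cl: "closed M"
    unfolding M_def by (intro closed_Collect_eq) auto
  have sub: "csubspace M"
    using scale[of 0 0] by (auto simp: csubspace_def M_def add scale)
  obtain m where m: "m \<in> M" and orth: "\<And>y. y \<in> M \<Longrightarrow> cinner (x0 - m) y = 0"
    using orthogonal_projection[OF sub cl] by blast
  define e where "e = x0 - m"
  have fe: "f e \<noteq> 0" using m x0 by (simp add: e_def diff M_def)
  then have "e \<noteq> 0" using diff[of e e] by auto
  then have ee: "cinner e e \<noteq> 0" by (simp add: cinner_self)
  have "f x = cinner x (cnj (f e / cinner e e) *\<^sub>C e)" for x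
  proof -
    have "f (x - (f x / f e) *\<^sub>C e) = 0" using fe by (simp add: diff scale)
    then have "cinner e (x - (f x / f e) *\<^sub>C e) = 0" using orth by (simp add: e_def M_def)
    then have "cinner (x - (f x / f e) *\<^sub>C e) e = 0"
      using cinner_commute[of "x - (f x / f e) *\<^sub>C e" e] by simp
    then have "cinner x e = (f x / f e) * cinner e e"
      by (simp add: cinner_diff_left cinner_scaleC_left)
    then show ?thesis using ee fe by (simp add: cinner_scaleC_right)
  qed
  then show ?thesis by blast
qed

section \<open>Operators\<close>

lemma scaleC_blinfun_apply [simp]: "blinfun_apply (c *\<^sub>C S) x = c *\<^sub>C blinfun_apply S x"
  by transfer simp

text \<open>\<open>op_adj\<close> is a definite description, so uniqueness has to accompany
  existence.\<close>

lemma op_adj_exists: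
  fixes S :: "'h::chilbert_space \<Rightarrow>\<^sub>L 'h"
  assumes S: "S \<in> bounded_ops"
  shows "\<exists>!R. \<forall>x y. cinner (blinfun_apply S x) y = cinner x (blinfun_apply R y)"
proof -
  have bd: "cmod (cinner (S x) y) \<le> norm S * norm y * norm x" for x y
    using mult_right_mono[OF norm_blinfun[of S x] norm_ge_zero[of y]] cmod_cinner_le[of "S x" y]
    by (simp add: mult_ac)
  have "\<exists>z. \<forall>x. cinner (S x) y = cinner x z" for y
    using S by (intro riesz_representation[where K="norm S * norm y"])
      (auto simp: bounded_ops_def blinfun.add_right cinner_add_left cinner_scaleC_left bd)
  then obtain R where R: "\<And>x y. cinner (S x) y = cinner x (R y)" by metis
  have R': "cinner (R y) x = cinner y (S x)" for x y
    by (subst (1 2) cinner_commute) (simp add: R)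
  have "bounded_linear R"
  proof (rule bounded_linear_intro[of _ "norm S"])
    show "R (x + y) = R x + R y" for x y
      by (rule cinner_ext) (simp add: R' cinner_add_left)
    show "R (r *\<^sub>R x) = r *\<^sub>R R x" for r x
      by (rule cinner_ext) (simp add: R' cinner_scaleR_left)
    show "norm (R x) \<le> norm x * norm S" for x
    proof (cases "R x = 0")
      case False
      have "(norm (R x))\<^sup>2 = cmod (cinner (S (R x)) x)"
        by (simp add: R cinner_self norm_power)
      also have "\<dots> \<le> norm (R x) * (norm x * norm S)"
        using bd[of "R x" x] by (simp add: mult_ac)
      finally show ?thesis
        using False by (simp add: power2_eq_square)
    qed simp
  qed
  then obtain R'' where R'': "R = blinfun_apply R''"
    using bounded_linear_Blinfun_apply by metis
  show ?thesis
  proof (rule ex1I[of _ R''])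
    show "\<forall>x y. cinner (S x) y = cinner x (R'' y)"
      using R R'' by simp
    fix Q assume Q: "\<forall>x y. cinner (S x) y = cinner x (blinfun_apply Q y)"
    show "Q = R''"
    proof (rule blinfun_eqI, rule cinner_ext)
      fix y z
      have "cinner z (Q y) = cinner z (R'' y)"
        using Q R R'' by metis
      then show "cinner (Q y) z = cinner (R'' y) z"
        by (subst (1 2) cinner_commute) simp
    qed
  qed
qed

lemma cinner_op_adj_right:
  assumes "S \<in> bounded_ops"
  shows "cinner x (op_adj S y) = cinner (S x) y"
  using theI'[OF op_adj_exists[OF assms]] unfolding op_adj_def by metis

lemma cinner_op_adj_left:
  assumes "S \<in> bounded_ops"
  shows "cinner (op_adj S x) y = cinner x (S y)"
  using cinner_op_adj_right[OF assms, of y x] by (subst (1 2) cinner_commute) simp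

lemma op_adj_eqI:
  assumes "S \<in> bounded_ops" "\<And>x y. cinner (blinfun_apply R x) y = cinner x (S y)"
  shows "op_adj S = R"
  by (rule blinfun_eqI, rule cinner_ext) (simp add: cinner_op_adj_left assms)

lemma bounded_ops_scaleC: "S \<in> bounded_ops \<Longrightarrow> blinfun_apply S (c *\<^sub>C x) = c *\<^sub>C S x"
  by (simp add: bounded_ops_def)

lemma op_adj_in_bounded_ops:
  assumes "S \<in> bounded_ops"
  shows "op_adj S \<in> bounded_ops"
proof -
  have "op_adj S (c *\<^sub>C x) = c *\<^sub>C op_adj S x" for c x
    by (rule cinner_ext) (simp add: cinner_op_adj_left assms cinner_scaleC_left)
  then show ?thesis by (simp add: bounded_ops_def)
qed

lemma op_adj_op_adj:
  assumes "S \<in> bounded_ops"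
  shows "op_adj (op_adj S) = S"
  by (rule op_adj_eqI) (simp_all add: op_adj_in_bounded_ops cinner_op_adj_right assms)

lemma op_adj_add:
  assumes "S \<in> bounded_ops" "R \<in> bounded_ops" "S + R \<in> bounded_ops"
  shows "op_adj (S + R) = op_adj S + op_adj R"
  by (rule op_adj_eqI)
    (simp_all add: assms blinfun.add_left cinner_add_left cinner_add_right cinner_op_adj_left)

lemma op_adj_scaleC:
  assumes "S \<in> bounded_ops" "c *\<^sub>C S \<in> bounded_ops"
  shows "op_adj (c *\<^sub>C S) = cnj c *\<^sub>C op_adj S"
  by (rule op_adj_eqI)
    (simp_all add: assms cinner_scaleC_left cinner_scaleC_right cinner_op_adj_left)

lemma norm_op_adj_le:
  assumes "S \<in> bounded_ops"
  shows "norm (op_adj S) \<le> norm S"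
proof (rule norm_blinfun_bound)
  fix x
  show "norm (op_adj S x) \<le> norm S * norm x"
  proof (cases "op_adj S x = 0")
    case False
    have "(norm (op_adj S x))\<^sup>2 = cmod (cinner (S (op_adj S x)) x)"
      by (simp add: cinner_op_adj_right[OF assms, symmetric] cinner_self norm_power)
    also have "\<dots> \<le> norm (S (op_adj S x)) * norm x"
      by (rule cmod_cinner_le)
    also have "\<dots> \<le> norm S * norm (op_adj S x) * norm x"
      by (intro mult_right_mono norm_blinfun norm_ge_zero)
    finally show ?thesis
      using False by (simp add: power2_eq_square)
  qed simp
qed simp

section \<open>Rank-one operators\<close>

definition rank_one :: "'h::chilbert_space \<Rightarrow> 'h \<Rightarrow> 'h \<Rightarrow>\<^sub>L 'h" where
  "rank_one x y = Blinfun (\<lambda>z. cinner z y *\<^sub>C x)"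

lemma rank_one_apply [simp]: "blinfun_apply (rank_one x y) z = cinner z y *\<^sub>C x"
proof -
  have "bounded_linear (\<lambda>z. cinner z y *\<^sub>C x)"
  proof (rule bounded_linear_intro[of _ "norm y * norm x"])
    show "norm (cinner z y *\<^sub>C x) \<le> norm z * (norm y * norm x)" for z
      using mult_right_mono[OF cmod_cinner_le[of z y] norm_ge_zero[of x]]
      by (simp add: norm_scaleC mult_ac)
  qed (simp_all add: cinner_add_left scaleC_add_left
      cinner_scaleC_left scaleC_of_real[symmetric] scaleC_scaleC)
  then show ?thesis
    by (simp add: rank_one_def bounded_linear_Blinfun_apply)
qed

text \<open>The unit ball goes into the multiples c x with |c| at most \<open>norm y\<close>, which
  form the continuous image of a compact disc.\<close>

lemma rank_one_in_compact_ops: "rank_one x y \<in> compact_ops"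
proof -
  have "bounded_linear (\<lambda>c::complex. c *\<^sub>C x)"
    by (rule bounded_linear_intro[of _ "norm x"])
      (simp_all add: scaleC_add_left norm_scaleC scaleR_conv_of_real
        scaleC_of_real[symmetric] scaleC_scaleC)
  then have cont: "continuous_on S (\<lambda>c::complex. c *\<^sub>C x)" for S
    by (rule linear_continuous_on)
  define K where "K = (\<lambda>c::complex. c *\<^sub>C x) ` cball 0 (norm y)"
  have K: "compact K"
    unfolding K_def by (intro compact_continuous_image cont) simp
  have "rank_one x y ` cball 0 1 \<subseteq> K"
  proof
    fix w assume "w \<in> rank_one x y ` cball 0 1"
    then obtain z where z: "norm z \<le> 1" "w = cinner z y *\<^sub>C x" by auto
    have "cmod (cinner z y) \<le> norm y"
      using cmod_cinner_le[of z y] mult_right_mono[OF z(1) norm_ge_zero[of y]] by simp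
    then show "w \<in> K" using z by (auto simp: K_def)
  qed
  then have "closure (rank_one x y ` cball 0 1) \<subseteq> K"
    by (intro closure_minimal compact_imp_closed K)
  then have "compact (closure (rank_one x y ` cball 0 1))"
    using K closed_closure
    by (metis compact_Int_closed inf.absorb_iff2)
  moreover have "rank_one x y \<in> bounded_ops"
    by (simp add: bounded_ops_def cinner_scaleC_left scaleC_scaleC)
  ultimately show ?thesis by (simp add: compact_ops_def)
qed

lemma op_adj_rank_one: "op_adj (rank_one x y) = rank_one y x"
proof (rule op_adj_eqI)
  show "rank_one x y \<in> bounded_ops"
    using rank_one_in_compact_ops by (auto simp: compact_ops_def)
  show "cinner (rank_one y x u) v = cinner u (rank_one x y v)" for u v
    by (simp add: cinner_scaleC_left cinner_scaleC_right cinner_commute[of x v])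
       (metis cinner_commute mult.commute)
qed

section \<open>Duality\<close>

lemma ext0_in [simp]: "x \<in> V \<Longrightarrow> ext0 V f x = f x"
  by (simp add: ext0_def)

lemma ext0_cong: "(\<And>x. x \<in> V \<Longrightarrow> f x = g x) \<Longrightarrow> ext0 V f = ext0 V g"
  by (auto simp: ext0_def)

lemma ext0_idem: "(\<And>x. x \<notin> V \<Longrightarrow> f x = 0) \<Longrightarrow> ext0 V f = f"
  by (auto simp: ext0_def)

text \<open>Induction on I. If some s in the common kernel of the other functionals has
  \<open>f j s\<close> nonzero, subtracting (g s / f j s) f j from g removes j. Otherwise
  \<open>f j\<close> vanishes on that kernel anyway and gets coefficient 0.\<close>

lemma functional_in_span_of_kernels:
  fixes V :: "'v::{plus,scaleC} set" and f :: "'i \<Rightarrow> 'v \<Rightarrow> complex"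
  assumes "finite I"
    and V: "\<And>x y. x \<in> V \<Longrightarrow> y \<in> V \<Longrightarrow> x + y \<in> V" "\<And>c x. x \<in> V \<Longrightarrow> c *\<^sub>C x \<in> V"
    and f: "\<And>i. i \<in> I \<Longrightarrow> linear_functional V (f i)"
    and g: "linear_functional V g"
    and ker: "\<And>x. x \<in> V \<Longrightarrow> (\<And>i. i \<in> I \<Longrightarrow> f i x = 0) \<Longrightarrow> g x = 0"
  shows "\<exists>c. \<forall>x\<in>V. g x = (\<Sum>i\<in>I. c i * f i x)"
  using assms(1) f g ker
proof (induction I arbitrary: g rule: finite_induct)
  case empty
  then show ?case by simp
next
  case (insert j I)
  have lj: "linear_functional V (f j)" using insert.prems by simp
  have li: "linear_functional V (f i)" if "i \<in> I" for i using insert.prems that by simp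
  have lg: "linear_functional V g" using insert.prems by simp
  show ?case
  proof (cases "\<exists>s\<in>V. (\<forall>i\<in>I. f i s = 0) \<and> f j s \<noteq> 0")
    case False
    then have "\<exists>c. \<forall>x\<in>V. g x = (\<Sum>i\<in>I. c i * f i x)"
      using insert.prems by (intro insert.IH) auto
    then obtain c where c: "\<forall>x\<in>V. g x = (\<Sum>i\<in>I. c i * f i x)" by blast
    have "(\<Sum>i\<in>insert j I. (c(j := 0)) i * f i x) = (\<Sum>i\<in>I. c i * f i x)" for x
      using insert.hyps by (simp cong: sum.cong) (rule sum.cong, auto)
    then show ?thesis using c by (intro exI[of _ "c(j := 0)"]) simp
  next
    case True
    then obtain s where s: "s \<in> V" "\<And>i. i \<in> I \<Longrightarrow> f i s = 0" "f j s \<noteq> 0" by blast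
    define r where "r = g s / f j s"
    define h where "h = (\<lambda>x. g x - r * f j x)"
    have "linear_functional V h"
      using lg lj by (auto simp: linear_functional_def h_def algebra_simps)
    moreover have "h x = 0" if x: "x \<in> V" and 0: "\<And>i. i \<in> I \<Longrightarrow> f i x = 0" for x
    proof -
      \<comment> \<open>Correcting x along s kills \<open>f j\<close> without changing the other
        \<open>f i\<close>.\<close>
      define y where "y = x + (- (f j x / f j s)) *\<^sub>C s"
      have val: "l y = l x - f j x / f j s * l s" if "linear_functional V l" for l
      proof -
        have "l y = l x + l ((- (f j x / f j s)) *\<^sub>C s)"
          using that x s(1) V unfolding linear_functional_def y_def by blast
        also have "l ((- (f j x / f j s)) *\<^sub>C s) = - (f j x / f j s) * l s"
          using that s(1) unfolding linear_functional_def by blast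
        finally show ?thesis by simp
      qed
      have "y \<in> V" using x s(1) V by (simp add: y_def)
      moreover have "f i y = 0" if "i \<in> insert j I" for i
        using that val[OF lj] val[OF li] 0 s by auto
      ultimately have "g y = 0" using insert.prems(3) by blast
      then show ?thesis using val[OF lg] by (simp add: h_def r_def)
    qed
    ultimately have "\<exists>c. \<forall>x\<in>V. h x = (\<Sum>i\<in>I. c i * f i x)"
      using li by (intro insert.IH) auto
    then obtain c where c: "\<forall>x\<in>V. h x = (\<Sum>i\<in>I. c i * f i x)" by blast
    have "(\<Sum>i\<in>insert j I. (c(j := r)) i * f i x) = r * f j x + (\<Sum>i\<in>I. c i * f i x)" for x
    proof -
      have "(\<Sum>i\<in>I. (c(j := r)) i * f i x) = (\<Sum>i\<in>I. c i * f i x)"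
        using insert.hyps by (intro sum.cong) auto
      then show ?thesis using insert.hyps by simp
    qed
    then show ?thesis
      using c by (intro exI[of _ "c(j := r)"]) (auto simp: h_def algebra_simps)
  qed
qed

text \<open>The instance of \<open>scaleC\<close> for \<open>blinfun\<close> is purely syntactic, so
  its agreement with the real scaling has to be proved.\<close>

lemma scaleC_of_real_blinfun:
  "complex_of_real r *\<^sub>C t = r *\<^sub>R (t::'a::real_normed_vector \<Rightarrow>\<^sub>L 'h::chilbert_space)"
  by (rule blinfun_eqI) (simp add: scaleC_of_real scaleR_blinfun.rep_eq)

text \<open>Lets a weak-* neighbourhood of 0 be shrunk to one described by finitely many
  functionals. The intersection of an empty family is the whole type.\<close>

lemma generate_topology_on_nbhd:
  assumes "generate_topology_on S W" "x \<in> W"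
  shows "\<exists>\<U>. finite \<U> \<and> \<U> \<subseteq> S \<and> x \<in> \<Inter>\<U> \<and> \<Inter>\<U> \<subseteq> W"
  using assms
proof (induction rule: generate_topology_on.induct)
  case Empty
  then show ?case by simp
next
  case (Int a b)
  then obtain U1 U2 where "finite U1 \<and> U1 \<subseteq> S \<and> x \<in> \<Inter>U1 \<and> \<Inter>U1 \<subseteq> a"
    "finite U2 \<and> U2 \<subseteq> S \<and> x \<in> \<Inter>U2 \<and> \<Inter>U2 \<subseteq> b" by blast
  then show ?case by (intro exI[of _ "U1 \<union> U2"]) blast
next
  case (UN K)
  then obtain k where k: "k \<in> K" "x \<in> k" by blast
  from UN.IH[OF k] obtain \<U>
    where "finite \<U> \<and> \<U> \<subseteq> S \<and> x \<in> \<Inter>\<U> \<and> \<Inter>\<U> \<subseteq> k" ..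
  moreover have "k \<subseteq> \<Union>K" using k(1) by (rule Union_upper)
  ultimately show ?case by (meson order_trans)
next
  case (Basis s)
  then show ?case by (intro exI[of _ "{s}"]) simp
qed

locale algebra_with_compacts =
  fixes T :: "('h::chilbert_space \<Rightarrow>\<^sub>L 'h) set"
  assumes alg: "unital_cstar_subalgebra T" and compacts: "compact_ops \<subseteq> T"
begin

lemma T_bounded: "t \<in> T \<Longrightarrow> t \<in> bounded_ops"
  and T_id: "id_blinfun \<in> T"
  and T_add: "s \<in> T \<Longrightarrow> t \<in> T \<Longrightarrow> s + t \<in> T"
  and T_comp: "s \<in> T \<Longrightarrow> t \<in> T \<Longrightarrow> s o\<^sub>L t \<in> T"
  and T_scaleC: "t \<in> T \<Longrightarrow> c *\<^sub>C t \<in> T"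
  and T_adj: "t \<in> T \<Longrightarrow> op_adj t \<in> T"
  using alg by (auto simp: unital_cstar_subalgebra_def unital_closed_subalgebra_def)

lemma T_rank_one: "rank_one x y \<in> T"
  using compacts rank_one_in_compact_ops by blast

lemma T_scaleR: "t \<in> T \<Longrightarrow> r *\<^sub>R t \<in> T"
  using T_scaleC[of t "of_real r"] by (simp only: scaleC_of_real_blinfun)

lemma T_zero: "0 \<in> T"
  using T_scaleR[OF T_id, of 0] by simp

lemma T_diff: "s \<in> T \<Longrightarrow> t \<in> T \<Longrightarrow> s - t \<in> T"
  using T_add[of s "(-1) *\<^sub>R t"] T_scaleR[of t "-1"] by simp

lemma dualI:
  assumes "\<And>s t. s \<in> T \<Longrightarrow> t \<in> T \<Longrightarrow> g (s + t) = g s + g t"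
    and "\<And>c t. t \<in> T \<Longrightarrow> g (c *\<^sub>C t) = c * g t"
    and "\<And>t. t \<in> T \<Longrightarrow> cmod (g t) \<le> K * norm t"
  shows "ext0 T g \<in> dual T"
proof -
  have "\<exists>M. \<forall>t\<in>T. cmod (ext0 T g t) \<le> M * norm t" using assms(3) by (intro exI[of _ K]) simp
  then show ?thesis
    using assms(1,2) T_add T_scaleC
    by (auto simp: dual_def dual_space_def linear_functional_def) (simp_all add: ext0_def)
qed

lemma dual_outside: "\<phi> \<in> dual T \<Longrightarrow> t \<notin> T \<Longrightarrow> \<phi> t = 0"
  and dual_add: "\<phi> \<in> dual T \<Longrightarrow> s \<in> T \<Longrightarrow> t \<in> T \<Longrightarrow> \<phi> (s + t) = \<phi> s + \<phi> t"
  and dual_scaleC: "\<phi> \<in> dual T \<Longrightarrow> t \<in> T \<Longrightarrow> \<phi> (c *\<^sub>C t) = c * \<phi> t"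
  by (auto simp: dual_def dual_space_def linear_functional_def)

lemma dual_zero_arg: "\<phi> \<in> dual T \<Longrightarrow> \<phi> 0 = 0"
  using dual_add[of \<phi> 0 0] T_zero by simp

lemma dual_eqI: "\<phi> \<in> dual T \<Longrightarrow> \<psi> \<in> dual T \<Longrightarrow> (\<And>t. t \<in> T \<Longrightarrow> \<phi> t = \<psi> t) \<Longrightarrow> \<phi> = \<psi>"
  using dual_outside by (metis ext)

lemma dual_ext0: "\<phi> \<in> dual T \<Longrightarrow> ext0 T \<phi> = \<phi>"
  by (rule ext0_idem) (rule dual_outside)

lemma cmod_le_fnorm_unit_ball:
  assumes \<phi>: "\<phi> \<in> dual T" and t: "t \<in> T" "norm t \<le> 1"
  shows "cmod (\<phi> t) \<le> fnorm T \<phi>"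
proof -
  obtain M where M: "\<And>t. t \<in> T \<Longrightarrow> cmod (\<phi> t) \<le> M * norm t"
    using \<phi> by (auto simp: dual_def dual_space_def)
  \<comment> \<open>The bound M is not known to be nonnegative, hence the absolute value.\<close>
  have "M * norm s \<le> \<bar>M\<bar>" if "norm s \<le> 1" for s :: "'h \<Rightarrow>\<^sub>L 'h"
    using mult_mono[of M "\<bar>M\<bar>" "norm s" 1] that by simp
  then have "bdd_above ((\<lambda>t. cmod (\<phi> t)) ` {t \<in> T. norm t \<le> 1})"
    using M by (intro bdd_aboveI[of _ "\<bar>M\<bar>"]) (auto intro: order_trans)
  then show ?thesis
    unfolding fnorm_def dual_norm_def using t by (intro cSUP_upper) auto
qed

lemma fnorm_nonneg: "\<phi> \<in> dual T \<Longrightarrow> 0 \<le> fnorm T \<phi>"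
  using cmod_le_fnorm_unit_ball[OF _ T_zero, of \<phi>] by (simp add: dual_zero_arg)

lemma cmod_le_fnorm:
  assumes \<phi>: "\<phi> \<in> dual T" and t: "t \<in> T"
  shows "cmod (\<phi> t) \<le> fnorm T \<phi> * norm t"
proof (cases "t = 0")
  case False
  define u where "u = complex_of_real (inverse (norm t)) *\<^sub>C t"
  have u': "u = inverse (norm t) *\<^sub>R t"
    unfolding u_def by (rule scaleC_of_real_blinfun)
  have "cmod (\<phi> u) \<le> fnorm T \<phi>"
    using T_scaleR[OF t] False by (intro cmod_le_fnorm_unit_ball \<phi>) (simp_all add: u')
  moreover have "\<phi> u = inverse (norm t) * \<phi> t"
    unfolding u_def by (rule dual_scaleC[OF \<phi> t])
  ultimately show ?thesis
    using False by (simp add: norm_mult field_simps norm_divide)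
qed (use dual_zero_arg[OF \<phi>] in simp)

lemma fnorm_le:
  assumes "\<And>t. t \<in> T \<Longrightarrow> cmod (\<phi> t) \<le> K * norm t" "0 \<le> K"
  shows "fnorm T \<phi> \<le> K"
  unfolding fnorm_def dual_norm_def
proof (rule cSUP_least)
  show "{t \<in> T. norm t \<le> 1} \<noteq> {}" using T_zero by auto
  show "cmod (\<phi> t) \<le> K" if "t \<in> {t \<in> T. norm t \<le> 1}" for t
    using assms(1)[of t] mult_left_mono[of "norm t" 1 K] assms(2) that by auto
qed

lemma dual_closed_add: "\<phi> \<in> dual T \<Longrightarrow> \<psi> \<in> dual T \<Longrightarrow> \<phi> + \<psi> \<in> dual T"
proof -
  assume a: "\<phi> \<in> dual T" "\<psi> \<in> dual T"
  have "ext0 T (\<lambda>t. \<phi> t + \<psi> t) \<in> dual T"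
  proof (rule dualI[where K = "fnorm T \<phi> + fnorm T \<psi>"])
    fix t assume t: "t \<in> T"
    show "cmod (\<phi> t + \<psi> t) \<le> (fnorm T \<phi> + fnorm T \<psi>) * norm t"
      using cmod_le_fnorm[OF a(1) t] cmod_le_fnorm[OF a(2) t] norm_triangle_ineq[of "\<phi> t" "\<psi> t"]
      by (simp add: algebra_simps)
  qed (simp_all add: a dual_add dual_scaleC algebra_simps)
  moreover have "ext0 T (\<lambda>t. \<phi> t + \<psi> t) = \<phi> + \<psi>"
    using dual_outside[OF a(1)] dual_outside[OF a(2)] by (auto simp: ext0_def fun_eq_iff)
  ultimately show ?thesis by simp
qed

lemma dual_closed_scaleC: "\<phi> \<in> dual T \<Longrightarrow> c *\<^sub>C \<phi> \<in> dual T"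
proof -
  assume a: "\<phi> \<in> dual T"
  have "ext0 T (\<lambda>t. c * \<phi> t) \<in> dual T"
  proof (rule dualI[where K = "cmod c * fnorm T \<phi>"])
    fix t assume t: "t \<in> T"
    show "cmod (c * \<phi> t) \<le> cmod c * fnorm T \<phi> * norm t"
      using mult_left_mono[OF cmod_le_fnorm[OF a t] norm_ge_zero[of c]]
      by (simp add: norm_mult mult_ac)
  qed (simp_all add: a dual_add dual_scaleC algebra_simps)
  moreover have "ext0 T (\<lambda>t. c * \<phi> t) = c *\<^sub>C \<phi>"
    using dual_outside[OF a] by (auto simp: ext0_def fun_eq_iff scaleC_fun_def scaleC_complex_def)
  ultimately show ?thesis by simp
qed

lemma dual_closed_zero: "0 \<in> dual T"
  using dualI[of "\<lambda>_. 0" 0] by (simp add: ext0_def zero_fun_def)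

lemma dual_closed_sum: "(\<And>i. i \<in> I \<Longrightarrow> f i \<in> dual T) \<Longrightarrow> sum f I \<in> dual T"
  by (induction I rule: infinite_finite_induct) (auto intro: dual_closed_zero dual_closed_add)

lemma bidualI:
  assumes "\<And>\<phi> \<psi>. \<phi> \<in> dual T \<Longrightarrow> \<psi> \<in> dual T \<Longrightarrow> g (\<phi> + \<psi>) = g \<phi> + g \<psi>"
    and "\<And>c \<phi>. \<phi> \<in> dual T \<Longrightarrow> g (c *\<^sub>C \<phi>) = c * g \<phi>"
    and "\<And>\<phi>. \<phi> \<in> dual T \<Longrightarrow> cmod (g \<phi>) \<le> K * fnorm T \<phi>"
  shows "ext0 (dual T) g \<in> bidual T"
proof -
  have "\<exists>M. \<forall>\<phi>\<in>dual T. cmod (ext0 (dual T) g \<phi>) \<le> M * fnorm T \<phi>"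
    using assms(3) by (intro exI[of _ K]) simp
  then show ?thesis
    using assms(1,2) dual_closed_add dual_closed_scaleC
    by (auto simp: bidual_def dual_space_def linear_functional_def) (simp_all add: ext0_def)
qed

lemma bidual_outside: "\<xi> \<in> bidual T \<Longrightarrow> \<phi> \<notin> dual T \<Longrightarrow> \<xi> \<phi> = 0"
  and bidual_add: "\<xi> \<in> bidual T \<Longrightarrow> \<phi> \<in> dual T \<Longrightarrow> \<psi> \<in> dual T \<Longrightarrow> \<xi> (\<phi> + \<psi>) = \<xi> \<phi> + \<xi> \<psi>"
  and bidual_scaleC: "\<xi> \<in> bidual T \<Longrightarrow> \<phi> \<in> dual T \<Longrightarrow> \<xi> (c *\<^sub>C \<phi>) = c * \<xi> \<phi>"
  by (auto simp: bidual_def dual_space_def linear_functional_def)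

lemma bidual_zero_arg: "\<xi> \<in> bidual T \<Longrightarrow> \<xi> 0 = 0"
  using bidual_add[of \<xi> 0 0] dual_closed_zero by simp

lemma bidual_sum:
  "\<xi> \<in> bidual T \<Longrightarrow> (\<And>i. i \<in> I \<Longrightarrow> f i \<in> dual T) \<Longrightarrow> \<xi> (sum f I) = (\<Sum>i\<in>I. \<xi> (f i))"
  by (induction I rule: infinite_finite_induct)
    (auto simp: bidual_zero_arg bidual_add dual_closed_sum)

lemma bidual_eqI:
  "\<xi> \<in> bidual T \<Longrightarrow> \<eta> \<in> bidual T \<Longrightarrow> (\<And>\<phi>. \<phi> \<in> dual T \<Longrightarrow> \<xi> \<phi> = \<eta> \<phi>) \<Longrightarrow> \<xi> = \<eta>"
  using bidual_outside by (metis ext)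

lemma bidual_bound:
  assumes "\<xi> \<in> bidual T"
  obtains M where "0 \<le> M" "\<And>\<phi>. \<phi> \<in> dual T \<Longrightarrow> cmod (\<xi> \<phi>) \<le> M * fnorm T \<phi>"
proof -
  obtain M where M: "\<And>\<phi>. \<phi> \<in> dual T \<Longrightarrow> cmod (\<xi> \<phi>) \<le> M * fnorm T \<phi>"
    using assms by (auto simp: bidual_def dual_space_def)
  have "M * fnorm T \<phi> \<le> \<bar>M\<bar> * fnorm T \<phi>" if "\<phi> \<in> dual T" for \<phi>
    using fnorm_nonneg[OF that] by (intro mult_right_mono) auto
  then show ?thesis using M that[of "\<bar>M\<bar>"] by (meson abs_ge_zero order_trans)
qed

lemma bidual_closed_add: "\<xi> \<in> bidual T \<Longrightarrow> \<eta> \<in> bidual T \<Longrightarrow> \<xi> + \<eta> \<in> bidual T"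
proof -
  assume a: "\<xi> \<in> bidual T" "\<eta> \<in> bidual T"
  obtain M N where M: "\<And>\<phi>. \<phi> \<in> dual T \<Longrightarrow> cmod (\<xi> \<phi>) \<le> M * fnorm T \<phi>"
    and N: "\<And>\<phi>. \<phi> \<in> dual T \<Longrightarrow> cmod (\<eta> \<phi>) \<le> N * fnorm T \<phi>"
    using bidual_bound a by metis
  have "ext0 (dual T) (\<lambda>\<phi>. \<xi> \<phi> + \<eta> \<phi>) \<in> bidual T"
  proof (rule bidualI[where K = "M + N"])
    fix \<phi> assume \<phi>: "\<phi> \<in> dual T"
    show "cmod (\<xi> \<phi> + \<eta> \<phi>) \<le> (M + N) * fnorm T \<phi>"
      using M[OF \<phi>] N[OF \<phi>] norm_triangle_ineq[of "\<xi> \<phi>" "\<eta> \<phi>"] by (simp add: algebra_simps)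
  qed (simp_all add: a bidual_add bidual_scaleC algebra_simps)
  moreover have "ext0 (dual T) (\<lambda>\<phi>. \<xi> \<phi> + \<eta> \<phi>) = \<xi> + \<eta>"
    using bidual_outside[OF a(1)] bidual_outside[OF a(2)] by (auto simp: ext0_def fun_eq_iff)
  ultimately show ?thesis by simp
qed

lemma bidual_closed_scaleC: "\<xi> \<in> bidual T \<Longrightarrow> c *\<^sub>C \<xi> \<in> bidual T"
proof -
  assume a: "\<xi> \<in> bidual T"
  obtain M where M: "\<And>\<phi>. \<phi> \<in> dual T \<Longrightarrow> cmod (\<xi> \<phi>) \<le> M * fnorm T \<phi>"
    using bidual_bound a by metis
  have "ext0 (dual T) (\<lambda>\<phi>. c * \<xi> \<phi>) \<in> bidual T"
  proof (rule bidualI[where K = "cmod c * M"])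
    fix \<phi> assume \<phi>: "\<phi> \<in> dual T"
    show "cmod (c * \<xi> \<phi>) \<le> cmod c * M * fnorm T \<phi>"
      using mult_left_mono[OF M[OF \<phi>] norm_ge_zero[of c]] by (simp add: norm_mult mult_ac)
  qed (simp_all add: a bidual_add bidual_scaleC algebra_simps)
  moreover have "ext0 (dual T) (\<lambda>\<phi>. c * \<xi> \<phi>) = c *\<^sub>C \<xi>"
    using bidual_outside[OF a] by (auto simp: ext0_def fun_eq_iff scaleC_fun_def scaleC_complex_def)
  ultimately show ?thesis by simp
qed

lemma bidual_closed_zero: "0 \<in> bidual T"
  using bidualI[of "\<lambda>_. 0" 0] by (simp add: ext0_def zero_fun_def)

lemma bidual_closed_diff: "\<xi> \<in> bidual T \<Longrightarrow> \<eta> \<in> bidual T \<Longrightarrow> \<xi> - \<eta> \<in> bidual T"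
proof -
  assume a: "\<xi> \<in> bidual T" "\<eta> \<in> bidual T"
  have "\<xi> + (-1) *\<^sub>C \<eta> \<in> bidual T" by (intro bidual_closed_add bidual_closed_scaleC a)
  also have "\<xi> + (-1) *\<^sub>C \<eta> = \<xi> - \<eta>" by (simp add: fun_eq_iff scaleC_fun_def)
  finally show ?thesis .
qed

lemma embed_in_bidual: "t \<in> T \<Longrightarrow> embed T t \<in> bidual T"
  unfolding embed_def
proof (rule bidualI[where K = "norm t"])
  show "cmod (\<phi> t) \<le> norm t * fnorm T \<phi>" if "t \<in> T" "\<phi> \<in> dual T" for \<phi>
    using cmod_le_fnorm[OF that(2,1)] by (simp add: mult.commute)
qed (simp_all add: scaleC_fun_def scaleC_complex_def)

lemma embed_apply: "\<phi> \<in> dual T \<Longrightarrow> embed T t \<phi> = \<phi> t"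
  by (simp add: embed_def)

subsection \<open>Weak-* continuous functionals\<close>

lemma topspace_weak_star_bidual: "topspace (weak_star_bidual T) = bidual T"
proof -
  have "bidual T \<in> {{\<xi> \<in> bidual T. f \<xi> \<in> U} |f U. f \<in> {\<lambda>\<xi>. \<xi> \<phi> |\<phi>. \<phi> \<in> dual T} \<and> open U}"
    using dual_closed_zero by (auto intro!: exI[of _ "\<lambda>\<xi>. \<xi> 0"] exI[of _ "UNIV::complex set"])
  then have "bidual T \<subseteq> \<Union>{{\<xi> \<in> bidual T. f \<xi> \<in> U} |f U. f \<in> {\<lambda>\<xi>. \<xi> \<phi> |\<phi>. \<phi> \<in> dual T} \<and> open U}"
    by (rule Union_upper)
  then show ?thesis
    by (auto simp: weak_star_bidual_def initial_topology_def)
qed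

text \<open>Extended by 0 like every functional here, so that the uniqueness statements for
  \<open>hat\<close> and \<open>modulus\<close> become equalities of functions.\<close>

definition ev :: "'h functional \<Rightarrow> 'h bifunctional \<Rightarrow> complex" where
  "ev \<phi> = ext0 (bidual T) (\<lambda>\<xi>. \<xi> \<phi>)"

lemma ev_apply: "\<xi> \<in> bidual T \<Longrightarrow> ev \<phi> \<xi> = \<xi> \<phi>"
  by (simp add: ev_def)

lemma linear_functional_ev: "linear_functional (bidual T) (ev \<phi>)"
  unfolding linear_functional_def ev_def ext0_def
  by (simp add: bidual_closed_add bidual_closed_scaleC)
    (simp add: scaleC_fun_def scaleC_complex_def)

lemma weak_star_functional_ev:
  assumes "\<phi> \<in> dual T"
  shows "weak_star_functional T (ev \<phi>)"
  unfolding weak_star_functional_def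
proof
  show "continuous_map (weak_star_bidual T) euclidean (ev \<phi>)"
    unfolding continuous_map_def topspace_weak_star_bidual
  proof (intro conjI allI impI)
    fix U :: "complex set" assume "openin euclidean U"
    then have "{\<xi> \<in> bidual T. \<xi> \<phi> \<in> U} \<in>
        {{\<xi> \<in> bidual T. f \<xi> \<in> U} |f U. f \<in> {\<lambda>\<xi>. \<xi> \<phi> |\<phi>. \<phi> \<in> dual T} \<and> open U}"
      using assms by (auto simp: intro!: exI[of _ "\<lambda>\<xi>. \<xi> \<phi>"])
    then have "openin (weak_star_bidual T) {\<xi> \<in> bidual T. \<xi> \<phi> \<in> U}"
      unfolding weak_star_bidual_def initial_topology_def by (rule topology_generated_by_Basis)
    also have "{\<xi> \<in> bidual T. \<xi> \<phi> \<in> U} = {\<xi> \<in> bidual T. ev \<phi> \<xi> \<in> U}"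
      by (auto simp: ev_def)
    finally show "openin (weak_star_bidual T) {\<xi> \<in> bidual T. ev \<phi> \<xi> \<in> U}" .
  qed auto
qed (rule linear_functional_ev)

text \<open>Continuity at 0 bounds \<Phi> by 1 on a set cut out by finitely many evaluations.
  Linearity then forces \<Phi> to vanish on their common kernel, so it is a combination of
  them.\<close>

lemma weak_star_functional_is_ev:
  assumes \<Phi>: "weak_star_functional T \<Phi>"
  shows "\<exists>\<phi>\<in>dual T. \<Phi> = ev \<phi>"
proof -
  have lin: "linear_functional (bidual T) \<Phi>" and cont: "continuous_map (weak_star_bidual T) euclidean \<Phi>"
    using \<Phi> by (auto simp: weak_star_functional_def)
  have sc: "\<Phi> (c *\<^sub>C \<xi>) = c * \<Phi> \<xi>" if "\<xi> \<in> bidual T" for c \<xi>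
    using lin that by (auto simp: linear_functional_def)
  have "(0::'h bifunctional) = 0 *\<^sub>C 0" by (simp add: scaleC_fun_def fun_eq_iff)
  then have \<Phi>0: "\<Phi> 0 = 0" using sc[OF bidual_closed_zero, of 0] by simp
  define S where "S = {{\<xi> \<in> bidual T. f \<xi> \<in> U} |f U. f \<in> {\<lambda>\<xi>. \<xi> \<phi> |\<phi>. \<phi> \<in> dual T} \<and> open U}"
  define W where "W = {\<xi> \<in> bidual T. \<Phi> \<xi> \<in> ball 0 1}"
  have "openin (weak_star_bidual T) W"
    using openin_continuous_map_preimage[OF cont, of "ball 0 1"]
    by (simp add: W_def topspace_weak_star_bidual)
  then have "generate_topology_on S W"
    by (simp add: weak_star_bidual_def initial_topology_def S_def openin_topology_generated_by_iff)
  moreover have "0 \<in> W" using \<Phi>0 by (simp add: W_def bidual_closed_zero)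
  ultimately obtain \<U> where \<U>: "finite \<U>" "\<U> \<subseteq> S" "0 \<in> \<Inter>\<U>" "\<Inter>\<U> \<subseteq> W"
    using generate_topology_on_nbhd by meson
  have "\<forall>U\<in>\<U>. \<exists>\<phi>. \<phi> \<in> dual T \<and> (\<exists>G. U = {\<xi> \<in> bidual T. \<xi> \<phi> \<in> G})"
    using \<U>(2) unfolding S_def by blast
  from bchoice[OF this] obtain p where
    p': "\<forall>U\<in>\<U>. p U \<in> dual T \<and> (\<exists>G. U = {\<xi> \<in> bidual T. \<xi> (p U) \<in> G})" ..
  have p: "p U \<in> dual T" and U: "\<exists>G. U = {\<xi> \<in> bidual T. \<xi> (p U) \<in> G}" if "U \<in> \<U>" for U
    using bspec[OF p' that] by simp_all
  have ker: "\<Phi> \<xi> = 0" if \<xi>: "\<xi> \<in> bidual T" and 0: "\<And>U. U \<in> \<U> \<Longrightarrow> ev (p U) \<xi> = 0" for \<xi>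
  proof (rule ccontr)
    assume ne: "\<Phi> \<xi> \<noteq> 0"
    \<comment> \<open>Scaled to \<Phi> \<eta> = 1, just outside the open unit ball, while the chosen
      evaluations remain 0.\<close>
    define \<eta> where "\<eta> = (1 / \<Phi> \<xi>) *\<^sub>C \<xi>"
    have \<eta>: "\<eta> \<in> bidual T" using \<xi> by (simp add: \<eta>_def bidual_closed_scaleC)
    have "\<eta> \<in> U" if UU: "U \<in> \<U>" for U
    proof -
      obtain G where G: "U = {\<xi> \<in> bidual T. \<xi> (p U) \<in> G}" using U[OF UU] ..
      have "0 \<in> U" using \<U>(3) UU by blast
      then have "0 \<in> G" by (subst (asm) G) simp
      moreover have "\<eta> (p U) = 0"
        using 0[OF UU] \<xi> by (simp add: \<eta>_def ev_def scaleC_fun_def scaleC_complex_def)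
      ultimately show ?thesis by (subst G) (simp add: \<eta>)
    qed
    then have "\<eta> \<in> W" using \<U>(4) by blast
    moreover have "\<Phi> \<eta> = 1" using ne sc[OF \<xi>] by (simp add: \<eta>_def)
    ultimately show False by (simp add: W_def)
  qed
  obtain c where c: "\<forall>\<xi>\<in>bidual T. \<Phi> \<xi> = (\<Sum>U\<in>\<U>. c U * ev (p U) \<xi>)"
    using functional_in_span_of_kernels[of \<U> "bidual T" "\<lambda>U. ev (p U)" \<Phi>] ker lin \<U>(1)
      linear_functional_ev bidual_closed_add bidual_closed_scaleC by blast
  define \<phi> where "\<phi> = (\<Sum>U\<in>\<U>. c U *\<^sub>C p U)"
  have \<phi>: "\<phi> \<in> dual T"
    unfolding \<phi>_def by (intro dual_closed_sum dual_closed_scaleC p)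
  have "\<Phi> \<xi> = ev \<phi> \<xi>" for \<xi>
  proof (cases "\<xi> \<in> bidual T")
    case True
    have "\<xi> \<phi> = (\<Sum>U\<in>\<U>. \<xi> (c U *\<^sub>C p U))"
      unfolding \<phi>_def using p dual_closed_scaleC by (intro bidual_sum True) auto
    then show ?thesis
      using True c p by (simp add: ev_apply bidual_scaleC)
  next
    case False
    then show ?thesis using lin by (simp add: linear_functional_def ev_def ext0_def)
  qed
  with \<phi> show ?thesis by blast
qed

text \<open>A competing extension is evaluation at some \<psi>, and its values on the embedded T
  give back \<psi>. From here on \<open>hat\<close> is plain evaluation.\<close>

lemma hat_eq:
  assumes \<phi>: "\<phi> \<in> dual T"
  shows "hat T \<phi> = ev \<phi>"
  unfolding hat_def
proof (rule the_equality)
  show "weak_star_functional T (ev \<phi>) \<and> (\<forall>t\<in>T. ev \<phi> (embed T t) = \<phi> t)"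
    using \<phi> by (simp add: weak_star_functional_ev ev_apply embed_in_bidual embed_apply)
  fix \<Phi> assume \<Phi>: "weak_star_functional T \<Phi> \<and> (\<forall>t\<in>T. \<Phi> (embed T t) = \<phi> t)"
  then obtain \<psi> where \<psi>: "\<psi> \<in> dual T" "\<Phi> = ev \<psi>" using weak_star_functional_is_ev by blast
  have "\<psi> = \<phi>"
    using \<Phi> \<psi> by (intro dual_eqI \<phi>) (auto simp: ev_apply embed_in_bidual embed_apply)
  then show "\<Phi> = ev \<phi>" using \<psi> by simp
qed

subsection \<open>The Arens product and the involution\<close>

definition slice :: "'h functional \<Rightarrow> ('h \<Rightarrow>\<^sub>L 'h) \<Rightarrow> 'h functional" where
  "slice \<phi> a = ext0 T (\<lambda>b. \<phi> (a o\<^sub>L b))"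

text \<open>The module action of the bidual on the dual: the first Arens product of \<xi> and \<eta>
  takes \<phi> to \<xi> (\<open>act \<eta> \<phi>\<close>).\<close>

definition act :: "'h bifunctional \<Rightarrow> 'h functional \<Rightarrow> 'h functional" where
  "act \<eta> \<phi> = ext0 T (\<lambda>a. \<eta> (slice \<phi> a))"

lemma slice_apply: "b \<in> T \<Longrightarrow> slice \<phi> a b = \<phi> (a o\<^sub>L b)"
  and slice_outside: "b \<notin> T \<Longrightarrow> slice \<phi> a b = 0"
  by (simp_all add: slice_def ext0_def)

lemma act_apply: "a \<in> T \<Longrightarrow> act \<eta> \<phi> a = \<eta> (slice \<phi> a)"
  and act_outside: "a \<notin> T \<Longrightarrow> act \<eta> \<phi> a = 0"
  by (simp_all add: act_def ext0_def)

lemma bmult_apply: "\<phi> \<in> dual T \<Longrightarrow> bmult T \<xi> \<eta> \<phi> = \<xi> (act \<eta> \<phi>)"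
  by (simp add: bmult_def act_def slice_def)

lemma slice_bound: 
  assumes "\<phi> \<in> dual T" "a \<in> T" "b \<in> T"
  shows "cmod (\<phi> (a o\<^sub>L b)) \<le> fnorm T \<phi> * norm a * norm b"
  using cmod_le_fnorm[OF assms(1) T_comp[OF assms(2,3)]]
    mult_left_mono[OF norm_blinfun_compose[of a b] fnorm_nonneg[OF assms(1)]]
  by (simp add: mult_ac)

lemma compose_add_right: "a o\<^sub>L (b + c) = (a o\<^sub>L b) + (a o\<^sub>L c)" for a :: "'h \<Rightarrow>\<^sub>L 'h" and b c :: "'h \<Rightarrow>\<^sub>L 'h"
  by (rule blinfun_eqI) (simp add: blinfun.add_left blinfun.add_right)

lemma compose_add_left: "(a + b) o\<^sub>L c = (a o\<^sub>L c) + (b o\<^sub>L c)" for a :: "'h \<Rightarrow>\<^sub>L 'h" and b c :: "'h \<Rightarrow>\<^sub>L 'h"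
  by (rule blinfun_eqI) (simp add: blinfun.add_left)

lemma compose_scaleC_right: "a \<in> T \<Longrightarrow> a o\<^sub>L (c *\<^sub>C b) = c *\<^sub>C (a o\<^sub>L b)"
  by (rule blinfun_eqI) (simp add: bounded_ops_scaleC T_bounded)

lemma compose_scaleC_left: "(c *\<^sub>C a) o\<^sub>L b = c *\<^sub>C (a o\<^sub>L b)" for a :: "'h \<Rightarrow>\<^sub>L 'h" and b :: "'h \<Rightarrow>\<^sub>L 'h"
  by (rule blinfun_eqI) simp

lemma slice_in_dual: "\<phi> \<in> dual T \<Longrightarrow> a \<in> T \<Longrightarrow> slice \<phi> a \<in> dual T"
  unfolding slice_def
  by (rule dualI[where K = "fnorm T \<phi> * norm a"])
    (simp_all add: compose_add_right compose_scaleC_right dual_add dual_scaleC T_comp slice_bound)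

lemma fnorm_slice: "\<phi> \<in> dual T \<Longrightarrow> a \<in> T \<Longrightarrow> fnorm T (slice \<phi> a) \<le> fnorm T \<phi> * norm a"
  by (rule fnorm_le) (simp_all add: slice_def slice_bound fnorm_nonneg)

lemma slice_add_right:
  assumes "\<phi> \<in> dual T" "a \<in> T" "b \<in> T"
  shows "slice \<phi> (a + b) = slice \<phi> a + slice \<phi> b"
  by (rule ext) (simp add: slice_def ext0_def compose_add_left dual_add T_comp assms)

lemma slice_scaleC_right:
  assumes "\<phi> \<in> dual T" "a \<in> T"
  shows "slice \<phi> (c *\<^sub>C a) = c *\<^sub>C slice \<phi> a"
  by (rule ext)
    (simp add: slice_def ext0_def compose_scaleC_left dual_scaleC T_comp assms scaleC_fun_def scaleC_complex_def)

lemma slice_add_left: "slice (\<phi> + \<psi>) a = slice \<phi> a + slice \<psi> a"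
  by (rule ext) (simp add: slice_def ext0_def)

lemma slice_scaleC_left: "slice (c *\<^sub>C \<phi>) a = c *\<^sub>C slice \<phi> a"
  by (rule ext) (simp add: slice_def ext0_def scaleC_fun_def scaleC_complex_def)

lemma act_bound:
  assumes \<eta>: "\<eta> \<in> bidual T"
  obtains M where "0 \<le> M"
    "\<And>\<phi> a. \<phi> \<in> dual T \<Longrightarrow> a \<in> T \<Longrightarrow> cmod (\<eta> (slice \<phi> a)) \<le> M * fnorm T \<phi> * norm a"
proof -
  obtain M where M: "0 \<le> M" "\<And>\<phi>. \<phi> \<in> dual T \<Longrightarrow> cmod (\<eta> \<phi>) \<le> M * fnorm T \<phi>"
    using bidual_bound[OF \<eta>] by blast
  have "cmod (\<eta> (slice \<phi> a)) \<le> M * fnorm T \<phi> * norm a" if "\<phi> \<in> dual T" "a \<in> T" for \<phi> a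
    using M(2)[OF slice_in_dual[OF that]] mult_left_mono[OF fnorm_slice[OF that] M(1)]
    by (simp add: mult_ac)
  with M(1) show ?thesis using that by blast
qed

lemma act_in_dual:
  assumes "\<eta> \<in> bidual T" "\<phi> \<in> dual T"
  shows "act \<eta> \<phi> \<in> dual T"
proof -
  obtain M where M: "\<And>\<phi> a. \<phi> \<in> dual T \<Longrightarrow> a \<in> T \<Longrightarrow> cmod (\<eta> (slice \<phi> a)) \<le> M * fnorm T \<phi> * norm a"
    using act_bound[OF assms(1)] by metis
  show ?thesis
    unfolding act_def
    by (rule dualI[where K = "M * fnorm T \<phi>"])
      (simp_all add: slice_add_right slice_scaleC_right bidual_add bidual_scaleC slice_in_dual M assms)
qed

lemma act_add:
  assumes "\<eta> \<in> bidual T" "\<phi> \<in> dual T" "\<psi> \<in> dual T"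
  shows "act \<eta> (\<phi> + \<psi>) = act \<eta> \<phi> + act \<eta> \<psi>"
  by (rule ext) (simp add: act_def ext0_def slice_add_left bidual_add slice_in_dual assms)

lemma act_scaleC:
  assumes "\<eta> \<in> bidual T" "\<phi> \<in> dual T"
  shows "act \<eta> (c *\<^sub>C \<phi>) = c *\<^sub>C act \<eta> \<phi>"
  by (rule ext) (simp add: act_def ext0_def slice_scaleC_left bidual_scaleC slice_in_dual assms
      scaleC_fun_def[of c "\<lambda>x. if x \<in> T then \<eta> (slice \<phi> x) else 0"] scaleC_complex_def)

lemma bmult_in_bidual:
  assumes "\<xi> \<in> bidual T" "\<eta> \<in> bidual T"
  shows "bmult T \<xi> \<eta> \<in> bidual T"
proof -
  obtain M where M: "0 \<le> M"
    "\<And>\<phi> a. \<phi> \<in> dual T \<Longrightarrow> a \<in> T \<Longrightarrow> cmod (\<eta> (slice \<phi> a)) \<le> M * fnorm T \<phi> * norm a"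
    using act_bound[OF assms(2)] by blast
  obtain N where N: "0 \<le> N" "\<And>\<phi>. \<phi> \<in> dual T \<Longrightarrow> cmod (\<xi> \<phi>) \<le> N * fnorm T \<phi>"
    using bidual_bound[OF assms(1)] by blast
  have "cmod (\<xi> (act \<eta> \<phi>)) \<le> N * M * fnorm T \<phi>" if \<phi>: "\<phi> \<in> dual T" for \<phi>
  proof -
    have "fnorm T (act \<eta> \<phi>) \<le> M * fnorm T \<phi>"
      by (rule fnorm_le) (simp_all add: act_def M fnorm_nonneg \<phi>)
    then show ?thesis
      using N(2)[OF act_in_dual[OF assms(2) \<phi>]] mult_left_mono[OF _ N(1)] by (fastforce simp: mult_ac)
  qed
  then have "ext0 (dual T) (\<lambda>\<phi>. \<xi> (act \<eta> \<phi>)) \<in> bidual T"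
    using assms by (intro bidualI[where K = "N * M"])
      (simp_all add: act_add act_scaleC bidual_add bidual_scaleC act_in_dual)
  then show ?thesis by (simp add: bmult_def act_def slice_def)
qed

text \<open>The module law behind associativity. Slicing twice is slicing by the product, so
  \<open>act \<zeta>\<close> commutes with slices.\<close>

lemma act_bmult:
  assumes "\<eta> \<in> bidual T" "\<zeta> \<in> bidual T" "\<phi> \<in> dual T"
  shows "act (bmult T \<eta> \<zeta>) \<phi> = act \<eta> (act \<zeta> \<phi>)"
proof -
  have ss: "slice (slice \<phi> a) b = slice \<phi> (a o\<^sub>L b)" if "a \<in> T" "b \<in> T" for a b
  proof -
    have "a o\<^sub>L (b o\<^sub>L c) = (a o\<^sub>L b) o\<^sub>L c" for c :: "'h \<Rightarrow>\<^sub>L 'h"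
      by (rule blinfun_eqI) simp
    then show ?thesis
      using that by (auto simp: slice_def ext0_def T_comp fun_eq_iff)
  qed
  have "act \<zeta> (slice \<phi> a) = slice (act \<zeta> \<phi>) a" if "a \<in> T" for a
  proof (rule ext)
    fix b
    show "act \<zeta> (slice \<phi> a) b = slice (act \<zeta> \<phi>) a b"
      using that by (cases "b \<in> T")
        (simp_all add: act_apply act_outside slice_apply slice_outside ss T_comp)
  qed
  then show ?thesis
    using assms by (auto simp: act_def[of \<eta>] act_def[of "bmult T \<eta> \<zeta>"] bmult_apply slice_in_dual
        intro!: ext0_cong)
qed

lemma bmult_assoc:
  assumes "\<xi> \<in> bidual T" "\<eta> \<in> bidual T" "\<zeta> \<in> bidual T"
  shows "bmult T (bmult T \<xi> \<eta>) \<zeta> = bmult T \<xi> (bmult T \<eta> \<zeta>)"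
  by (rule bidual_eqI) (simp_all add: assms bmult_in_bidual bmult_apply act_bmult act_in_dual)

text \<open>Right multiplication by an element of T amounts to right translation of functionals;
  most explicit products below are computed this way.\<close>

lemma act_embed:
  assumes "\<phi> \<in> dual T" "t \<in> T"
  shows "act (embed T t) \<phi> = ext0 T (\<lambda>a. \<phi> (a o\<^sub>L t))"
  unfolding act_def
  by (rule ext0_cong) (simp add: embed_apply slice_in_dual assms, simp add: slice_def assms)

lemma compose_id: "a o\<^sub>L id_blinfun = a" "id_blinfun o\<^sub>L a = a" for a :: "'h \<Rightarrow>\<^sub>L 'h"
  by (rule blinfun_eqI, simp)+

lemma act_bone: "\<phi> \<in> dual T \<Longrightarrow> act (bone T) \<phi> = \<phi>"
  unfolding bone_def by (subst act_embed) (simp_all add: T_id dual_ext0 compose_id)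

lemma bone_in_bidual: "bone T \<in> bidual T"
  unfolding bone_def by (rule embed_in_bidual[OF T_id])

lemma bmult_bone_right: "\<xi> \<in> bidual T \<Longrightarrow> bmult T \<xi> (bone T) = \<xi>"
  by (rule bidual_eqI) (simp_all add: bmult_in_bidual bone_in_bidual bmult_apply act_bone)

lemma bmult_bone_left:
  assumes "\<xi> \<in> bidual T"
  shows "bmult T (bone T) \<xi> = \<xi>"
proof (rule bidual_eqI)
  fix \<phi> assume \<phi>: "\<phi> \<in> dual T"
  have "slice \<phi> id_blinfun = \<phi>" using \<phi> by (simp add: slice_def dual_ext0 compose_id)
  then show "bmult T (bone T) \<xi> \<phi> = \<xi> \<phi>"
    using \<phi> assms by (simp add: bmult_apply bone_def embed_apply act_in_dual)
      (simp add: act_def T_id)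
qed (simp_all add: assms bmult_in_bidual bone_in_bidual)

lemma bmult_add_left: "bmult T (\<xi> + \<eta>) \<zeta> = bmult T \<xi> \<zeta> + bmult T \<eta> \<zeta>"
  by (rule ext) (simp add: bmult_def ext0_def)

lemma bmult_scaleC_left: "bmult T (c *\<^sub>C \<xi>) \<zeta> = c *\<^sub>C bmult T \<xi> \<zeta>"
  by (rule ext) (simp add: bmult_def ext0_def scaleC_fun_def scaleC_complex_def)

lemma act_add_left: "act (\<eta> + \<zeta>) \<phi> = act \<eta> \<phi> + act \<zeta> \<phi>"
  by (rule ext) (simp add: act_def ext0_def)

lemma act_scaleC_left: "act (c *\<^sub>C \<eta>) \<phi> = c *\<^sub>C act \<eta> \<phi>"
  by (rule ext) (simp add: act_def ext0_def scaleC_fun_def scaleC_complex_def)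

lemma bmult_add_right:
  assumes "\<xi> \<in> bidual T" "\<eta> \<in> bidual T" "\<zeta> \<in> bidual T"
  shows "bmult T \<xi> (\<eta> + \<zeta>) = bmult T \<xi> \<eta> + bmult T \<xi> \<zeta>"
  by (rule bidual_eqI)
    (simp_all add: assms bmult_in_bidual bidual_closed_add bmult_apply act_add_left bidual_add act_in_dual)

lemma bmult_scaleC_right:
  assumes "\<xi> \<in> bidual T" "\<eta> \<in> bidual T"
  shows "bmult T \<xi> (c *\<^sub>C \<eta>) = c *\<^sub>C bmult T \<xi> \<eta>"
proof (rule bidual_eqI)
  fix \<phi> assume \<phi>: "\<phi> \<in> dual T"
  have "bmult T \<xi> (c *\<^sub>C \<eta>) \<phi> = c * bmult T \<xi> \<eta> \<phi>"
    by (simp add: assms \<phi> bmult_apply act_scaleC_left bidual_scaleC act_in_dual)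
  then show "bmult T \<xi> (c *\<^sub>C \<eta>) \<phi> = (c *\<^sub>C bmult T \<xi> \<eta>) \<phi>"
    by (simp add: scaleC_fun_def scaleC_complex_def)
qed (simp_all add: assms bmult_in_bidual bidual_closed_scaleC)

lemma fun_diff_scaleC: "\<xi> - \<eta> = \<xi> + (-1) *\<^sub>C (\<eta> :: 'b \<Rightarrow> complex)"
  by (simp add: fun_eq_iff scaleC_fun_def)

lemma bmult_diff_right:
  assumes "\<xi> \<in> bidual T" "\<eta> \<in> bidual T" "\<zeta> \<in> bidual T"
  shows "bmult T \<xi> (\<eta> - \<zeta>) = bmult T \<xi> \<eta> - bmult T \<xi> \<zeta>"
  by (simp only: fun_diff_scaleC bmult_add_right bmult_scaleC_right bidual_closed_scaleC assms)

lemma bmult_embed: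
  assumes "s \<in> T" "t \<in> T"
  shows "bmult T (embed T s) (embed T t) = embed T (s o\<^sub>L t)"
  by (rule bidual_eqI) (simp_all add: assms bmult_in_bidual embed_in_bidual T_comp bmult_apply act_in_dual embed_apply,
      simp add: act_embed assms)

lemma embed_diff: "s \<in> T \<Longrightarrow> t \<in> T \<Longrightarrow> embed T (s - t) = embed T s - embed T t"
proof (rule bidual_eqI)
  fix \<phi> assume a: "s \<in> T" "t \<in> T" "\<phi> \<in> dual T"
  have "\<phi> ((s - t) + t) = \<phi> (s - t) + \<phi> t" using a T_diff dual_add by blast
  then show "embed T (s - t) \<phi> = (embed T s - embed T t) \<phi>" using a by (simp add: embed_apply)
qed (simp_all add: embed_in_bidual T_diff bidual_closed_diff)

lemma embed_add: "s \<in> T \<Longrightarrow> t \<in> T \<Longrightarrow> embed T (s + t) = embed T s + embed T t"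
  by (rule bidual_eqI) (simp_all add: embed_in_bidual T_add bidual_closed_add embed_apply dual_add)

lemma dagger_apply: "t \<in> T \<Longrightarrow> dagger T \<phi> t = cnj (\<phi> (op_adj t))"
  by (simp add: dagger_def)

lemma dagger_bound: "\<phi> \<in> dual T \<Longrightarrow> t \<in> T \<Longrightarrow> cmod (\<phi> (op_adj t)) \<le> fnorm T \<phi> * norm t"
  using cmod_le_fnorm[OF _ T_adj, of \<phi> t] mult_left_mono[OF norm_op_adj_le[OF T_bounded, of t] fnorm_nonneg, of \<phi>]
  by simp

lemma dagger_in_dual:
  assumes "\<phi> \<in> dual T"
  shows "dagger T \<phi> \<in> dual T"
  unfolding dagger_def
  by (rule dualI[where K = "fnorm T \<phi>"])
    (simp_all add: assms op_adj_add op_adj_scaleC T_bounded T_add T_scaleC T_adj dual_add dual_scaleC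
      dagger_bound)

lemma fnorm_dagger_le: "\<phi> \<in> dual T \<Longrightarrow> fnorm T (dagger T \<phi>) \<le> fnorm T \<phi>"
  by (rule fnorm_le) (simp_all add: dagger_apply dagger_bound fnorm_nonneg)

lemma dagger_dagger: "\<phi> \<in> dual T \<Longrightarrow> dagger T (dagger T \<phi>) = \<phi>"
  by (rule dual_eqI) (simp_all add: dagger_in_dual dagger_apply T_adj op_adj_op_adj T_bounded)

lemma fnorm_dagger: "\<phi> \<in> dual T \<Longrightarrow> fnorm T (dagger T \<phi>) = fnorm T \<phi>"
  by (metis antisym dagger_dagger dagger_in_dual fnorm_dagger_le)

lemma dagger_add: "dagger T (\<phi> + \<psi>) = dagger T \<phi> + dagger T \<psi>"
  by (rule ext) (simp add: dagger_def ext0_def)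

lemma dagger_scaleC: "dagger T (c *\<^sub>C \<phi>) = cnj c *\<^sub>C dagger T \<phi>"
  by (rule ext) (simp add: dagger_def ext0_def scaleC_fun_def scaleC_complex_def)

lemma bstar_apply: "\<phi> \<in> dual T \<Longrightarrow> bstar T \<xi> \<phi> = cnj (\<xi> (dagger T \<phi>))"
  by (simp add: bstar_def)

lemma bstar_in_bidual:
  assumes "\<xi> \<in> bidual T"
  shows "bstar T \<xi> \<in> bidual T"
proof -
  obtain M where M: "\<And>\<phi>. \<phi> \<in> dual T \<Longrightarrow> cmod (\<xi> \<phi>) \<le> M * fnorm T \<phi>"
    using bidual_bound[OF assms] by blast
  have "cmod (\<xi> (dagger T \<phi>)) \<le> M * fnorm T \<phi>" if "\<phi> \<in> dual T" for \<phi>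
    using M[OF dagger_in_dual[OF that]] fnorm_dagger[OF that] by simp
  then show ?thesis
    unfolding bstar_def
    by (intro bidualI[where K = M])
      (simp_all add: dagger_add dagger_scaleC bidual_add bidual_scaleC dagger_in_dual assms)
qed

lemma bstar_bstar: "\<xi> \<in> bidual T \<Longrightarrow> bstar T (bstar T \<xi>) = \<xi>"
  by (rule bidual_eqI) (simp_all add: bstar_in_bidual bstar_apply dagger_in_dual dagger_dagger)

lemma bstar_add: "bstar T (\<xi> + \<eta>) = bstar T \<xi> + bstar T \<eta>"
  by (rule ext) (simp add: bstar_def ext0_def)

lemma bstar_scaleC: "bstar T (c *\<^sub>C \<xi>) = cnj c *\<^sub>C bstar T \<xi>"
  by (rule ext) (simp add: bstar_def ext0_def scaleC_fun_def scaleC_complex_def)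

lemma bstar_embed: "t \<in> T \<Longrightarrow> bstar T (embed T t) = embed T (op_adj t)"
  by (rule bidual_eqI)
    (simp_all add: bstar_in_bidual embed_in_bidual T_adj bstar_apply embed_apply dagger_in_dual dagger_apply)

subsection \<open>Vector functionals and the normal extension of the identity representation\<close>

definition vf :: "'h \<Rightarrow> 'h \<Rightarrow> 'h functional" where
  "vf x y = ext0 T (\<lambda>t. cinner (blinfun_apply t x) y)"

lemma scaleC_fun_apply: "(c *\<^sub>C f) x = c * (f x :: complex)"
  by (simp add: scaleC_fun_def scaleC_complex_def)

lemma vf_apply: "t \<in> T \<Longrightarrow> vf x y t = cinner (t x) y"
  by (simp add: vf_def)

lemma vf_bound: "cmod (cinner (blinfun_apply t x) y) \<le> norm x * norm y * norm t"
  using cmod_cinner_le[of "t x" y] mult_right_mono[OF norm_blinfun[of t x] norm_ge_zero[of y]]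
  by (simp add: mult_ac)

lemma vf_in_dual: "vf x y \<in> dual T"
  unfolding vf_def
  by (rule dualI[where K = "norm x * norm y"])
    (simp_all add: blinfun.add_left cinner_add_left cinner_scaleC_left vf_bound)

lemma fnorm_vf_le: "fnorm T (vf x y) \<le> norm x * norm y"
  by (rule fnorm_le) (simp_all add: vf_apply vf_bound)

lemma vf_add_left: "vf (x + y) z = vf x z + vf y z"
  by (rule ext) (simp add: vf_def ext0_def blinfun.add_right cinner_add_left)

lemma vf_add_right: "vf x (y + z) = vf x y + vf x z"
  by (rule ext) (simp add: vf_def ext0_def cinner_add_right)

lemma vf_scaleC_left: "vf (c *\<^sub>C x) z = c *\<^sub>C vf x z"
  by (rule dual_eqI)
    (simp_all add: vf_in_dual dual_closed_scaleC vf_apply bounded_ops_scaleC T_bounded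
      cinner_scaleC_left scaleC_fun_apply)

lemma vf_scaleC_right: "vf x (c *\<^sub>C z) = cnj c *\<^sub>C vf x z"
  by (rule ext) (simp add: vf_def ext0_def cinner_scaleC_right scaleC_fun_def scaleC_complex_def)

lemma dagger_vf: "dagger T (vf x y) = vf y x"
proof (rule dual_eqI)
  fix t assume t: "t \<in> T"
  have "cnj (cinner (op_adj t x) y) = cnj (cinner x (t y))"
    using t by (simp add: cinner_op_adj_left T_bounded)
  also have "\<dots> = cinner (t y) x" by (rule cinner_commute[symmetric])
  finally show "dagger T (vf x y) t = vf y x t"
    using t by (simp add: dagger_apply vf_apply T_adj)
qed (simp_all add: vf_in_dual dagger_in_dual)

text \<open>Kept as a plain function because only its values at single vectors are used.
  \<open>cinner_rep\<close> shows that the vector asked for exists.\<close>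

definition rep :: "'h bifunctional \<Rightarrow> 'h \<Rightarrow> 'h" where
  "rep \<xi> x = (SOME y. \<forall>z. cinner y z = \<xi> (vf x z))"

lemma cinner_rep:
  assumes \<xi>: "\<xi> \<in> bidual T"
  shows "cinner (rep \<xi> x) z = \<xi> (vf x z)"
proof -
  obtain M where M: "0 \<le> M" "\<And>\<phi>. \<phi> \<in> dual T \<Longrightarrow> cmod (\<xi> \<phi>) \<le> M * fnorm T \<phi>"
    using bidual_bound[OF \<xi>] by blast
  \<comment> \<open>The values are conjugate-linear in z, so the Riesz theorem is applied to their
    conjugates.\<close>
  have "\<exists>y. \<forall>z. cnj (\<xi> (vf x z)) = cinner z y"
  proof (rule riesz_representation[where K = "M * norm x"])
    show "cmod (cnj (\<xi> (vf x z))) \<le> M * norm x * norm z" for z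
      using M(2)[OF vf_in_dual[of x z]] mult_left_mono[OF fnorm_vf_le[of x z] M(1)]
      by (simp add: mult_ac)
  qed (simp_all add: vf_add_right vf_scaleC_right bidual_add bidual_scaleC vf_in_dual \<xi>)
  then obtain y where y: "\<And>z. cnj (\<xi> (vf x z)) = cinner z y" by blast
  have "cinner y z = \<xi> (vf x z)" for z
    by (subst cinner_commute) (simp flip: y)
  then have "\<exists>y. \<forall>z. cinner y z = \<xi> (vf x z)" by blast
  from someI_ex[OF this] show ?thesis by (simp add: rep_def)
qed

lemma rep_add: "\<xi> \<in> bidual T \<Longrightarrow> rep \<xi> (x + y) = rep \<xi> x + rep \<xi> y"
  by (rule cinner_ext)
    (simp add: cinner_rep cinner_add_left vf_add_left bidual_add vf_in_dual)

lemma rep_scaleC: "\<xi> \<in> bidual T \<Longrightarrow> rep \<xi> (c *\<^sub>C x) = c *\<^sub>C rep \<xi> x"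
  by (rule cinner_ext)
    (simp add: cinner_rep cinner_scaleC_left vf_scaleC_left bidual_scaleC vf_in_dual)

lemma rep_scaleR: "\<xi> \<in> bidual T \<Longrightarrow> rep \<xi> (r *\<^sub>R x) = r *\<^sub>R rep \<xi> x"
  using rep_scaleC[of \<xi> "of_real r" x] by (simp add: scaleC_of_real)

lemma rep_diff: "\<xi> \<in> bidual T \<Longrightarrow> rep \<xi> (x - y) = rep \<xi> x - rep \<xi> y"
  using rep_add[of \<xi> "x - y" y] by simp

lemma rep_zero_left: "rep 0 x = 0"
  by (rule cinner_ext) (simp add: cinner_rep bidual_closed_zero)

lemma rep_embed: "t \<in> T \<Longrightarrow> rep (embed T t) x = t x"
  by (rule cinner_ext) (simp add: cinner_rep embed_in_bidual embed_apply vf_in_dual vf_apply)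

lemma slice_vf: "a \<in> T \<Longrightarrow> slice (vf x z) a = vf x (op_adj a z)"
  by (rule dual_eqI)
    (simp_all add: slice_in_dual vf_in_dual slice_apply vf_apply T_comp cinner_op_adj_right T_bounded)

text \<open>Only the first vector moves, which makes \<open>rep\<close> multiplicative for the Arens
  product.\<close>

lemma act_vf:
  assumes "\<eta> \<in> bidual T"
  shows "act \<eta> (vf x z) = vf (rep \<eta> x) z"
  by (rule dual_eqI)
    (simp_all add: assms act_in_dual vf_in_dual act_apply slice_vf vf_apply
      cinner_rep[symmetric] cinner_op_adj_right T_bounded)

lemma rep_bmult:
  "\<xi> \<in> bidual T \<Longrightarrow> \<eta> \<in> bidual T \<Longrightarrow> rep (bmult T \<xi> \<eta>) x = rep \<xi> (rep \<eta> x)"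
  by (rule cinner_ext) (simp add: cinner_rep bmult_in_bidual bmult_apply vf_in_dual act_vf)

lemma cinner_rep_bstar:
  assumes "\<xi> \<in> bidual T"
  shows "cinner (rep (bstar T \<xi>) x) z = cinner x (rep \<xi> z)"
proof -
  have "cinner (rep (bstar T \<xi>) x) z = cnj (cinner (rep \<xi> z) x)"
    using assms by (simp add: cinner_rep bstar_in_bidual bstar_apply vf_in_dual dagger_vf)
  then show ?thesis by (simp add: cinner_commute[of x])
qed

text \<open>Contractivity from the single identity w (w* w) = w. With y = \<open>rep w k\<close> and
  u = \<open>rep (bstar T w) y\<close> it gives \<open>rep w u = y\<close>, hence |u| = |y|, while
  |y|^2 = \<langle>u, k\<rangle>.\<close>

lemma rep_partial_isometry_le:
  assumes "partial_isometry T w"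
  shows "norm (rep w k) \<le> norm k"
proof -
  have w: "w \<in> bidual T" and ww: "bmult T w (bmult T (bstar T w) w) = w"
    using assms by (auto simp: partial_isometry_def)
  define y where "y = rep w k"
  define u where "u = rep (bstar T w) y"
  have "rep (bmult T w (bmult T (bstar T w) w)) k = rep w u"
    by (simp add: rep_bmult w bstar_in_bidual bmult_in_bidual u_def y_def)
  then have wu: "rep w u = y" by (simp add: ww y_def)
  have "cinner u k = cinner y y" by (simp add: u_def y_def cinner_rep_bstar w)
  then have "(norm y)\<^sup>2 = cmod (cinner u k)" by (simp add: cinner_self norm_power)
  also have "\<dots> \<le> norm u * norm k" by (rule cmod_cinner_le)
  finally have "(norm y)\<^sup>2 \<le> norm u * norm k" .
  moreover have "cinner u u = cinner y y"
    using cinner_rep_bstar[OF w, of y u] by (simp add: wu flip: u_def)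
  then have "norm u = norm y"
    by (simp add: cinner_self power2_eq_iff_nonneg del: of_real_power)
  ultimately have "norm y * norm y \<le> norm y * norm k" by (simp add: power2_eq_square)
  then show ?thesis
    unfolding y_def[symmetric] by (cases "norm y = 0") (simp_all add: mult_le_cancel_left)
qed

text \<open>By the Riesz theorem u -> \<phi> (\<open>rank_one u y\<close>) is the inner product with
  some w, so the right translate of \<phi> by \<open>rank_one x y\<close> is \<open>vf x w\<close>.
  The product therefore depends on \<xi> only through \<open>rep \<xi> x\<close>. This is what the
  compact operators in T are for.\<close>

lemma bmult_rank_one_eq_0:
  assumes \<xi>: "\<xi> \<in> bidual T" and x: "rep \<xi> x = 0"
  shows "bmult T \<xi> (embed T (rank_one x y)) = 0"
proof (rule bidual_eqI)
  fix \<phi> assume \<phi>: "\<phi> \<in> dual T"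
  have norm_r: "norm (rank_one u y) \<le> norm u * norm y" for u
  proof (rule norm_blinfun_bound)
    show "norm (rank_one u y z) \<le> norm u * norm y * norm z" for z
      using mult_right_mono[OF cmod_cinner_le[of z y] norm_ge_zero[of u]]
      by (simp add: norm_scaleC mult_ac)
  qed simp
  have add: "rank_one (u + u') y = rank_one u y + rank_one u' y" for u u'
    by (rule blinfun_eqI) (simp add: scaleC_add_right blinfun.add_left)
  have sc: "rank_one (c *\<^sub>C u) y = c *\<^sub>C rank_one u y" for c u
    by (rule blinfun_eqI) (simp add: scaleC_scaleC mult.commute)
  have "\<exists>w. \<forall>u. \<phi> (rank_one u y) = cinner u w"
  proof (rule riesz_representation[where K = "fnorm T \<phi> * norm y"])
    show "cmod (\<phi> (rank_one u y)) \<le> fnorm T \<phi> * norm y * norm u" for u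
      using cmod_le_fnorm[OF \<phi> T_rank_one[of u y]] mult_left_mono[OF norm_r[of u] fnorm_nonneg[OF \<phi>]]
      by (simp add: mult_ac)
  qed (simp_all add: add sc dual_add dual_scaleC \<phi> T_rank_one)
  then obtain w where w: "\<And>u. \<phi> (rank_one u y) = cinner u w" by blast
  have "a o\<^sub>L rank_one x y = rank_one (a x) y" if "a \<in> T" for a
    using that by (intro blinfun_eqI) (simp add: bounded_ops_scaleC T_bounded)
  then have "act (embed T (rank_one x y)) \<phi> = vf x w"
    using \<phi> by (simp add: act_embed T_rank_one) (auto simp: vf_def w intro!: ext0_cong)
  then show "bmult T \<xi> (embed T (rank_one x y)) \<phi> = 0 \<phi>"
    using \<phi> \<xi> x by (simp add: bmult_apply cinner_rep[symmetric])
qed (simp_all add: \<xi> bmult_in_bidual embed_in_bidual T_rank_one bidual_closed_zero)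

subsection \<open>Positive functionals of finite rank and their supports\<close>

text \<open>A list rather than a set: vectors may repeat or be dependent, and sums of such
  functionals are concatenations.\<close>

primrec rho :: "'h list \<Rightarrow> 'h functional" where
  "rho [] = 0"
| "rho (k # L) = vf k k + rho L"

lemma rho_in_dual: "rho L \<in> dual T"
  by (induction L) (simp_all only: rho.simps dual_closed_zero dual_closed_add vf_in_dual)

lemma rho_apply: "t \<in> T \<Longrightarrow> rho L t = (\<Sum>k\<leftarrow>L. cinner (t k) k)"
  by (induction L) (simp_all add: vf_apply)

lemma bidual_rho: "\<xi> \<in> bidual T \<Longrightarrow> \<xi> (rho L) = (\<Sum>k\<leftarrow>L. cinner (rep \<xi> k) k)"
proof (induction L)
  case (Cons k L)
  have "\<xi> (rho (k # L)) = \<xi> (vf k k) + \<xi> (rho L)"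
    by (simp only: rho.simps bidual_add vf_in_dual rho_in_dual Cons.prems)
  then show ?case using Cons by (simp add: cinner_rep del: rho.simps)
qed (simp only: rho.simps list.map sum_list.Nil bidual_zero_arg)

lemma bidual_rho_square:
  assumes "\<xi> \<in> bidual T"
  shows "bmult T (bstar T \<xi>) \<xi> (rho L) = of_real (\<Sum>k\<leftarrow>L. (norm (rep \<xi> k))\<^sup>2)"
proof -
  have "bmult T (bstar T \<xi>) \<xi> (rho L) = (\<Sum>k\<leftarrow>L. of_real ((norm (rep \<xi> k))\<^sup>2))"
    by (simp add: assms bidual_rho bmult_in_bidual bstar_in_bidual rep_bmult cinner_rep_bstar cinner_self)
  also have "\<dots> = of_real (\<Sum>k\<leftarrow>L. (norm (rep \<xi> k))\<^sup>2)"
    by (induction L) simp_all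
  finally show ?thesis .
qed

text \<open>Turns null conditions in the bidual into conditions on vectors of the Hilbert
  space.\<close>

lemma rho_square_eq_0_iff:
  assumes "\<xi> \<in> bidual T"
  shows "bmult T (bstar T \<xi>) \<xi> (rho L) = 0 \<longleftrightarrow> (\<forall>k\<in>set L. rep \<xi> k = 0)"
proof -
  have "(\<Sum>k\<leftarrow>L. (norm (rep \<xi> k))\<^sup>2) = 0 \<longleftrightarrow> (\<forall>k\<in>set L. rep \<xi> k = 0)"
  proof (induction L)
    case (Cons k L)
    have "0 \<le> (\<Sum>k\<leftarrow>L. (norm (rep \<xi> k))\<^sup>2)" by (intro sum_list_nonneg) auto
    then show ?case using Cons by (simp add: add_nonneg_eq_0_iff)
  qed simp
  then show ?thesis by (simp only: bidual_rho_square[OF assms] of_real_eq_0_iff)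
qed

lemma positive_ev_rho: "positive_functional T (ev (rho L))"
  unfolding positive_functional_def
  by (auto simp: ev_apply bmult_in_bidual bstar_in_bidual bidual_rho_square complex_nonneg_Reals_iff
      intro!: sum_list_nonneg)

text \<open>P is the support projection of \<open>rho L\<close>. The last clause expresses its
  minimality, and does so in the bidual because the polar decomposition asks for an equality of left
  ideals there.\<close>

definition supports :: "('h \<Rightarrow>\<^sub>L 'h) \<Rightarrow> 'h list \<Rightarrow> bool" where
  "supports P L \<longleftrightarrow> P \<in> T \<and> op_adj P = P \<and> P o\<^sub>L P = P \<and> (\<forall>k\<in>set L. P k = k) \<and>
    (\<forall>\<xi>\<in>bidual T. (\<forall>k\<in>set L. rep \<xi> k = 0) \<longrightarrow> bmult T \<xi> (embed T P) = 0)"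

lemma supports_Nil: "supports 0 []"
proof -
  have "embed T 0 = 0"
    using embed_diff[OF T_zero T_zero] by simp
  moreover have "op_adj (0 :: 'h \<Rightarrow>\<^sub>L 'h) = 0"
    by (rule op_adj_eqI) (simp_all add: T_bounded T_zero)
  moreover have "bmult T \<xi> 0 = 0" if "\<xi> \<in> bidual T" for \<xi>
    using bmult_diff_right[OF that bidual_closed_zero bidual_closed_zero] by simp
  ultimately show ?thesis
    by (simp add: supports_def T_zero blinfun_eqI)
qed

text \<open>One Gram-Schmidt step: e is a unit vector orthogonal to the range of P. The last
  hypothesis stands in for e lying in the span of k and L.\<close>

lemma supports_Cons:
  assumes P: "supports P L" and e: "norm e = 1" "P e = 0" and k: "(P + rank_one e e) k = k"
    and rep: "\<And>\<xi>. \<xi> \<in> bidual T \<Longrightarrow> \<forall>l\<in>set (k # L). rep \<xi> l = 0 \<Longrightarrow> rep \<xi> e = 0"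
  shows "supports (P + rank_one e e) (k # L)"
proof -
  have PT: "P \<in> T" and Pa: "op_adj P = P" and PP: "P o\<^sub>L P = P" and PL: "\<And>l. l \<in> set L \<Longrightarrow> P l = l"
    and P0: "\<And>\<xi>. \<xi> \<in> bidual T \<Longrightarrow> \<forall>k\<in>set L. rep \<xi> k = 0 \<Longrightarrow> bmult T \<xi> (embed T P) = 0"
    using P by (auto simp: supports_def)
  have ee: "cinner e e = 1" using e by (simp add: cinner_self)
  have Pe: "cinner (P x) e = 0" for x
    using cinner_op_adj_left[OF T_bounded[OF PT], of x e] Pa e by simp
  have Ple: "cinner l e = 0" if "l \<in> set L" for l
    using Pe[of l] PL[OF that] by simp
  have PPx: "P (P x) = P x" for x
    using PP by (metis blinfun_apply_blinfun_compose)
  have "op_adj (P + rank_one e e) = P + rank_one e e"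
    by (simp add: op_adj_add T_bounded PT T_rank_one T_add Pa op_adj_rank_one)
  moreover have "(P + rank_one e e) o\<^sub>L (P + rank_one e e) = P + rank_one e e"
    by (rule blinfun_eqI) (simp add: blinfun.add_left blinfun.add_right PPx Pe
        bounded_ops_scaleC T_bounded PT e cinner_add_left cinner_scaleC_left ee)
  moreover have "\<forall>l\<in>set (k # L). (P + rank_one e e) l = l"
    using k PL Ple by (auto simp: blinfun.add_left)
  moreover have "bmult T \<xi> (embed T (P + rank_one e e)) = 0"
    if "\<xi> \<in> bidual T" "\<forall>l\<in>set (k # L). rep \<xi> l = 0" for \<xi>
    using that P0[of \<xi>] rep[of \<xi>]
    by (simp add: embed_add PT T_rank_one bmult_add_right embed_in_bidual bmult_rank_one_eq_0)
  ultimately show ?thesis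
    by (simp add: supports_def PT T_add T_rank_one)
qed

lemma supports_same:
  assumes "supports P L" "P k = k"
  shows "supports P (k # L)"
  using assms by (simp add: supports_def)

lemma supports_exists: "\<exists>P. supports P L"
proof (induction L)
  case Nil
  then show ?case using supports_Nil by blast
next
  case (Cons k L)
  then obtain P where P: "supports P L" by blast
  then have PT: "P \<in> T" and Pa: "op_adj P = P" and PP: "P o\<^sub>L P = P"
    and P0: "\<And>\<xi>. \<xi> \<in> bidual T \<Longrightarrow> \<forall>k\<in>set L. rep \<xi> k = 0 \<Longrightarrow> bmult T \<xi> (embed T P) = 0"
    by (auto simp: supports_def)
  have PPx: "P (P x) = P x" for x
    using PP by (metis blinfun_apply_blinfun_compose)
  show ?case
  proof (cases "P k = k")
    case True
    then show ?thesis using supports_same[OF P] by blast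
  next
    case False
    \<comment> \<open>The part of k orthogonal to the range of P; normalized, it is the new basis
      vector.\<close>
    define u where "u = k - P k"
    have u: "norm u \<noteq> 0" using False by (simp add: u_def)
    define e where "e = inverse (norm u) *\<^sub>R u"
    have e: "norm e = 1" using u by (simp add: e_def)
    have Pu: "P u = 0" by (simp add: u_def blinfun.diff_right PPx)
    have Pe: "P e = 0" by (simp add: e_def blinfun.scaleR_right Pu)
    have "cinner (P k) u = 0"
      using cinner_op_adj_left[OF T_bounded[OF PT], of k u] Pa Pu by simp
    then have "cinner k u = cinner u u" by (simp add: u_def cinner_diff_left)
    then have "cinner k e = of_real (inverse (norm u) * (norm u)\<^sup>2)"
      by (simp only: e_def cinner_scaleR_right cinner_self of_real_mult)
    also have "inverse (norm u) * (norm u)\<^sup>2 = norm u"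
      using u by (simp add: power2_eq_square)
    finally have "cinner k e *\<^sub>C e = u"
      using u by (simp add: scaleC_of_real e_def)
    then have k: "(P + rank_one e e) k = k"
      by (simp add: blinfun.add_left u_def)
    have "rep \<xi> e = 0" if \<xi>: "\<xi> \<in> bidual T" and 0: "\<forall>l\<in>set (k # L). rep \<xi> l = 0" for \<xi>
    proof -
      \<comment> \<open>By induction \<xi> P = 0 in the bidual, so the operator of \<xi> vanishes at
        P k and then also at u = k - P k.\<close>
      have "rep \<xi> (P k) = rep (bmult T \<xi> (embed T P)) k"
        using \<xi> PT by (simp add: rep_bmult embed_in_bidual rep_embed)
      then have "rep \<xi> (P k) = 0" using P0[OF \<xi>] 0 by (simp add: rep_zero_left)
      then show ?thesis using \<xi> 0 by (simp add: e_def u_def rep_scaleR rep_diff)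
    qed
    then have "supports (P + rank_one e e) (k # L)"
      using supports_Cons[OF P e Pe k] by blast
    then show ?thesis by blast
  qed
qed

text \<open>The scalar c is carried along because normalizing functionals puts factors such as 1 /
  sqrt 2 on the vectors while the projection stays the same.\<close>

lemma supports_single:
  assumes "norm e = 1" "c \<noteq> 0"
  shows "supports (rank_one e e) [c *\<^sub>R e]"
proof -
  have "cinner e e = 1" using assms by (simp add: cinner_self)
  then have "supports (0 + rank_one e e) [c *\<^sub>R e]"
    using assms by (intro supports_Cons supports_Nil)
      (simp_all add: rep_scaleR cinner_scaleR_left scaleC_of_real)
  then show ?thesis by simp
qed

lemma supports_pair:
  assumes "norm e = 1" "norm f = 1" "cinner e f = 0" "c \<noteq> 0"
  shows "supports (rank_one f f + rank_one e e) [c *\<^sub>R e, c *\<^sub>R f]"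
proof -
  have "cinner e e = 1" using assms by (simp add: cinner_self)
  then show ?thesis
    using assms by (intro supports_Cons supports_single)
      (simp_all add: rep_scaleR cinner_scaleR_left scaleC_of_real blinfun.add_left)
qed

subsection \<open>Positive functionals on the bidual\<close>

context
  fixes \<Psi> :: "'h bifunctional \<Rightarrow> complex"
  assumes lin: "linear_functional (bidual T) \<Psi>" and pos: "positive_functional T \<Psi>"
begin

lemma functional_add: "\<xi> \<in> bidual T \<Longrightarrow> \<eta> \<in> bidual T \<Longrightarrow> \<Psi> (\<xi> + \<eta>) = \<Psi> \<xi> + \<Psi> \<eta>"
  and functional_scaleC: "\<xi> \<in> bidual T \<Longrightarrow> \<Psi> (c *\<^sub>C \<xi>) = c * \<Psi> \<xi>"
  using lin by (simp_all add: linear_functional_def)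

lemma functional_diff: "\<xi> \<in> bidual T \<Longrightarrow> \<eta> \<in> bidual T \<Longrightarrow> \<Psi> (\<xi> - \<eta>) = \<Psi> \<xi> - \<Psi> \<eta>"
  by (simp only: fun_diff_scaleC functional_add functional_scaleC bidual_closed_scaleC) simp

lemma positive_expand:
  assumes x: "x \<in> bidual T" and y: "y \<in> bidual T"
  shows "\<Psi> (bmult T (bstar T (x + c *\<^sub>C y)) (x + c *\<^sub>C y)) =
    \<Psi> (bmult T (bstar T x) x) + c * \<Psi> (bmult T (bstar T x) y) + cnj c * \<Psi> (bmult T (bstar T y) x)
      + cnj c * c * \<Psi> (bmult T (bstar T y) y)"
proof -
  note mem = x y bstar_in_bidual bidual_closed_add bidual_closed_scaleC bmult_in_bidual
  have "bmult T (bstar T (x + c *\<^sub>C y)) (x + c *\<^sub>C y) =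
      (bmult T (bstar T x) x + c *\<^sub>C bmult T (bstar T x) y) +
      (cnj c *\<^sub>C bmult T (bstar T y) x + cnj c *\<^sub>C c *\<^sub>C bmult T (bstar T y) y)"
    by (simp only: bstar_add bstar_scaleC bmult_add_left bmult_scaleC_left bmult_add_right
        bmult_scaleC_right mem)
      (simp add: fun_eq_iff scaleC_fun_apply algebra_simps)
  then show ?thesis
    by (simp only: functional_add functional_scaleC mem) (simp add: algebra_simps)
qed

lemma positive_Re: "x \<in> bidual T \<Longrightarrow> 0 \<le> Re (\<Psi> (bmult T (bstar T x) x))"
  and positive_Im: "x \<in> bidual T \<Longrightarrow> Im (\<Psi> (bmult T (bstar T x) x)) = 0"
  using pos by (auto simp: positive_functional_def complex_nonneg_Reals_iff)

text \<open>Values at squares are real. For x + y and x + i y this compares the imaginary and the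
  real parts of the two mixed terms.\<close>

lemma positive_hermitian:
  assumes x: "x \<in> bidual T" and y: "y \<in> bidual T"
  shows "\<Psi> (bmult T (bstar T y) x) = cnj (\<Psi> (bmult T (bstar T x) y))"
proof -
  have "Im (\<Psi> (bmult T (bstar T (x + c *\<^sub>C y)) (x + c *\<^sub>C y))) = 0" for c
    using x y by (intro positive_Im bidual_closed_add bidual_closed_scaleC)
  from this[of 1] this[of \<i>] show ?thesis
    by (simp add: positive_expand x y positive_Im complex_eq_iff)
qed

text \<open>The degenerate Cauchy-Schwarz inequality. With y the adjoint of w, adding a suitable
  multiple of x to w would give a square with negative value, unless \<Psi> is 0 at the product of y
  and x.\<close>

lemma positive_null:
  assumes x: "x \<in> bidual T" and null: "\<Psi> (bmult T (bstar T x) x) = 0" and y: "y \<in> bidual T"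
  shows "\<Psi> (bmult T y x) = 0"
proof (rule ccontr)
  define z where "z = \<Psi> (bmult T y x)"
  define w where "w = bstar T y"
  define A where "A = Re (\<Psi> (bmult T (bstar T w) w))"
  have w: "w \<in> bidual T" and wy: "bstar T w = y"
    using y by (simp_all add: w_def bstar_in_bidual bstar_bstar)
  assume "\<Psi> (bmult T y x) \<noteq> 0"
  then have z: "(cmod z)\<^sup>2 > 0" by (simp add: z_def)
  \<comment> \<open>Solves A - 2 s |z|^2 = -1.\<close>
  define s where "s = (A + 1) / (2 * (cmod z)\<^sup>2)"
  define c where "c = - of_real s * cnj z"
  have cz: "c * z = of_real (- s * (cmod z)\<^sup>2)"
    using complex_norm_square[of z] by (simp add: c_def mult_ac)
  have cz': "cnj c * cnj z = of_real (- s * (cmod z)\<^sup>2)"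
    using arg_cong[OF cz, of cnj] by simp
  have "0 \<le> Re (\<Psi> (bmult T (bstar T (w + c *\<^sub>C x)) (w + c *\<^sub>C x)))"
    using x w by (intro positive_Re bidual_closed_add bidual_closed_scaleC)
  also have "\<dots> = A + Re (c * z) + Re (cnj c * cnj z)"
    using positive_hermitian[OF w x]
    by (simp only: positive_expand[OF w x] null A_def wy z_def[symmetric]) simp
  also have "\<dots> = A - 2 * s * (cmod z)\<^sup>2"
    by (simp only: cz cz' Re_complex_of_real)
  also have "\<dots> = - 1"
    using z by (simp add: s_def field_simps)
  finally show False by simp
qed

lemma positive_diff_Re:
  assumes x: "x \<in> bidual T" and y: "y \<in> bidual T"
  shows "Re (\<Psi> (bmult T (bstar T (x - y)) (x - y))) =
    Re (\<Psi> (bmult T (bstar T x) x)) - 2 * Re (\<Psi> (bmult T (bstar T y) x)) + Re (\<Psi> (bmult T (bstar T y) y))"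
  unfolding fun_diff_scaleC[of x] positive_expand[OF x y]
  by (simp add: positive_hermitian[OF y x])

end

subsection \<open>The polar decomposition of a functional of finite rank\<close>

context
  fixes P v :: "'h \<Rightarrow>\<^sub>L 'h" and L :: "'h list" and \<phi> :: "'h functional"
  assumes supp: "supports P L" and v: "v \<in> T" and vv: "op_adj v o\<^sub>L v = P" and vP: "v o\<^sub>L P = v"
    and \<phi>: "\<phi> \<in> dual T" and \<phi>_eq: "\<And>t. t \<in> T \<Longrightarrow> \<phi> t = rho L (t o\<^sub>L v)"
begin

lemma P_in: "P \<in> T"
    and P_adj: "op_adj P = P" and P_idem: "P o\<^sub>L P = P"
    and P_fix: "\<And>k. k \<in> set L \<Longrightarrow> P k = k"
    and P_kill: "\<And>\<xi>. \<xi> \<in> bidual T \<Longrightarrow> \<forall>k\<in>set L. rep \<xi> k = 0 \<Longrightarrow> bmult T \<xi> (embed T P) = 0"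
  using supp by (auto simp: supports_def)

lemma P_P: "P (P x) = P x"
  using P_idem by (metis blinfun_apply_blinfun_compose)

lemma cinner_v: "cinner (v x) (v y) = cinner (P x) y"
proof -
  have "cinner (P x) y = cinner (op_adj v (v x)) y" by (simp flip: vv)
  then show ?thesis by (simp add: cinner_op_adj_left T_bounded v)
qed

lemma bidual_\<phi>: "\<xi> \<in> bidual T \<Longrightarrow> \<xi> \<phi> = bmult T \<xi> (embed T v) (rho L)"
proof -
  assume \<xi>: "\<xi> \<in> bidual T"
  have "act (embed T v) (rho L) = \<phi>"
    unfolding act_embed[OF rho_in_dual v] using dual_outside[OF \<phi>]
    by (auto simp: ext0_def \<phi>_eq)
  then show ?thesis by (simp add: bmult_apply rho_in_dual)
qed

lemma rho_P: "\<xi> \<in> bidual T \<Longrightarrow> bmult T \<xi> (embed T P) (rho L) = \<xi> (rho L)"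
proof -
  assume \<xi>: "\<xi> \<in> bidual T"
  have "rho L (a o\<^sub>L P) = rho L a" if "a \<in> T" for a
    using that by (auto simp: rho_apply T_comp P_in P_fix intro!: arg_cong[of _ _ sum_list])
  then have "act (embed T P) (rho L) = rho L"
    unfolding act_embed[OF rho_in_dual P_in] using dual_outside[OF rho_in_dual[of L]]
    by (auto simp: ext0_def)
  then show ?thesis by (simp add: bmult_apply rho_in_dual)
qed

lemma embed_v_star_v: "bmult T (bstar T (embed T v)) (embed T v) = embed T P"
  by (simp add: bstar_embed v bmult_embed T_adj vv)

lemma bone_minus_P_square:
  "bmult T (bstar T (bone T - embed T P)) (bone T - embed T P) = bone T - embed T P"
proof -
  have "bone T - embed T P = embed T (id_blinfun - P)"
    by (simp add: bone_def embed_diff T_id P_in)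
  moreover have "op_adj (id_blinfun - P) = id_blinfun - P"
    by (rule op_adj_eqI) (simp_all add: T_bounded T_diff T_id P_in blinfun.diff_left cinner_diff_left
      cinner_diff_right cinner_op_adj_left[of P, unfolded P_adj])
  moreover have "(id_blinfun - P) o\<^sub>L (id_blinfun - P) = id_blinfun - P"
    by (rule blinfun_eqI) (simp add: blinfun.diff_left blinfun.diff_right P_P)
  ultimately show ?thesis
    by (simp add: bstar_embed bmult_embed T_diff T_id P_in)
qed

text \<open>The identities v* v = P and v P = v hold in T and pass to the bidual by
  \<open>embed\<close>. For the left ideals, \<open>supports\<close> gives \<xi> P = 0 for null
  \<xi>, that is \<xi> = \<xi> (1 - P).\<close>

lemma polar_decomposition_rho: "polar_decomposition T \<phi> (embed T v) (ev (rho L))"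
  unfolding polar_decomposition_def
proof (intro conjI ballI)
  show "partial_isometry T (embed T v)"
    unfolding partial_isometry_def embed_v_star_v by (simp add: bmult_embed v P_in vP embed_in_bidual)
  show "weak_star_functional T (ev (rho L))" by (rule weak_star_functional_ev[OF rho_in_dual])
  show "positive_functional T (ev (rho L))" by (rule positive_ev_rho)
  show "hat T \<phi> \<xi> = ev (rho L) (bmult T \<xi> (embed T v))" if "\<xi> \<in> bidual T" for \<xi>
    using that by (simp add: hat_eq[OF \<phi>] ev_apply bmult_in_bidual embed_in_bidual v bidual_\<phi>)
  show "{bmult T \<xi> (bone T - bmult T (bstar T (embed T v)) (embed T v)) |\<xi>. \<xi> \<in> bidual T} =
      {\<xi> \<in> bidual T. ev (rho L) (bmult T (bstar T \<xi>) \<xi>) = 0}" (is "?A = ?B")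
    unfolding embed_v_star_v
  proof (intro equalityI subsetI)
    fix \<eta> assume "\<eta> \<in> {bmult T \<xi> (bone T - embed T P) |\<xi>. \<xi> \<in> bidual T}"
    then obtain \<xi> where \<xi>: "\<xi> \<in> bidual T" and \<eta>: "\<eta> = bmult T \<xi> (bone T - embed T P)" by blast
    have Q: "bone T - embed T P \<in> bidual T"
      by (intro bidual_closed_diff bone_in_bidual embed_in_bidual P_in)
    have 1: "\<eta> \<in> bidual T" unfolding \<eta> by (rule bmult_in_bidual[OF \<xi> Q])
    have "bone T - embed T P = embed T (id_blinfun - P)"
      by (simp add: bone_def embed_diff T_id P_in)
    then have "rep \<eta> k = 0" if "k \<in> set L" for k
      using that rep_scaleC[OF \<xi>, of 0 0] unfolding \<eta>
      by (simp add: rep_bmult \<xi> embed_in_bidual T_diff T_id P_in rep_embed blinfun.diff_left P_fix)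
    then show "\<eta> \<in> ?B"
      using 1 by (simp add: ev_apply bmult_in_bidual bstar_in_bidual rho_square_eq_0_iff)
  next
    fix \<xi> assume "\<xi> \<in> ?B"
    then have \<xi>: "\<xi> \<in> bidual T" and "\<forall>k\<in>set L. rep \<xi> k = 0"
      by (auto simp: ev_apply bmult_in_bidual bstar_in_bidual rho_square_eq_0_iff)
    then have "bmult T \<xi> (embed T P) = 0" by (rule P_kill)
    then have "\<xi> = bmult T \<xi> (bone T - embed T P)"
      by (simp add: bmult_diff_right \<xi> bone_in_bidual embed_in_bidual P_in bmult_bone_right)
    then show "\<xi> \<in> {bmult T \<xi> (bone T - embed T P) |\<xi>. \<xi> \<in> bidual T}" using \<xi> by blast
  qed
qed

text \<open>The two partial isometries are compared in the seminorms of both functionals. Put V =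
  \<open>embed T v\<close>, E = w* w and R = V* V. Passing through \<phi> gives \<Psi> (V* w) =
  \<Phi> 1 and \<Phi> (w* V) = \<Psi> 1. So, in real parts, the squared distance of w and V is
  \<Psi> 1 - 2 \<Phi> 1 + \<Psi> R with respect to \<Psi> and \<Phi> 1 - 2 \<Psi> 1 + \<Phi> E with
  respect to \<Phi>. As \<Psi> R is at most \<Psi> 1 and \<Phi> E at most \<Phi> 1, these two
  nonnegative numbers have a sum of at most 0.\<close>

lemma polar_decomposition_unique:
  assumes pd: "polar_decomposition T \<phi> w \<Psi>"
  shows "\<Psi> = ev (rho L)"
proof -
  define \<Phi> where "\<Phi> = ev (rho L)"
  define V where "V = embed T v"
  define R where "R = embed T P"
  define E where "E = bmult T (bstar T w) w"
  have w: "w \<in> bidual T" and pw: "partial_isometry T w"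
    and lin: "linear_functional (bidual T) \<Psi>" and pos: "positive_functional T \<Psi>"
    using pd by (auto simp: polar_decomposition_def partial_isometry_def weak_star_functional_def)
  have lin': "linear_functional (bidual T) \<Phi>" and pos': "positive_functional T \<Phi>"
    unfolding \<Phi>_def by (rule linear_functional_ev) (rule positive_ev_rho)
  have \<phi>w: "\<xi> \<phi> = \<Psi> (bmult T \<xi> w)" if "\<xi> \<in> bidual T" for \<xi>
    using pd that by (simp add: polar_decomposition_def hat_eq[OF \<phi>] ev_apply)
  have V: "V \<in> bidual T" and R: "R \<in> bidual T" and E: "E \<in> bidual T"
    by (simp_all add: V_def R_def E_def embed_in_bidual v P_in bmult_in_bidual bstar_in_bidual w)
  note mem = w V R E bone_in_bidual bstar_in_bidual bmult_in_bidual bidual_closed_diff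
  have \<Phi>: "\<Phi> \<xi> = \<xi> (rho L)" if "\<xi> \<in> bidual T" for \<xi>
    using that by (simp add: \<Phi>_def ev_apply)
  have \<phi>V: "\<xi> \<phi> = \<Phi> (bmult T \<xi> V)" if "\<xi> \<in> bidual T" for \<xi>
    using that by (simp add: \<Phi> mem bidual_\<phi> V_def[symmetric])
  have VV: "bmult T (bstar T V) V = R"
    unfolding V_def R_def by (rule embed_v_star_v)
  have QQ: "bmult T (bstar T (bone T - R)) (bone T - R) = bone T - R"
    unfolding R_def by (rule bone_minus_P_square)
  \<comment> \<open>1 - E generates the left ideal of the given decomposition, so it is null for
    \<Psi>.\<close>
  have one_E: "\<Psi> (bmult T (bstar T (bone T - E)) (bone T - E)) = 0"
  proof -
    have "bone T - E = bmult T (bone T) (bone T - E)"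
      by (simp add: bmult_bone_left mem)
    then have "bone T - E \<in> {bmult T \<xi> (bone T - bmult T (bstar T w) w) |\<xi>. \<xi> \<in> bidual T}"
      using bone_in_bidual unfolding E_def by blast
    then show ?thesis
      using pd unfolding polar_decomposition_def by blast
  qed
  have \<Psi>E: "\<Psi> (bmult T \<xi> E) = \<Psi> \<xi>" if \<xi>: "\<xi> \<in> bidual T" for \<xi>
  proof -
    have "\<Psi> (bmult T \<xi> (bone T - E)) = 0"
      by (rule positive_null[OF lin pos _ one_E \<xi>]) (intro mem)
    then show ?thesis
      by (simp add: bmult_diff_right bmult_bone_right functional_diff[OF lin pos] mem \<xi>)
  qed
  have \<Psi>\<Phi>: "\<Psi> \<xi> = \<Phi> (bmult T (bmult T \<xi> (bstar T w)) V)" if \<xi>: "\<xi> \<in> bidual T" for \<xi>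
  proof -
    have "\<Psi> \<xi> = \<Psi> (bmult T (bmult T \<xi> (bstar T w)) w)"
      using \<Psi>E[OF \<xi>] by (simp add: E_def bmult_assoc mem \<xi>)
    then show ?thesis using \<phi>w \<phi>V \<xi> by (metis mem(6,7) w)
  qed
  have \<Phi>R: "\<Phi> (bmult T \<xi> R) = \<Phi> \<xi>" if \<xi>: "\<xi> \<in> bidual T" for \<xi>
    using \<xi> by (simp add: \<Phi> mem) (simp add: R_def rho_P)
  have \<Phi>\<Psi>: "\<Phi> \<xi> = \<Psi> (bmult T (bmult T \<xi> (bstar T V)) w)" if \<xi>: "\<xi> \<in> bidual T" for \<xi>
  proof -
    have "\<Phi> \<xi> = \<Phi> (bmult T (bmult T \<xi> (bstar T V)) V)"
      using \<Phi>R[OF \<xi>] by (simp add: VV[symmetric] bmult_assoc mem \<xi>)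
    then show ?thesis using \<phi>w \<phi>V \<xi> by (metis mem(6,7) V)
  qed
  have \<Psi>1: "\<Psi> (bone T) = \<Phi> (bmult T (bstar T w) V)"
    using \<Psi>\<Phi>[OF bone_in_bidual] by (simp add: bmult_bone_left mem)
  have \<Phi>1: "\<Phi> (bone T) = \<Psi> (bmult T (bstar T V) w)"
    using \<Phi>\<Psi>[OF bone_in_bidual] by (simp add: bmult_bone_left mem)
  have \<Psi>E1: "\<Psi> E = \<Psi> (bone T)" and \<Phi>R1: "\<Phi> R = \<Phi> (bone T)"
    using \<Psi>E[OF bone_in_bidual] \<Phi>R[OF bone_in_bidual] by (simp_all add: bmult_bone_left mem)
  \<comment> \<open>R is embedded from a projection in T, so 1 - R is a square.\<close>
  have \<Psi>R: "Re (\<Psi> R) \<le> Re (\<Psi> (bone T))"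
    using positive_Re[OF lin pos, of "bone T - R"] by (simp add: mem QQ functional_diff[OF lin pos])
  \<comment> \<open>To write 1 - E as a square one would take the adjoint of the product w* w. Since
    \<Phi> has finite rank, contractivity of \<open>rep w\<close> does instead.\<close>
  have \<Phi>E: "Re (\<Phi> E) \<le> Re (\<Phi> (bone T))"
  proof -
    have "(\<Sum>k\<leftarrow>L. (norm (rep w k))\<^sup>2) \<le> (\<Sum>k\<leftarrow>L. (norm k)\<^sup>2)"
      by (intro sum_list_mono power_mono rep_partial_isometry_le[OF pw]) auto
    moreover have "Re (\<Phi> E) = (\<Sum>k\<leftarrow>L. (norm (rep w k))\<^sup>2)"
      by (simp add: \<Phi> mem E_def bidual_rho_square)
    moreover have "Re (\<Phi> (bone T)) = (\<Sum>k\<leftarrow>L. (norm k)\<^sup>2)"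
    proof -
      have "\<Phi> (bone T) = (\<Sum>k\<leftarrow>L. of_real ((norm k)\<^sup>2))"
        unfolding \<Phi>[OF bone_in_bidual] bidual_rho[OF bone_in_bidual]
        by (simp add: bone_def rep_embed T_id cinner_self)
      also have "\<dots> = of_real (\<Sum>k\<leftarrow>L. (norm k)\<^sup>2)" by (induction L) simp_all
      finally show ?thesis by simp
    qed
    ultimately show ?thesis by simp
  qed
  have \<Psi>D: "Re (\<Psi> (bmult T (bstar T (w - V)) (w - V))) =
      Re (\<Psi> (bone T)) - 2 * Re (\<Phi> (bone T)) + Re (\<Psi> R)"
    by (simp add: positive_diff_Re[OF lin pos] mem E_def[symmetric] VV \<Phi>1 \<Psi>E1)
  have \<Phi>D: "Re (\<Phi> (bmult T (bstar T (V - w)) (V - w))) =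
      Re (\<Phi> (bone T)) - 2 * Re (\<Psi> (bone T)) + Re (\<Phi> E)"
    by (simp add: positive_diff_Re[OF lin' pos'] mem E_def[symmetric] VV \<Psi>1 \<Phi>R1)
  have "0 \<le> Re (\<Psi> (bmult T (bstar T (w - V)) (w - V)))"
    by (intro positive_Re[OF lin pos] mem)
  moreover have "0 \<le> Re (\<Phi> (bmult T (bstar T (V - w)) (V - w)))"
    by (intro positive_Re[OF lin' pos'] mem)
  \<comment> \<open>Both squared distances are nonnegative and add up to at most 0, so all the
    estimates are equalities.\<close>
  ultimately have D0: "Re (\<Psi> (bmult T (bstar T (w - V)) (w - V))) = 0"
    and R0: "Re (\<Psi> R) = Re (\<Psi> (bone T))"
    using \<Psi>D \<Phi>D \<Psi>R \<Phi>E by linarith+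
  have wV: "\<Psi> (bmult T \<xi> w) = \<Psi> (bmult T \<xi> V)" if \<xi>: "\<xi> \<in> bidual T" for \<xi>
  proof -
    have "\<Psi> (bmult T (bstar T (w - V)) (w - V)) = 0"
      using D0 positive_Im[OF lin pos, of "w - V"] by (simp add: mem complex_eq_iff)
    then have "\<Psi> (bmult T \<xi> (w - V)) = 0"
      by (intro positive_null[OF lin pos _ _ \<xi>] mem)
    then show ?thesis
      by (simp add: bmult_diff_right functional_diff[OF lin pos] mem \<xi>)
  qed
  have \<Psi>R': "\<Psi> (bmult T \<xi> R) = \<Psi> \<xi>" if \<xi>: "\<xi> \<in> bidual T" for \<xi>
  proof -
    have "\<Psi> (bmult T (bstar T (bone T - R)) (bone T - R)) = 0"
      using R0 positive_Im[OF lin pos, of "bone T - R"]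
      by (simp add: mem complex_eq_iff QQ functional_diff[OF lin pos])
    then have "\<Psi> (bmult T \<xi> (bone T - R)) = 0"
      by (intro positive_null[OF lin pos _ _ \<xi>] mem)
    then show ?thesis
      by (simp add: bmult_diff_right bmult_bone_right functional_diff[OF lin pos] mem \<xi>)
  qed
  have "\<Psi> \<xi> = \<Phi> \<xi>" for \<xi>
  proof (cases "\<xi> \<in> bidual T")
    case True
    \<comment> \<open>The last V may be exchanged for w with respect to \<Psi>; this leads to \<phi>
      and from there to \<Phi>.\<close>
    have "\<Psi> \<xi> = \<Psi> (bmult T (bmult T \<xi> (bstar T V)) V)"
      using \<Psi>R'[OF True] by (simp add: VV[symmetric] bmult_assoc mem True)
    also have "\<dots> = \<Psi> (bmult T (bmult T \<xi> (bstar T V)) w)"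
      by (rule wV[symmetric]) (simp add: mem True)
    also have "\<dots> = \<Phi> \<xi>" by (rule \<Phi>\<Psi>[OF True, symmetric])
    finally show ?thesis .
  next
    case False
    then show ?thesis using lin lin' by (simp add: linear_functional_def)
  qed
  then show ?thesis unfolding \<Phi>_def by (rule ext)
qed

lemma modulus_eq: "modulus T \<phi> = ev (rho L)"
  unfolding modulus_def
  by (rule the_equality) (use polar_decomposition_rho polar_decomposition_unique in blast)+

lemma modulus_restr_eq: "modulus_restr T \<phi> = rho L"
  unfolding modulus_restr_def modulus_eq using dual_outside[OF rho_in_dual[of L]]
  by (auto simp: ext0_def ev_apply embed_in_bidual embed_apply rho_in_dual)

text \<open>The norm is attained at the adjoint of v, a contraction at which \<phi> takes the value
  \<open>rho L P\<close>.\<close>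

lemma fnorm_eq: "fnorm T \<phi> = (\<Sum>k\<leftarrow>L. (norm k)\<^sup>2)"
proof (rule antisym)
  have sum_nonneg: "0 \<le> (\<Sum>k\<leftarrow>L. (norm k)\<^sup>2)" by (intro sum_list_nonneg) auto
  have norm_v: "norm (v k) = norm k" if "k \<in> set L" for k
    using cinner_v[of k k] P_fix[OF that]
    by (simp add: cinner_self power2_eq_iff_nonneg del: of_real_power)
  show "fnorm T \<phi> \<le> (\<Sum>k\<leftarrow>L. (norm k)\<^sup>2)"
  proof (rule fnorm_le[OF _ sum_nonneg])
    fix t assume t: "t \<in> T"
    \<comment> \<open>That v preserves norms is only known on the entries of L, so the induction
      runs over lists with entries in L.\<close>
    have "cmod (\<Sum>k\<leftarrow>M. cinner (t (v k)) k) \<le> (\<Sum>k\<leftarrow>M. (norm k)\<^sup>2) * norm t" if "set M \<subseteq> set L" for M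
      using that
    proof (induction M)
      case (Cons k M)
      have "cmod (cinner (t (v k)) k) \<le> norm (v k) * norm k * norm t" by (rule vf_bound)
      also have "\<dots> = (norm k)\<^sup>2 * norm t" using Cons.prems by (simp add: norm_v power2_eq_square)
      finally have "cmod (cinner (t (v k)) k + (\<Sum>k\<leftarrow>M. cinner (t (v k)) k)) \<le>
          (norm k)\<^sup>2 * norm t + (\<Sum>k\<leftarrow>M. (norm k)\<^sup>2) * norm t"
        using Cons by (intro norm_triangle_mono) auto
      then show ?case by (simp add: algebra_simps)
    qed simp
    then show "cmod (\<phi> t) \<le> (\<Sum>k\<leftarrow>L. (norm k)\<^sup>2) * norm t"
      using t v by (simp add: \<phi>_eq rho_apply T_comp)
  qed
  have "norm v \<le> 1"
  proof (rule norm_blinfun_bound)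
    fix x
    have "cinner (P x) (P x) = cinner (P x) x"
      using cinner_op_adj_left[OF T_bounded[OF P_in], of "P x" x] by (simp add: P_adj P_P)
    then have "(norm (P x))\<^sup>2 = cmod (cinner (P x) x)"
      by (metis cinner_self norm_of_real abs_power2)
    also have "\<dots> \<le> norm (P x) * norm x" by (rule cmod_cinner_le)
    finally have Px: "norm (P x) \<le> norm x"
      by (cases "norm (P x) = 0") (simp_all add: power2_eq_square mult_le_cancel_left)
    have "cmod (cinner (v x) (v x)) = cmod (cinner (P x) x)"
      by (simp only: cinner_v)
    then have "(norm (v x))\<^sup>2 = cmod (cinner (P x) x)"
      by (simp only: cinner_self norm_of_real abs_power2)
    also have "\<dots> \<le> norm (P x) * norm x" by (rule cmod_cinner_le)
    also have "\<dots> \<le> norm x * norm x" using Px by (intro mult_right_mono) auto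
    finally show "norm (v x) \<le> 1 * norm x"
      by (simp add: power2_eq_square[symmetric] power2_le_iff_abs_le)
  qed simp
  then have "norm (op_adj v) \<le> 1"
    using norm_op_adj_le[OF T_bounded[OF v]] by simp
  then have "cmod (\<phi> (op_adj v)) \<le> fnorm T \<phi>"
    using \<phi> v by (intro cmod_le_fnorm_unit_ball T_adj)
  moreover have "\<phi> (op_adj v) = of_real (\<Sum>k\<leftarrow>L. (norm k)\<^sup>2)"
  proof -
    have "\<phi> (op_adj v) = (\<Sum>k\<leftarrow>L. cinner (P k) k)"
      using v by (simp add: \<phi>_eq T_adj vv rho_apply P_in)
    also have "\<dots> = (\<Sum>k\<leftarrow>L. of_real ((norm k)\<^sup>2))"
      by (auto simp: P_fix cinner_self intro!: arg_cong[of _ _ sum_list])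
    also have "\<dots> = of_real (\<Sum>k\<leftarrow>L. (norm k)\<^sup>2)" by (induction L) simp_all
    finally show ?thesis .
  qed
  ultimately show "(\<Sum>k\<leftarrow>L. (norm k)\<^sup>2) \<le> fnorm T \<phi>"
    using sum_nonneg by (simp only: norm_of_real abs_of_nonneg)
qed

end

text \<open>Here the partial isometry is the support projection itself.\<close>

lemma modulus_rho: "modulus T (rho L) = ev (rho L)"
proof -
  obtain P where P: "supports P L" using supports_exists by blast
  have *: "P \<in> T" "op_adj P = P" "P o\<^sub>L P = P" "\<And>k. k \<in> set L \<Longrightarrow> P k = k"
    using P by (auto simp: supports_def)
  have "rho L t = rho L (t o\<^sub>L P)" if "t \<in> T" for t
    using that by (auto simp: rho_apply T_comp * intro!: arg_cong[of _ _ sum_list])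
  then show ?thesis
    by (intro modulus_eq[OF P *(1)]) (simp_all add: * rho_in_dual)
qed

end

section \<open>Bounded nets in the weak-* topology\<close>

lemma eventually_in_topology_generated_by:
  assumes "generate_topology_on S U" "x \<in> U" "\<And>V. V \<in> S \<Longrightarrow> x \<in> V \<Longrightarrow> eventually (\<lambda>i. f i \<in> V) F"
  shows "eventually (\<lambda>i. f i \<in> U) F"
  using assms(1,2)
proof (induction rule: generate_topology_on.induct)
  case (Int a b)
  then show ?case by (auto intro: eventually_conj)
next
  case (UN K)
  then obtain k where "k \<in> K" "x \<in> k" by blast
  then have "eventually (\<lambda>i. f i \<in> k) F" using UN.IH by blast
  then show ?case by (rule eventually_mono) (use \<open>k \<in> K\<close> in blast)
qed (use assms(3) in auto)

text \<open>Tannery's theorem, dominated convergence for series, interchanges the limit along the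
  net with the sum in a predual functional. The norm bound supplies the summable majorant.\<close>

lemma bounded_wot_imp_weak_star:
  fixes b :: "'i \<Rightarrow> 'h::chilbert_space \<Rightarrow>\<^sub>L 'h"
  assumes dir: "directed I le" and b: "\<And>i. i \<in> I \<Longrightarrow> b i \<in> bounded_ops"
    and M: "\<And>i. i \<in> I \<Longrightarrow> norm (b i) \<le> M"
    and wot: "\<And>h k. ((\<lambda>i. cinner (b i h) k) \<longlongrightarrow> 0) (tail_filter I le)"
  shows "limitin weak_star_ops b 0 (tail_filter I le)"
proof -
  define F where "F = tail_filter I le"
  have "I \<noteq> {}" and refl: "\<And>i. i \<in> I \<Longrightarrow> le i i"
    using dir by (simp_all add: directed_def)
  have in_I: "eventually (\<lambda>i. i \<in> I) F"
    unfolding F_def eventually_tail_filter[OF dir] using \<open>I \<noteq> {}\<close> by blast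
  \<comment> \<open>By reflexivity every tail is nonempty, so the filter is proper, as Tannery's
    theorem asks.\<close>
  have nb: "F \<noteq> bot"
    unfolding eventually_False[symmetric] F_def eventually_tail_filter[OF dir]
    using refl by blast
  have zero: "(0 :: 'h \<Rightarrow>\<^sub>L 'h) \<in> bounded_ops" by (simp add: bounded_ops_def)
  have p_lim: "((\<lambda>i. p (b i)) \<longlongrightarrow> 0) F" and p_0: "p 0 = 0" if "p \<in> predual_functionals" for p
  proof -
    obtain h k where p: "p = (\<lambda>S. \<Sum>n. cinner (blinfun_apply S (h n)) (k n))"
      and h: "summable (\<lambda>n::nat. (norm (h n))\<^sup>2)" and k: "summable (\<lambda>n. (norm (k n))\<^sup>2)"
      using \<open>p \<in> predual_functionals\<close> unfolding predual_functionals_def by blast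
    show "p 0 = 0" by (simp add: p)
    have "\<forall>n. \<forall>i\<in>I. norm (cinner (b i (h n)) (k n)) \<le> \<bar>M\<bar> * ((norm (h n))\<^sup>2 + (norm (k n))\<^sup>2)"
    proof (intro allI ballI)
      fix n i assume i: "i \<in> I"
      have "cmod (cinner (b i (h n)) (k n)) \<le> norm (b i (h n)) * norm (k n)" by (rule cmod_cinner_le)
      also have "\<dots> \<le> (norm (b i) * norm (h n)) * norm (k n)"
        by (intro mult_right_mono norm_blinfun) simp
      also have "\<dots> \<le> (\<bar>M\<bar> * norm (h n)) * norm (k n)"
        using M[OF i] by (intro mult_right_mono) auto
      also have "\<dots> = \<bar>M\<bar> * (norm (h n) * norm (k n))" by (simp add: mult_ac)
      also have "norm (h n) * norm (k n) \<le> (norm (h n))\<^sup>2 + (norm (k n))\<^sup>2"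
        using sum_squares_bound[of "norm (h n)" "norm (k n)"]
          mult_nonneg_nonneg[OF norm_ge_zero[of "h n"] norm_ge_zero[of "k n"]] by linarith
      finally show "cmod (cinner (b i (h n)) (k n)) \<le> \<bar>M\<bar> * ((norm (h n))\<^sup>2 + (norm (k n))\<^sup>2)"
        by (simp add: mult_left_mono)
    qed
    then have bd: "eventually (\<lambda>(n, i). norm (cinner (b i (h n)) (k n)) \<le>
        \<bar>M\<bar> * ((norm (h n))\<^sup>2 + (norm (k n))\<^sup>2)) (at_top \<times>\<^sub>F F)"
      unfolding eventually_prod_filter using in_I
      by (intro exI[of _ "\<lambda>_. True"] exI[of _ "\<lambda>i. i \<in> I"]) auto
    have "((\<lambda>i. suminf (\<lambda>n. cinner (b i (h n)) (k n))) \<longlongrightarrow> suminf (\<lambda>n. 0)) F"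
      using tannerys_theorem[OF wot[folded F_def] bd summable_mult[OF summable_add[OF h k]] nb] by blast
    then show "((\<lambda>i. p (b i)) \<longlongrightarrow> 0) F" by (simp add: p)
  qed
  define S where "S = {{x \<in> bounded_ops. p x \<in> U} |p U.
    p \<in> (predual_functionals :: (('h \<Rightarrow>\<^sub>L 'h) \<Rightarrow> complex) set) \<and> open U}"
  have top: "weak_star_ops = topology_generated_by S"
    by (simp add: weak_star_ops_def initial_topology_def S_def)
  \<comment> \<open>The zero functional makes \<open>bounded_ops\<close> a subbasic set, which puts
    0 into the topological space.\<close>
  have "(\<lambda>_. 0) \<in> (predual_functionals :: (('h \<Rightarrow>\<^sub>L 'h) \<Rightarrow> complex) set)"
    unfolding predual_functionals_def
    by (intro CollectI exI[of _ "\<lambda>_. 0"]) simp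
  then have "{x \<in> bounded_ops. (0::complex) \<in> UNIV} \<in> S"
    unfolding S_def by blast
  then have "0 \<in> topspace (weak_star_ops :: ('h \<Rightarrow>\<^sub>L 'h) topology)"
    using zero by (auto simp: top)
  moreover have "eventually (\<lambda>i. b i \<in> U) F" if U: "openin weak_star_ops U" "0 \<in> U" for U
  proof (rule eventually_in_topology_generated_by[of S U 0])
    show "generate_topology_on S U"
      using U(1) by (simp add: top openin_topology_generated_by_iff)
    fix V assume "V \<in> S" and 0: "0 \<in> V"
    then obtain p G where p: "p \<in> predual_functionals" "open G" and V: "V = {x \<in> bounded_ops. p x \<in> G}"
      by (auto simp: S_def)
    have "eventually (\<lambda>i. p (b i) \<in> G) F"
      using 0 p_0[OF p(1)] by (intro topological_tendstoD[OF p_lim[OF p(1)] p(2)]) (simp add: V)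
    with in_I show "eventually (\<lambda>i. b i \<in> V) F"
      by eventually_elim (simp add: V b)
  qed (rule U(2))
  ultimately show ?thesis by (simp add: limitin_def F_def)
qed

context algebra_with_compacts
begin

section \<open>Vector functionals are absolutely continuous\<close>

text \<open>The partial isometry sends k / |k| to h / |h|, so the modulus sees k alone. Only this is
  recorded; for the zero functional the list is empty.\<close>

lemma modulus_vf:
  "\<exists>L. modulus T (vf h k) = ev (rho L) \<and>
    (\<forall>\<xi>\<in>bidual T. rep \<xi> k = 0 \<longrightarrow> (\<forall>l\<in>set L. rep \<xi> l = 0))"
proof (cases "h = 0 \<or> k = 0")
  case True
  then have "vf h k = rho []"
    by (intro dual_eqI vf_in_dual rho_in_dual) (auto simp: vf_apply rho_apply)
  then show ?thesis using modulus_rho[of "[]"] by (intro exI[of _ "[]"]) simp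
next
  case False
  define e where "e = inverse (norm h) *\<^sub>R h"
  define f where "f = inverse (norm k) *\<^sub>R k"
  \<comment> \<open>c^2 = |h| |k| is the norm of the functional, hence the total mass of its
    modulus.\<close>
  define c where "c = sqrt (norm h * norm k)"
  have e: "norm e = 1" and f: "norm f = 1" using False by (simp_all add: e_def f_def)
  have h: "h = norm h *\<^sub>R e" and k: "k = norm k *\<^sub>R f" using False by (simp_all add: e_def f_def)
  have c: "c \<noteq> 0" "c * c = norm h * norm k" using False by (simp_all add: c_def)
  have ee: "cinner e e = 1" "cinner f f = 1" using e f by (simp_all add: cinner_self)
  have "modulus T (vf h k) = ev (rho [c *\<^sub>R f])"
  proof (rule modulus_eq[OF supports_single[OF f c(1)] T_rank_one[of e f]])
    show "op_adj (rank_one e f) o\<^sub>L rank_one e f = rank_one f f"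
      by (rule blinfun_eqI) (simp add: op_adj_rank_one cinner_scaleC_left ee)
    show "rank_one e f o\<^sub>L rank_one f f = rank_one e f"
      by (rule blinfun_eqI) (simp add: cinner_scaleC_left ee)
    show "vf h k t = rho [c *\<^sub>R f] (t o\<^sub>L rank_one e f)" if t: "t \<in> T" for t
    proof -
      have "rho [c *\<^sub>R f] (t o\<^sub>L rank_one e f) = of_real c * (of_real c * cinner (t e) f)"
        using t by (simp add: rho_apply T_comp T_rank_one bounded_ops_scaleC T_bounded del: rho.simps)
          (simp add: cinner_scaleC_left cinner_scaleR_left cinner_scaleR_right ee)
      also have "\<dots> = of_real (c * c) * cinner (t e) f" by simp
      also have "\<dots> = cinner (t (norm h *\<^sub>R e)) (norm k *\<^sub>R f)"
        unfolding c by (simp add: blinfun.scaleR_right cinner_scaleR_left cinner_scaleR_right)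
      also have "\<dots> = vf h k t" using t by (simp add: vf_apply h[symmetric] k[symmetric])
      finally show ?thesis ..
    qed
  qed (rule vf_in_dual)
  then show ?thesis
    by (intro exI[of _ "[c *\<^sub>R f]"]) (simp add: f_def rep_scaleR)
qed

lemma abs_cont_vf_rho:
  assumes "\<And>\<xi>. \<xi> \<in> bidual T \<Longrightarrow> \<forall>l\<in>set L. rep \<xi> l = 0 \<Longrightarrow> rep \<xi> k = 0"
  shows "abs_cont T (vf h k) (rho L)"
proof -
  obtain L' where L': "modulus T (vf h k) = ev (rho L')"
    "\<And>\<xi> l. \<xi> \<in> bidual T \<Longrightarrow> rep \<xi> k = 0 \<Longrightarrow> l \<in> set L' \<Longrightarrow> rep \<xi> l = 0"
    using modulus_vf by blast
  have zero_iff: "ev (rho M) (bmult T (bstar T \<xi>) \<xi>) = 0 \<longleftrightarrow> (\<forall>l\<in>set M. rep \<xi> l = 0)"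
    if "\<xi> \<in> bidual T" for \<xi> M
    by (simp only: ev_apply bmult_in_bidual bstar_in_bidual rho_square_eq_0_iff that)
  show ?thesis
    unfolding abs_cont_def modulus_rho L'(1)
  proof (intro ballI impI)
    fix \<xi> assume \<xi>: "\<xi> \<in> bidual T" and "ev (rho L) (bmult T (bstar T \<xi>) \<xi>) = 0"
    then have "rep \<xi> k = 0" using assms zero_iff by blast
    then show "ev (rho L') (bmult T (bstar T \<xi>) \<xi>) = 0"
      using L'(2)[OF \<xi>] zero_iff[OF \<xi>] by blast
  qed
qed

lemma rho_append: "rho (L @ M) = rho L + rho M"
  by (induction L) (simp_all only: append.simps rho.simps add_0 add.assoc)

lemma rho_map_scaleR: "rho (map ((*\<^sub>R) s) L) t = of_real (s\<^sup>2) * rho L t"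
proof (cases "t \<in> T")
  case True
  then show ?thesis
    by (induction L) (simp_all add: vf_apply blinfun.scaleR_right cinner_scaleR_left cinner_scaleR_right
      algebra_simps power2_eq_square)
qed (simp add: dual_outside rho_in_dual)

section \<open>Generators of Delta_star of finite rank and the vectors they dominate\<close>

context
  fixes A :: "('h \<Rightarrow>\<^sub>L 'h) set"
  assumes A: "A \<subseteq> T"
begin

definition Delta_generators :: "'h functional set" where
  "Delta_generators = {modulus_restr T (dagger T \<phi>) |\<phi>. \<phi> \<in> annihilator A T \<and> fnorm T \<phi> = 1}"

lemma rho_in_Delta_generators_noncyclic:
  assumes k: "norm k = 1" and g: "norm g = 1" and orth: "\<And>a. a \<in> A \<Longrightarrow> cinner (blinfun_apply a k) g = 0"
  shows "rho [k] \<in> Delta_generators"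
proof -
  have ee: "cinner k k = 1" "cinner g g = 1" using k g by (simp_all add: cinner_self)
  have supp: "supports (rank_one k k) [k]" using supports_single[OF k, of 1] by simp
  have v: "rank_one g k \<in> T" by (rule T_rank_one)
  have 1: "op_adj (rank_one g k) o\<^sub>L rank_one g k = rank_one k k"
    by (rule blinfun_eqI) (simp add: op_adj_rank_one cinner_scaleC_left ee)
  have 2: "rank_one g k o\<^sub>L rank_one k k = rank_one g k"
    by (rule blinfun_eqI) (simp add: cinner_scaleC_left ee)
  have 3: "vf g k t = rho [k] (t o\<^sub>L rank_one g k)" if "t \<in> T" for t
    using that by (simp add: rho_apply T_comp T_rank_one ee vf_apply del: rho.simps)
  \<comment> \<open>The adjoint swaps the two vectors, so the modulus is carried by k and not by
    g.\<close>
  have "modulus_restr T (dagger T (vf k g)) = rho [k]"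
    unfolding dagger_vf by (rule modulus_restr_eq[OF supp v 1 2 vf_in_dual 3])
  moreover have "fnorm T (vf k g) = 1"
    using fnorm_eq[OF supp v 1 2 vf_in_dual 3] fnorm_dagger[OF vf_in_dual, of k g] k by (simp add: dagger_vf)
  moreover have "vf k g \<in> annihilator A T"
    using A orth by (auto simp: annihilator_def vf_in_dual vf_apply)
  ultimately show ?thesis unfolding Delta_generators_def by (intro CollectI exI[of _ "vf k g"]) simp
qed

text \<open>A Jordan decomposition: e and f are orthonormal, v is 1 on e and -1 on f, and composing
  with v removes the sign. The difference of the two vector functionals has norm 2; the factor 1/2
  in \<phi>, matched by s^2 = 1/2, brings it to 1.\<close>

lemma rho_in_Delta_generators_pair:
  assumes e: "norm e = 1" and f: "norm f = 1" and ef: "cinner e f = 0"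
    and eq: "\<And>a. a \<in> A \<Longrightarrow> cinner (blinfun_apply a e) e = cinner (blinfun_apply a f) f"
    and s: "s = 1 / sqrt 2"
  shows "rho [s *\<^sub>R e, s *\<^sub>R f] \<in> Delta_generators"
proof -
  define \<phi> where "\<phi> = (1/2) *\<^sub>C (vf e e + (-1) *\<^sub>C vf f f)"
  define v where "v = rank_one e e - rank_one f f"
  have \<phi>: "\<phi> \<in> dual T"
    unfolding \<phi>_def by (intro dual_closed_scaleC dual_closed_add vf_in_dual)
  have \<phi>_apply: "\<phi> t = (cinner (t e) e - cinner (t f) f) / 2" if "t \<in> T" for t
    using that by (simp add: \<phi>_def scaleC_fun_apply vf_apply)
  have dag: "dagger T \<phi> = \<phi>"
    by (simp only: \<phi>_def dagger_scaleC dagger_add dagger_vf) simp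
  have s0: "s \<noteq> 0" and ss: "s * s = 1/2" using s by (simp_all add: real_sqrt_mult[symmetric])
  have fe: "cinner f e = 0" using ef cinner_commute[of f e] by simp
  have ip: "cinner e e = 1" "cinner f f = 1" "cinner e f = 0" "cinner f e = 0"
    using e f ef fe by (simp_all add: cinner_self)
  have supp: "supports (rank_one f f + rank_one e e) [s *\<^sub>R e, s *\<^sub>R f]"
    by (rule supports_pair[OF e f ef s0])
  have v: "v \<in> T" unfolding v_def by (intro T_diff T_rank_one)
  have "op_adj v = v"
  proof (rule op_adj_eqI)
    show "cinner (v x) y = cinner x (v y)" for x y
      by (simp add: v_def blinfun.diff_left cinner_diff_left cinner_diff_right cinner_scaleC_left
        cinner_scaleC_right cinner_commute[of e y] cinner_commute[of f y] mult.commute)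
  qed (rule T_bounded[OF v])
  have v_apply: "v x = cinner x e *\<^sub>C e - cinner x f *\<^sub>C f" for x
    by (simp add: v_def blinfun.diff_left)
  have ve: "v e = e" "v f = - f"
    by (simp_all add: v_apply ip)
  have v_lin: "v (c *\<^sub>C e) = c *\<^sub>C e" "v (c *\<^sub>C f) = - (c *\<^sub>C f)" for c
    using scaleC_diff_right[of c 0 f] by (simp_all add: bounded_ops_scaleC T_bounded v ve)
  have 1: "op_adj v o\<^sub>L v = rank_one f f + rank_one e e"
  proof (rule blinfun_eqI)
    fix x
    have "v (v x) = v (cinner x e *\<^sub>C e) - v (cinner x f *\<^sub>C f)"
      by (simp only: v_apply[of x] blinfun.diff_right)
    then show "(op_adj v o\<^sub>L v) x = (rank_one f f + rank_one e e) x"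
      by (simp add: \<open>op_adj v = v\<close> v_lin blinfun.add_left add.commute)
  qed
  have 2: "v o\<^sub>L (rank_one f f + rank_one e e) = v"
    by (rule blinfun_eqI) (simp add: blinfun.add_left blinfun.add_right v_lin, simp add: v_apply)
  have 3: "\<phi> t = rho [s *\<^sub>R e, s *\<^sub>R f] (t o\<^sub>L v)" if t: "t \<in> T" for t
  proof -
    have "rho [s *\<^sub>R e, s *\<^sub>R f] (t o\<^sub>L v) = of_real (s * s) * (cinner (t e) e - cinner (t f) f)"
      using t v by (simp add: rho_apply T_comp blinfun.scaleR_right blinfun.minus_right ve cinner_scaleR_left cinner_scaleR_right
          cinner_minus_left algebra_simps del: rho.simps)
    then show ?thesis by (simp add: ss \<phi>_apply t)
  qed
  have "modulus_restr T (dagger T \<phi>) = rho [s *\<^sub>R e, s *\<^sub>R f]"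
    unfolding dag by (rule modulus_restr_eq[OF supp v 1 2 \<phi> 3])
  moreover have "fnorm T \<phi> = 1"
    using fnorm_eq[OF supp v 1 2 \<phi> 3] e f ss by (simp add: power_mult_distrib power2_eq_square)
  moreover have "\<phi> \<in> annihilator A T"
    using A eq by (auto simp: annihilator_def \<phi> \<phi>_apply)
  ultimately show ?thesis unfolding Delta_generators_def by (intro CollectI exI[of _ \<phi>]) simp
qed

text \<open>Polar decompositions are only available in finite rank, so the definite description in
  \<^const>\<open>modulus\<close> might denote junk for other functionals, possibly outside the dual. This is
  why only the part of \<^const>\<open>Delta_star\<close> generated by functionals of finite rank is used.\<close>

definition Delta_fin :: "'h functional set" where
  "Delta_fin = norm_closure T (convex hull (Delta_generators \<inter> range rho))"

lemma Delta_fin_subset: "Delta_fin \<subseteq> Delta_star A T"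
proof -
  have "convex hull (Delta_generators \<inter> range rho) \<subseteq> convex hull Delta_generators" by (rule hull_mono) simp
  then show ?thesis unfolding Delta_fin_def Delta_star_def norm_closure_def Delta_generators_def[symmetric] by blast
qed

lemma scaleR_fun_scaleC: "r *\<^sub>R (\<psi> :: 'h functional) = of_real r *\<^sub>C \<psi>"
  by (rule ext) (simp add: scaleR_fun_def scaleC_fun_apply scaleR_conv_of_real)

lemma hull_subset_dual: "convex hull (Delta_generators \<inter> range rho) \<subseteq> dual T"
proof (rule hull_minimal)
  show "convex (dual T)"
    unfolding convex_def scaleR_fun_scaleC by (blast intro: dual_closed_add dual_closed_scaleC)
qed (auto simp: rho_in_dual)

lemma rho_in_Delta_fin:
  assumes "rho L \<in> Delta_generators"
  shows "rho L \<in> Delta_fin"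
proof -
  have "rho L \<in> convex hull (Delta_generators \<inter> range rho)"
    using assms by (intro hull_inc) simp
  moreover have "fnorm T (rho L - rho L) \<le> 0" by (rule fnorm_le) simp_all
  ultimately show ?thesis
    unfolding Delta_fin_def norm_closure_def by (force simp: rho_in_dual)
qed

text \<open>The midpoint case of convexity of a norm closure, by averaging approximants;
  \<open>dominated_add\<close> uses exactly this average.\<close>

lemma Delta_fin_half:
  assumes "\<delta> \<in> Delta_fin" "\<delta>' \<in> Delta_fin"
  shows "(1/2) *\<^sub>C \<delta> + (1/2) *\<^sub>C \<delta>' \<in> Delta_fin"
proof -
  have d: "\<delta> \<in> dual T" "\<delta>' \<in> dual T"
    using assms by (auto simp: Delta_fin_def norm_closure_def)
  have "\<exists>\<psi>\<in>convex hull (Delta_generators \<inter> range rho). fnorm T ((1/2) *\<^sub>C \<delta> + (1/2) *\<^sub>C \<delta>' - \<psi>) < \<epsilon>" if "\<epsilon> > 0" for \<epsilon>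
  proof -
    obtain \<psi> \<psi>' where \<psi>: "\<psi> \<in> convex hull (Delta_generators \<inter> range rho)" "fnorm T (\<delta> - \<psi>) < \<epsilon>"
      and \<psi>': "\<psi>' \<in> convex hull (Delta_generators \<inter> range rho)" "fnorm T (\<delta>' - \<psi>') < \<epsilon>"
      using assms \<open>\<epsilon> > 0\<close> unfolding Delta_fin_def norm_closure_def by blast
    define \<theta> where "\<theta> = (1/2) *\<^sub>R \<psi> + (1/2) *\<^sub>R \<psi>'"
    have \<theta>: "\<theta> \<in> convex hull (Delta_generators \<inter> range rho)"
      unfolding \<theta>_def by (intro convexD convex_convex_hull \<psi>(1) \<psi>'(1)) simp_all
    have p: "\<psi> \<in> dual T" "\<psi>' \<in> dual T" using \<psi> \<psi>' hull_subset_dual by auto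
    have dp: "\<delta> - \<psi> \<in> dual T" "\<delta>' - \<psi>' \<in> dual T"
      unfolding fun_diff_scaleC using d p by (blast intro: dual_closed_add dual_closed_scaleC)+
    have "fnorm T ((1/2) *\<^sub>C \<delta> + (1/2) *\<^sub>C \<delta>' - \<theta>) \<le> (fnorm T (\<delta> - \<psi>) + fnorm T (\<delta>' - \<psi>')) / 2"
    proof (rule fnorm_le)
      fix t assume t: "t \<in> T"
      have "((1/2) *\<^sub>C \<delta> + (1/2) *\<^sub>C \<delta>' - \<theta>) t = ((\<delta> - \<psi>) t + (\<delta>' - \<psi>') t) / 2"
        by (simp add: scaleC_fun_apply \<theta>_def scaleR_fun_def scaleR_conv_of_real field_simps)
      then have "cmod (((1/2) *\<^sub>C \<delta> + (1/2) *\<^sub>C \<delta>' - \<theta>) t) \<le> (cmod ((\<delta> - \<psi>) t) + cmod ((\<delta>' - \<psi>') t)) / 2"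
        by (simp only: norm_divide) (simp add: norm_triangle_ineq)
      then show "cmod (((1/2) *\<^sub>C \<delta> + (1/2) *\<^sub>C \<delta>' - \<theta>) t) \<le>
          (fnorm T (\<delta> - \<psi>) + fnorm T (\<delta>' - \<psi>')) / 2 * norm t"
        using cmod_le_fnorm[OF dp(1) t] cmod_le_fnorm[OF dp(2) t]
        by (simp add: algebra_simps add_divide_distrib)
    qed (use fnorm_nonneg[OF dp(1)] fnorm_nonneg[OF dp(2)] in simp)
    then show ?thesis using \<psi>(2) \<psi>'(2) \<theta> by force
  qed
  then show ?thesis
    unfolding Delta_fin_def norm_closure_def using d
    by (blast intro: dual_closed_add dual_closed_scaleC)
qed

lemma rho_closure_in_Delta_fin:
  assumes k: "norm k = 1" and approx: "\<And>\<epsilon>. \<epsilon> > 0 \<Longrightarrow> \<exists>u. norm u = 1 \<and> norm (u - k) < \<epsilon> \<and> rho [u] \<in> Delta_generators"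
  shows "rho [k] \<in> Delta_fin"
proof -
  have "\<exists>\<psi>\<in>convex hull (Delta_generators \<inter> range rho). fnorm T (rho [k] - \<psi>) < \<epsilon>" if "\<epsilon> > 0" for \<epsilon>
  proof -
    obtain u where u: "norm u = 1" "norm (u - k) < \<epsilon> / 2" "rho [u] \<in> Delta_generators"
      using approx[of "\<epsilon> / 2"] \<open>\<epsilon> > 0\<close> by auto
    \<comment> \<open>The two occurrences of k are replaced by u one at a time; for unit vectors
      each replacement costs at most |u - k|.\<close>
    have "fnorm T (rho [k] - rho [u]) \<le> 2 * norm (u - k)"
    proof (rule fnorm_le)
      fix t assume t: "t \<in> T"
      have "(rho [k] - rho [u]) t = cinner (t (k - u)) k + cinner (t u) (k - u)"
        using t by (simp add: vf_apply blinfun.diff_right cinner_diff_left cinner_diff_right)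
      also have "cmod \<dots> \<le> norm (k - u) * norm k * norm t + norm u * norm (k - u) * norm t"
        by (intro norm_triangle_mono vf_bound)
      also have "\<dots> = 2 * norm (u - k) * norm t"
        using k u(1) by (simp add: norm_minus_commute)
      finally show "cmod ((rho [k] - rho [u]) t) \<le> 2 * norm (u - k) * norm t" .
    qed simp
    moreover have "rho [u] \<in> convex hull (Delta_generators \<inter> range rho)"
      using u(3) by (intro hull_inc IntI rangeI)
    ultimately show ?thesis using u(2) by force
  qed
  then show ?thesis
    unfolding Delta_fin_def norm_closure_def using rho_in_dual by blast
qed

text \<open>Absolute continuity of \<open>vf x x\<close> with respect to \<open>rho L\<close>, put
  in terms of vectors; in this form the condition is linear in x.\<close>

definition dominated :: "'h \<Rightarrow> bool" where
  "dominated x \<longleftrightarrow> (\<exists>L. rho L \<in> Delta_fin \<and>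
    (\<forall>\<xi>\<in>bidual T. (\<forall>l\<in>set L. rep \<xi> l = 0) \<longrightarrow> rep \<xi> x = 0))"

lemma dominated_scaleR: "dominated x \<Longrightarrow> dominated (r *\<^sub>R x)"
  unfolding dominated_def by (auto simp: rep_scaleR)

lemma dominated_add:
  assumes "dominated x" "dominated y"
  shows "dominated (x + y)"
proof -
  obtain L M where L: "rho L \<in> Delta_fin" "\<And>\<xi>. \<xi> \<in> bidual T \<Longrightarrow> \<forall>l\<in>set L. rep \<xi> l = 0 \<Longrightarrow> rep \<xi> x = 0"
    and M: "rho M \<in> Delta_fin" "\<And>\<xi>. \<xi> \<in> bidual T \<Longrightarrow> \<forall>l\<in>set M. rep \<xi> l = 0 \<Longrightarrow> rep \<xi> y = 0"
    using assms unfolding dominated_def by blast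
  \<comment> \<open>s^2 = 1/2 turns the average of two functionals into the functional of one scaled
    list.\<close>
  define s where "s = 1 / sqrt 2"
  have s: "s \<noteq> 0" "s\<^sup>2 = 1/2" by (simp_all add: s_def power_divide)
  define N where "N = map ((*\<^sub>R) s) (L @ M)"
  have "rho N = (1/2) *\<^sub>C rho L + (1/2) *\<^sub>C rho M"
    by (rule ext) (simp add: N_def rho_append rho_map_scaleR scaleC_fun_apply s(2) algebra_simps del: map_append)
  then have "rho N \<in> Delta_fin" using Delta_fin_half[OF L(1) M(1)] by simp
  moreover have "rep \<xi> (x + y) = 0" if "\<xi> \<in> bidual T" "\<forall>l\<in>set N. rep \<xi> l = 0" for \<xi>
  proof -
    have "rep \<xi> l = 0" if "l \<in> set (L @ M)" for l
      using \<open>\<forall>l\<in>set N. rep \<xi> l = 0\<close> \<open>\<xi> \<in> bidual T\<close> s(1) that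
      unfolding N_def by (simp add: rep_scaleR ball_Un image_iff) blast
    then show ?thesis
      using L(2)[OF that(1)] M(2)[OF that(1)] by (simp add: rep_add that(1))
  qed
  ultimately show ?thesis unfolding dominated_def by blast
qed

lemma dominated_imp_AC:
  assumes "dominated k"
  shows "vf h k \<in> AC T (Delta_star A T)"
  using assms abs_cont_vf_rho[of _ k h] Delta_fin_subset vf_in_dual
  unfolding dominated_def AC_def by blast

lemma dominated_if_rho: "rho L \<in> Delta_fin \<Longrightarrow> c \<noteq> 0 \<Longrightarrow> c *\<^sub>R x \<in> set L \<Longrightarrow> dominated x"
  unfolding dominated_def by (metis rep_scaleR scaleR_eq_0_iff)

end

end

text \<open>Project a vector outside the closure of A k onto that closed subspace and normalize the
  difference.\<close>

lemma orthogonal_unit_vector_of_noncyclic: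
  fixes A :: "('h::chilbert_space \<Rightarrow>\<^sub>L 'h) set"
  assumes A: "unital_closed_subalgebra A" and k: "\<not> cyclic_vector A k"
  shows "\<exists>g. norm g = 1 \<and> (\<forall>a\<in>A. cinner (blinfun_apply a k) g = 0)"
proof -
  define M where "M = {blinfun_apply a k |a. a \<in> A}"
  have add: "a + b \<in> A" and scale: "c *\<^sub>C a \<in> A" if "a \<in> A" "b \<in> A" for a b c
    using A that by (auto simp: unital_closed_subalgebra_def)
  have id: "id_blinfun \<in> A" using A by (simp add: unital_closed_subalgebra_def)
  have "csubspace M"
    unfolding csubspace_def
  proof (intro conjI ballI allI)
    show "0 \<in> M"
      unfolding M_def using scale[OF id id, of 0] by (intro CollectI exI[of _ "0 *\<^sub>C id_blinfun"]) simp
    show "x + y \<in> M" if "x \<in> M" "y \<in> M" for x y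
    proof -
      obtain a b where "x = blinfun_apply a k" "y = blinfun_apply b k" "a \<in> A" "b \<in> A" using \<open>x \<in> M\<close> \<open>y \<in> M\<close> unfolding M_def by blast
      then show ?thesis
        unfolding M_def using add by (intro CollectI exI[of _ "a + b"]) (simp add: blinfun.add_left)
    qed
    show "c *\<^sub>C x \<in> M" if "x \<in> M" for c x
    proof -
      obtain a where "x = blinfun_apply a k" "a \<in> A" using \<open>x \<in> M\<close> unfolding M_def by blast
      then show ?thesis
        unfolding M_def using scale[of a a] by (intro CollectI exI[of _ "c *\<^sub>C a"]) simp
    qed
  qed
  then have sub: "csubspace (closure M)" by (rule csubspace_closure)
  obtain x where x: "x \<notin> closure M"
    using k by (auto simp: cyclic_vector_def M_def)
  obtain m where m: "m \<in> closure M" and orth: "\<And>y. y \<in> closure M \<Longrightarrow> cinner (x - m) y = 0"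
    using orthogonal_projection[OF sub closed_closure] by blast
  define g where "g = inverse (norm (x - m)) *\<^sub>R (x - m)"
  have "x - m \<noteq> 0" using m x by auto
  then have "norm g = 1" by (simp add: g_def)
  moreover have "cinner (blinfun_apply a k) g = 0" if "a \<in> A" for a
  proof -
    have "blinfun_apply a k \<in> closure M" using that closure_subset by (force simp: M_def)
    then have "cinner (x - m) (blinfun_apply a k) = 0" by (rule orth)
    then have "cinner (blinfun_apply a k) (x - m) = 0" using cinner_commute[of "blinfun_apply a k" "x - m"] by simp
    then show ?thesis by (simp add: g_def cinner_scaleR_right)
  qed
  ultimately show ?thesis by blast
qed

section \<open>All vectors are dominated, and coanalyticity\<close>

context algebra_with_compacts
begin

context
  fixes A :: "('h \<Rightarrow>\<^sub>L 'h) set" and \<Gamma> :: "'h set"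
  assumes A: "unital_closed_subalgebra A" and AT: "A \<subseteq> T"
    and \<Gamma>: "csubspace \<Gamma>" and noncyclic: "\<And>x. x \<in> \<Gamma> \<Longrightarrow> \<not> cyclic_vector A x"
    and partner: "\<And>h. h \<in> orth_complement \<Gamma> \<Longrightarrow> \<exists>h'\<in>\<Gamma>. \<forall>a\<in>A.
      cinner (blinfun_apply a h) h - cinner (blinfun_apply a h') h' = 0"
begin

lemma dominated_closure:
  assumes g: "g \<in> closure \<Gamma>" "g \<noteq> 0"
  shows "dominated A g"
proof -
  define k where "k = inverse (norm g) *\<^sub>R g"
  have k: "norm k = 1" using g by (simp add: k_def)
  have "k \<in> closure \<Gamma>"
    unfolding k_def by (intro csubspace_scaleR csubspace_closure \<Gamma> g(1))
  have approx: "\<exists>u. norm u = 1 \<and> norm (u - k) < \<epsilon> \<and> rho [u] \<in> Delta_generators A" if "\<epsilon> > 0" for \<epsilon>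
  proof -
    \<comment> \<open>The 1 keeps x away from 0, as k is a unit vector. The bound \<epsilon> / 2 is
      enough because normalizing x moves it by at most its distance to k.\<close>
    obtain x where x: "x \<in> \<Gamma>" "dist x k < min (\<epsilon> / 2) 1"
      using \<open>k \<in> closure \<Gamma>\<close> \<open>\<epsilon> > 0\<close> unfolding closure_approachable
      by (metis half_gt_zero min_less_iff_conj zero_less_one)
    then have d: "norm (x - k) < \<epsilon> / 2" "norm (x - k) < 1" by (simp_all add: dist_norm)
    then have "x \<noteq> 0" using k by auto
    define u where "u = inverse (norm x) *\<^sub>R x"
    have u: "norm u = 1" using \<open>x \<noteq> 0\<close> by (simp add: u_def)
    have "u \<in> \<Gamma>" unfolding u_def by (rule csubspace_scaleR[OF \<Gamma> x(1)])
    have "x = norm x *\<^sub>R u"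
      using \<open>x \<noteq> 0\<close> by (simp add: u_def)
    then have "u - x = (1 - norm x) *\<^sub>R u"
      by (metis scaleR_left_diff_distrib scaleR_one)
    then have "norm (u - x) = \<bar>norm k - norm x\<bar>" using u k by simp
    also have "\<dots> \<le> norm (k - x)" by (rule norm_triangle_ineq3)
    finally have "norm (u - x) \<le> norm (x - k)" by (simp add: norm_minus_commute)
    moreover have "norm (u - k) \<le> norm (u - x) + norm (x - k)"
      using norm_triangle_ineq[of "u - x" "x - k"] by simp
    ultimately have "norm (u - k) < \<epsilon>" using d by linarith
    moreover obtain w where "norm w = 1" "\<forall>a\<in>A. cinner (blinfun_apply a u) w = 0"
      using orthogonal_unit_vector_of_noncyclic[OF A noncyclic[OF \<open>u \<in> \<Gamma>\<close>]] by blast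
    then have "rho [u] \<in> Delta_generators A" using rho_in_Delta_generators_noncyclic[OF AT u] by blast
    ultimately show ?thesis using u by blast
  qed
  have "rho [k] \<in> Delta_fin A" by (rule rho_closure_in_Delta_fin[OF AT k approx])
  then show ?thesis
    by (rule dominated_if_rho[OF AT, of _ "inverse (norm g)"]) (use g in \<open>simp_all add: k_def\<close>)
qed

lemma dominated_orth_complement:
  assumes h: "h \<in> orth_complement \<Gamma>" "h \<noteq> 0"
  shows "dominated A h"
proof -
  obtain h' where h': "h' \<in> \<Gamma>" "\<And>a. a \<in> A \<Longrightarrow> cinner (blinfun_apply a h) h = cinner (blinfun_apply a h') h'"
    using partner[OF h(1)] by auto
  \<comment> \<open>The partner condition at the identity operator compares the norms of h and
    h'.\<close>
  have "id_blinfun \<in> A" using A by (simp add: unital_closed_subalgebra_def)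
  then have "cinner h h = cinner h' h'" using h'(2)[of id_blinfun] by simp
  then have n: "norm h' = norm h"
    by (simp add: cinner_self power2_eq_iff_nonneg del: of_real_power)
  define r where "r = inverse (norm h)"
  have r: "r * norm h = 1" "r \<noteq> 0" "r > 0" using h(2) by (simp_all add: r_def)
  have "cinner (r *\<^sub>R h) (r *\<^sub>R h') = 0"
    using h(1) h'(1) by (simp add: cinner_scaleR_left cinner_scaleR_right orth_complement_def)
  moreover have "cinner (blinfun_apply a (r *\<^sub>R h)) (r *\<^sub>R h) = cinner (blinfun_apply a (r *\<^sub>R h')) (r *\<^sub>R h')" if "a \<in> A" for a
    using h'(2)[OF that] by (simp add: blinfun.scaleR_right cinner_scaleR_left cinner_scaleR_right)
  ultimately have "rho [(1 / sqrt 2) *\<^sub>R r *\<^sub>R h, (1 / sqrt 2) *\<^sub>R r *\<^sub>R h'] \<in> Delta_generators A"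
    using r n by (intro rho_in_Delta_generators_pair[OF AT]) simp_all
  then have "rho [(1 / sqrt 2) *\<^sub>R r *\<^sub>R h, (1 / sqrt 2) *\<^sub>R r *\<^sub>R h'] \<in> Delta_fin A"
    by (rule rho_in_Delta_fin[OF AT])
  then show ?thesis
    by (rule dominated_if_rho[OF AT, of _ "(1 / sqrt 2) * r"]) (use r in simp_all)
qed

lemma all_dominated: "dominated A x"
proof -
  have decomp: "\<exists>g h. x = g + h \<and> g \<in> closure \<Gamma> \<and> h \<in> orth_complement \<Gamma>" for x
  proof -
    obtain m where "m \<in> closure \<Gamma>" "\<And>y. y \<in> closure \<Gamma> \<Longrightarrow> cinner (x - m) y = 0"
      using orthogonal_projection[OF csubspace_closure[OF \<Gamma>] closed_closure] by blast
    then show ?thesis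
      using closure_subset[of \<Gamma>]
      by (intro exI[of _ m] exI[of _ "x - m"]) (auto simp: orth_complement_def)
  qed
  \<comment> \<open>Both cases above normalize and so leave out 0, yet \<open>dominated A 0\<close>
    still asks for some \<open>rho L\<close> in \<open>Delta_fin A\<close>. One comes from a
    component of a nonzero vector z, which exists because 0 is non-cyclic: in the zero space {0}
    would be dense.\<close>
  have "0 \<in> \<Gamma>" using \<Gamma> by (simp add: csubspace_def)
  then have "closure {blinfun_apply a (0::'h) |a. a \<in> A} \<noteq> UNIV"
    using noncyclic[of 0] unfolding cyclic_vector_def by blast
  then obtain z :: 'h where "z \<notin> closure {blinfun_apply a 0 |a. a \<in> A}" by blast
  moreover have "blinfun_apply id_blinfun (0::'h) \<in> closure {blinfun_apply a 0 |a. a \<in> A}"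
    using A unfolding unital_closed_subalgebra_def by (intro subsetD[OF closure_subset]) blast
  ultimately have "z \<noteq> 0" by (auto simp only: id_blinfun.rep_eq)
  obtain g h where z: "z = g + h" "g \<in> closure \<Gamma>" "h \<in> orth_complement \<Gamma>"
    using decomp by blast
  then have "dominated A g \<or> dominated A h"
    using dominated_closure dominated_orth_complement \<open>z \<noteq> 0\<close> by (metis add_0)
  then have dom0: "dominated A 0"
    using dominated_scaleR[OF AT, of _ 0] by auto
  obtain g h where x: "x = g + h" "g \<in> closure \<Gamma>" "h \<in> orth_complement \<Gamma>"
    using decomp by blast
  have "dominated A g" "dominated A h"
    using dominated_closure[OF x(2)] dominated_orth_complement[OF x(3)] dom0 by (cases "g = 0"; cases "h = 0"; simp)+
  then show ?thesis unfolding x(1) by (rule dominated_add[OF AT])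
qed

lemma vf_in_AC: "vf h k \<in> AC T (Delta_star A T)"
  by (rule dominated_imp_AC[OF AT all_dominated])

text \<open>The value of \<open>vf k h\<close> at the adjoint of \<open>b i\<close> is the conjugate
  of \<langle>b i h, k\<rangle>. So the hypothesis on the net gives weak operator convergence to 0,
  which for bounded nets is weak-* convergence.\<close>

lemma coanalytic_triple: "coanalytic TYPE('i) A T"
  unfolding coanalytic_def
proof (intro allI impI, elim conjE exE)
  fix I :: "'i set" and le b M
  assume dir: "directed I le" and b: "\<forall>i\<in>I. b i \<in> A" and M: "\<forall>i\<in>I. norm (b i) \<le> M"
    and lim: "\<forall>\<alpha>\<in>AC T (Delta_star A T). ((\<lambda>i. \<alpha> (op_adj (b i))) \<longlongrightarrow> 0) (tail_filter I le)"
  have bT: "b i \<in> T" if "i \<in> I" for i using b AT that by blast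
  have "eventually (\<lambda>i. i \<in> I) (tail_filter I le)"
    unfolding eventually_tail_filter[OF dir] using dir unfolding directed_def by blast
  then have eq: "eventually (\<lambda>i. cnj (vf k h (op_adj (b i))) = cinner (b i h) k) (tail_filter I le)" for h k
  proof eventually_elim
    case (elim i)
    have "vf k h (op_adj (b i)) = cinner k (b i h)"
      using bT[OF elim] by (simp add: vf_apply T_adj cinner_op_adj_left T_bounded)
    then show ?case by (simp add: cinner_commute[of "b i h" k])
  qed
  have "((\<lambda>i. cinner (b i h) k) \<longlongrightarrow> 0) (tail_filter I le)" for h k
  proof -
    have "((\<lambda>i. cnj (vf k h (op_adj (b i)))) \<longlongrightarrow> cnj 0) (tail_filter I le)"
      by (intro tendsto_cnj lim[rule_format] vf_in_AC)
    then show ?thesis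
      using tendsto_cong[OF eq] by simp
  qed
  then show "limitin weak_star_ops b 0 (tail_filter I le)"
    using M bT T_bounded by (intro bounded_wot_imp_weak_star[OF dir]) blast+
qed

end

end

theorem proposition4p3:
  fixes A T :: "('h::chilbert_space \<Rightarrow>\<^sub>L 'h) set" and \<Gamma> :: "'h set"
  assumes "unital_cstar_subalgebra T"
    and "unital_closed_subalgebra A" and "A \<subseteq> T"
    and "compact_ops \<subseteq> T"
    and "csubspace \<Gamma>" and "\<forall>x\<in>\<Gamma>. \<not> cyclic_vector A x"
    and "\<forall>h\<in>orth_complement \<Gamma>. \<exists>h'\<in>\<Gamma>. \<forall>a\<in>A.
           cinner (blinfun_apply a h) h - cinner (blinfun_apply a h') h' = 0"
  shows "(\<forall>h k. ext0 T (\<lambda>t. cinner (blinfun_apply t h) k) \<in> AC T (Delta_star A T)) \<and>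
         coanalytic TYPE('i) A T"
proof -
  interpret algebra_with_compacts T
    by unfold_locales fact+
  show ?thesis
    using vf_in_AC[OF assms(2,3,5)] coanalytic_triple[OF assms(2,3,5)] assms(6,7)
    unfolding vf_def by blast
qed

end
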